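(* Let $p:\mathbb{R}\to\mathbb{R}$ be an $L^\infty$ function such that $x'=-x^2+p(t)$ has an attractor-repeller pair $(\tilde a,\tilde r)$, and let $\Gamma:\mathbb{R}\to\mathbb{R}$ be bounded and continuous with finite limits $\lim_{t\to\pm\infty}\Gamma(t)$. For $h\ge0$ consider $$x'=-\big(x-\Gamma^h(t)\big)^2+p(t).\qquad (E_h)$$ (i) Let $\bar t_1<\bar t_2$ satisfy $\mathfrak{a}_0(\bar t_1)-\Gamma(\bar t_1)>b^{1/2}(\bar t_1)$ and $\mathfrak{r}_0(\bar t_2)-\Gamma(\bar t_2)<b^{1/2}(\bar t_2)$ (in particular $\mathfrak{a}_0$ is defined at $\bar t_1$ and $\mathfrak{r}_0$ at $\bar t_2$). Assume that $\Gamma$ is $C^2$ on $[\bar t_1,\bar t_2]$, with $$\frac14\big(\tilde a(t)-\tilde r(t)\big)^2>\Gamma'(t)\quad\text{for all }t\in[\bar t_1,\bar t_2].$$ Then there exists $h_*>0$ such that $(E_h)$ has an attractor-repeller pair for all $h\in[0,h_*]$. (ii) Assume that $\Gamma$ is $C^2$ on $\mathbb{R}$ and that $$\frac14\inf_{t\in\mathbb{R}}\big(\tilde a(t)-\tilde r(t)\big)^2>\sup_{t\in\mathbb{R}}\Gamma'(t).$$ Then there exists $h_*>0$ such that there is total tracking on the hull $\Omega_p$ of $p$ for $(E_h)$ for all $h\in[0,h_*]$; that is, for every $h\in[0,h_*]$ and every $q\in\Omega_p$ the equation $x'=-(x-\Gamma^h(t))^2+q(t)$ has an attractor-repeller pa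ir.
   Context: Solutions are Carathéodory solutions (absolutely continuous on compact intervals, satisfying the equation for a.e. $t$). For $h>0$, $\Gamma^h(t):=\Gamma(jh)$ for $t\in[jh,(j+1)h)$, $j\in\mathbb{Z}$; and $\Gamma^0:=\Gamma$. $b^\nu:=\nu\,\tilde a+(1-\nu)\,\tilde r$ for $\nu\in[0,1]$. Attractor-repeller pair for $x'=-(x-\Delta(t))^2+q(t)$ ($\Delta,q\in L^\infty(\mathbb{R})$): the pair $(a,r)$ formed by the maximal and minimal bounded solutions on $\mathbb{R}$, when they exist and are hyperbolic with $a$ attractive and $r$ repulsive: there exist $k\ge1,\beta>0$ with $\exp\int_s^t-2(a(l)-\Delta(l))\,dl\le ke^{-\beta(t-s)}$ for $t\ge s$ and $\exp\int_s^t-2(r(l)-\Delta(l))\,dl\le ke^{\beta(t-s)}$ for $t\le s$. This is equivalent to $a,r$ existing with $\inf_{t\in\mathbb{R}}(a(t)-r(t))>0$. Special solutions of $(E_h)$: $\mathfrak{a}_h$ is the maximal solution, defined on $\mathbb{R}$ or on an open half-line unbounded below, such that for each $s$ in its domain the solution with value $x_0$ at $s$ remains bounded as $t\to-\infty$ iff $x_0\le\mathfrak{a}_h(s)$, and which tends to $-\infty$ at the right end of its domain if this is finite. $\mathfrak{r}_h$ is the maximal solution, defined on $\mathbb{R}$ or on an open half-line unbounded above, such that for each $s$ in its domain the solution with value $x_0$ at $s$ remains bounded as $t\to+\infty$ iff $x_0\ge\mathfrak{r}_h(s)$, and which tends to $+\infty$ at the left end of its domain if this is finite. Both exist under the present hypotheses.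 Hull: $p_s(t):=p(s+t)$; $\Omega_p$ is the closure of $\{p_s\,|\;s\in\mathbb{R}\}$ in $L^\infty(\mathbb{R})$ with the topology given by the seminorms $q\mapsto\big|\int_{r_1}^{r_2}q(t)\,dt\big|$, $r_1<r_2$ in $\mathbb{Q}$. *)

theory Defs
  imports "HOL-Analysis.Analysis"
begin

text \<open>
  Elements of $L^\infty$ are represented by functions, not by classes modulo equality almost
  everywhere: every notion below is invariant under changes of the coefficients on null sets.
\<close>

definition Linf :: "(real \<Rightarrow> real) set" where
  "Linf = {f \<in> borel_measurable lebesgue. \<exists>M. AE t in lebesgue. \<bar>f t\<bar> \<le> M}"

definition absolutely_continuous_on :: "real \<Rightarrow> real \<Rightarrow> (real \<Rightarrow> real) \<Rightarrow> bool" where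
  "absolutely_continuous_on c d x \<longleftrightarrow>
     (\<forall>\<epsilon>>0. \<exists>\<delta>>0. \<forall>F :: (real \<times> real) set.
        finite F \<and> (\<forall>(u, v)\<in>F. c \<le> u \<and> u < v \<and> v \<le> d) \<and>
        disjoint_family_on (\<lambda>(u, v). {u<..<v}) F \<and> (\<Sum>(u, v)\<in>F. v - u) < \<delta>
        \<longrightarrow> (\<Sum>(u, v)\<in>F. \<bar>x v - x u\<bar>) < \<epsilon>)"

text \<open>
  Caratheodory solutions of $x' = -(x - \Delta(t))^2 + q(t)$ on an interval $I$; only the values
  of \<open>x\<close> on \<open>I\<close> are relevant.
\<close>

definition solution_on :: "(real \<Rightarrow> real) \<Rightarrow> (real \<Rightarrow> real) \<Rightarrow> real set \<Rightarrow> (real \<Rightarrow> real) \<Rightarrow> bool" where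
  "solution_on \<Delta> q I x \<longleftrightarrow>
     is_interval I \<and>
     (\<forall>c d. {c..d} \<subseteq> I \<longrightarrow> absolutely_continuous_on c d x) \<and>
     (AE t in lebesgue. t \<in> I \<longrightarrow>
        (x has_real_derivative (- (x t - \<Delta> t)\<^sup>2 + q t)) (at t within I))"

definition maximal_solution_on ::
  "(real \<Rightarrow> real) \<Rightarrow> (real \<Rightarrow> real) \<Rightarrow> real set \<Rightarrow> (real \<Rightarrow> real) \<Rightarrow> bool" where
  "maximal_solution_on \<Delta> q I x \<longleftrightarrow>
     solution_on \<Delta> q I x \<and>
     (\<forall>J y. solution_on \<Delta> q J y \<and> I \<subseteq> J \<and> (\<forall>t\<in>I. y t = x t) \<longrightarrow> J = I)"

definition bounded_solution :: "(real \<Rightarrow> real) \<Rightarrow> (real \<Rightarrow> real) \<Rightarrow> (real \<Rightarrow> real) \<Rightarrow> bool" where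
  "bounded_solution \<Delta> q x \<longleftrightarrow> solution_on \<Delta> q UNIV x \<and> bounded (range x)"

text \<open>
  In the last condition $t \le s$, so the oriented integral from $s$ to $t$ is minus the
  integral over $[t, s]$.
\<close>

definition attractor_repeller_pair ::
  "(real \<Rightarrow> real) \<Rightarrow> (real \<Rightarrow> real) \<Rightarrow> (real \<Rightarrow> real) \<Rightarrow> (real \<Rightarrow> real) \<Rightarrow> bool" where
  "attractor_repeller_pair \<Delta> q a r \<longleftrightarrow>
     bounded_solution \<Delta> q a \<and> bounded_solution \<Delta> q r \<and>
     (\<forall>x. bounded_solution \<Delta> q x \<longrightarrow> (\<forall>t. r t \<le> x t \<and> x t \<le> a t)) \<and>
     (\<exists>k\<ge>1. \<exists>\<beta>>0.
        (\<forall>s t. s \<le> t \<longrightarrow>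
           exp (integral {s..t} (\<lambda>l. - 2 * (a l - \<Delta> l))) \<le> k * exp (- \<beta> * (t - s))) \<and>
        (\<forall>s t. t \<le> s \<longrightarrow>
           exp (- integral {t..s} (\<lambda>l. - 2 * (r l - \<Delta> l))) \<le> k * exp (\<beta> * (t - s))))"

text \<open>
  The solution with value $x_0$ at $s$ remains bounded as $t \to -\infty$ (respectively
  $t \to +\infty$). This includes that it is defined on the whole half-line before
  (respectively after) $s$.
\<close>

definition bounded_in_past :: "(real \<Rightarrow> real) \<Rightarrow> (real \<Rightarrow> real) \<Rightarrow> real \<Rightarrow> real \<Rightarrow> bool" where
  "bounded_in_past \<Delta> q s x0 \<longleftrightarrow> (\<exists>x. solution_on \<Delta> q {..s} x \<and> x s = x0 \<and> Bfun x at_bot)"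

definition bounded_in_future :: "(real \<Rightarrow> real) \<Rightarrow> (real \<Rightarrow> real) \<Rightarrow> real \<Rightarrow> real \<Rightarrow> bool" where
  "bounded_in_future \<Delta> q s x0 \<longleftrightarrow> (\<exists>x. solution_on \<Delta> q {s..} x \<and> x s = x0 \<and> Bfun x at_top)"

text \<open>
  \<open>upper_special_solution \<Delta> q D f\<close>: the restriction of \<open>f\<close> to its domain \<open>D\<close> is the
  solution $\mathfrak{a}$; similarly \<open>lower_special_solution\<close> and $\mathfrak{r}$.
\<close>

definition upper_special_solution ::
  "(real \<Rightarrow> real) \<Rightarrow> (real \<Rightarrow> real) \<Rightarrow> real set \<Rightarrow> (real \<Rightarrow> real) \<Rightarrow> bool" where
  "upper_special_solution \<Delta> q D f \<longleftrightarrow>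
     (D = UNIV \<or> (\<exists>b. D = {..<b})) \<and>
     maximal_solution_on \<Delta> q D f \<and>
     (\<forall>s\<in>D. \<forall>x0. bounded_in_past \<Delta> q s x0 \<longleftrightarrow> x0 \<le> f s) \<and>
     (\<forall>b. D = {..<b} \<longrightarrow> filterlim f at_bot (at_left b))"

definition lower_special_solution ::
  "(real \<Rightarrow> real) \<Rightarrow> (real \<Rightarrow> real) \<Rightarrow> real set \<Rightarrow> (real \<Rightarrow> real) \<Rightarrow> bool" where
  "lower_special_solution \<Delta> q D f \<longleftrightarrow>
     (D = UNIV \<or> (\<exists>b. D = {b<..})) \<and>
     maximal_solution_on \<Delta> q D f \<and>
     (\<forall>s\<in>D. \<forall>x0. bounded_in_future \<Delta> q s x0 \<longleftrightarrow> f s \<le> x0) \<and>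
     (\<forall>b. D = {b<..} \<longrightarrow> filterlim f at_top (at_right b))"

text \<open>$\Gamma^h$: for $h > 0$, $t \in [jh, (j+1)h)$ means $j = \lfloor t/h \rfloor$.\<close>

definition sample :: "real \<Rightarrow> (real \<Rightarrow> real) \<Rightarrow> real \<Rightarrow> real" where
  "sample h \<Gamma> t = (if h > 0 then \<Gamma> (of_int \<lfloor>t / h\<rfloor> * h) else \<Gamma> t)"

definition convex_comb :: "(real \<Rightarrow> real) \<Rightarrow> (real \<Rightarrow> real) \<Rightarrow> real \<Rightarrow> real \<Rightarrow> real" where
  "convex_comb a r \<nu> t = \<nu> * a t + (1 - \<nu>) * r t"

text \<open>The derivatives are one-sided at the endpoints that belong to \<open>S\<close>.\<close>

definition C2_on :: "real set \<Rightarrow> (real \<Rightarrow> real) \<Rightarrow> bool" where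
  "C2_on S f \<longleftrightarrow>
     (\<exists>f1 f2. (\<forall>t\<in>S. (f has_real_derivative f1 t) (at t within S)) \<and>
              (\<forall>t\<in>S. (f1 has_real_derivative f2 t) (at t within S)) \<and>
              continuous_on S f2)"

text \<open>The seminorm balls form a subbase of the topology defined by the seminorms.\<close>

definition Linf_topology :: "(real \<Rightarrow> real) topology" where
  "Linf_topology = topology_generated_by
     {{g \<in> Linf. \<bar>integral {r1..r2} (\<lambda>t. g t - f t)\<bar> < \<epsilon>} | f r1 r2 \<epsilon>.
        f \<in> Linf \<and> r1 \<in> \<rat> \<and> r2 \<in> \<rat> \<and> r1 < r2 \<and> \<epsilon> > 0}"

definition shift_hull :: "(real \<Rightarrow> real) \<Rightarrow> (real \<Rightarrow> real) set" where
  "shift_hull p = Linf_topology closure_of (range (\<lambda>s t. p (s + t)))"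

definition total_tracking_on_hull :: "(real \<Rightarrow> real) \<Rightarrow> (real \<Rightarrow> real) \<Rightarrow> bool" where
  "total_tracking_on_hull \<Delta> p \<longleftrightarrow> (\<forall>q\<in>shift_hull p. \<exists>a r. attractor_repeller_pair \<Delta> q a r)"

end

theory Submission
  imports Defs
begin

text \<open>
  Let $m = (\tilde a + \tilde r)/2$ and $\delta = (\tilde a - \tilde r)/2$, so that
  $m' = -m^2 - \delta^2 + p$ and $\inf \delta > 0$ by hyperbolicity. Where $\Gamma' < \delta^2$, the
  function $m + \Gamma$ is a strict lower solution of $(E_h)$ for all small $h$. A bounded solution $a$
  above a lower solution and a bounded solution $r$ below it, separated by a positive constant, form an
  attractor-repeller pair: $u = a - r$ satisfies $u' = -u\,(2(a - \Delta) - u)$, so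
  $\exp\int_s^t -2(a - \Delta)$ is dominated by $u(t)\,e^{-c(t-s)}/c$ if $u \ge c$. The two solutions
  are obtained as limits of the solutions through $(-n, M)$ and $(n, -M)$.

  For $q$ in the hull, $m(s + \cdot) + \Gamma + \int (q - p_s)$ is a strict lower solution on $[-n, n]$
  if $p_s$ is close to $q$. In part (i), lower solutions on five intervals are joined with downward
  jumps: $m + \Gamma(-\infty)$, a solution starting there, $m + \Gamma$ on $[\bar t_1, \bar t_2]$, a
  solution ending at the last piece, and $m + \Gamma(+\infty)$; the second one lies above
  $m + \Gamma$ at $\bar t_1$ since solutions started far in the past are attracted by $\mathfrak a_0$.
\<close>

section \<open>Absolutely continuous and Lipschitz functions\<close>

text \<open>One lower solution yields both existence and separation. The field keeps forward
  solutions below M and backward solutions above -M, but only the lower solution prevents the former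
  from escaping downwards and the latter upwards. Its strictness margin \<eta> allows small vertical
  shifts both ways; the gap between two shifts survives in the limit. Comparison works in both time
  directions: a solution above a lower solution stays above it later, and one below it was below it
  earlier. Hence pieces may be glued with downward jumps. The lower solution is built from \<Gamma>,
  not from \<Gamma>^h, whose jumps may go up. The difference \<Gamma> - \<Gamma>^h enters only
  inside the square and is absorbed by \<eta>; it is uniformly small for small h because \<Gamma> is
  uniformly continuous. Elements of the hull are limits of translates only in the sense of integrals
  over intervals, so the coefficients may stay far apart pointwise; adding a primitive exchanges one
  for the other while moving the lower solution only slightly.\<close>

lemma AE_lebesgueE:
  assumes "AE t in lebesgue. P (t :: real)"
  obtains N where "N \<in> null_sets lebesgue" "\<And>t. t \<notin> N \<Longrightarrow> P t"
  using assms by (auto simp: eventually_ae_filter)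

definition interval_system :: "real \<Rightarrow> real \<Rightarrow> real \<Rightarrow> (real \<times> real) set \<Rightarrow> bool" where
  "interval_system c d \<delta> F \<longleftrightarrow> finite F \<and> (\<forall>(u, v)\<in>F. c \<le> u \<and> u < v \<and> v \<le> d) \<and>
     disjoint_family_on (\<lambda>(u, v). {u<..<v}) F \<and> (\<Sum>(u, v)\<in>F. v - u) < \<delta>"

definition variation :: "(real \<Rightarrow> real) \<Rightarrow> (real \<times> real) set \<Rightarrow> real" where
  "variation f F = (\<Sum>(u, v)\<in>F. \<bar>f v - f u\<bar>)"

lemma absolutely_continuous_on_iff:
  "absolutely_continuous_on c d f \<longleftrightarrow>
     (\<forall>e>0. \<exists>\<delta>>0. \<forall>F. interval_system c d \<delta> F \<longrightarrow> variation f F < e)"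
  by (simp add: absolutely_continuous_on_def interval_system_def variation_def)

text \<open>A covering argument with a gauge: intervals tagged at good points let f grow by at most
  e (v - u), and intervals tagged in the null set stay inside an open set of small measure, where
  absolute continuity bounds the total increment by e. A fine tagged division sums both
  contributions.\<close>

lemma abs_cont_decreasing:
  fixes f :: "real \<Rightarrow> real"
  assumes ac: "absolutely_continuous_on c d f" and cd: "c \<le> d"
    and ae: "AE t in lebesgue. c < t \<and> t < d \<longrightarrow> (\<exists>f'\<le>0. (f has_real_derivative f') (at t))"
  shows "f d \<le> f c"
proof (rule field_le_epsilon)
  fix e0 :: real assume "e0 > 0"
  \<comment> \<open>The null set contributes e and the remaining points e (d - c); this choice makes
    them add up to \<open>e0\<close>.\<close>
  define e where "e = e0 / (1 + (d - c))"
  have e: "e > 0" and e0: "e + e * (d - c) = e0"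
    proof -
    have p: "1 + (d - c) > 0" using cd by simp
    then show "e > 0" using \<open>e0 > 0\<close> by (simp add: e_def)
    have "e * (1 + (d - c)) = e0" using p by (simp add: e_def)
    then show "e + e * (d - c) = e0" by (simp only: distrib_left mult_1_right)
  qed
  obtain \<delta> where \<delta>: "\<delta> > 0" and ac': "\<And>F. interval_system c d \<delta> F \<Longrightarrow> variation f F < e"
    using ac e unfolding absolutely_continuous_on_iff by blast
  obtain N0 where N0: "N0 \<in> null_sets lebesgue"
    and good: "\<And>t. t \<notin> N0 \<Longrightarrow> c < t \<Longrightarrow> t < d \<Longrightarrow> (\<exists>f'\<le>0. (f has_real_derivative f') (at t))"
    by (rule AE_lebesgueE[OF ae]) blast
  \<comment> \<open>The endpoints count as exceptional, since the derivative is controlled only in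
    the open interval.\<close>
  define N where "N = N0 \<union> {c, d}"
  have N: "N \<in> null_sets lebesgue"
    unfolding N_def using N0
    by (simp add: finite_imp_null_set_lborel null_sets.Un null_sets_completionI)
  obtain U where U: "open U" "N \<subseteq> U" "(U - N) \<in> lmeasurable" "emeasure lebesgue (U - N) < ennreal \<delta>"
    using sets_lebesgue_outer_open[of N \<delta>] N \<delta> by auto
  have Ueq: "emeasure lebesgue U = emeasure lebesgue (U - N)"
    using N U by (simp add: emeasure_Diff_null_set)
  have Um: "U \<in> lmeasurable"
    using U Ueq by (intro fmeasurableI) (auto simp: fmeasurable_def)
  have Umeas: "measure lebesgue U < \<delta>"
    using U(4) Um \<delta> Ueq by (metis emeasure_eq_measure2 ennreal_less_iff measure_nonneg)
  define P where "P t \<rho> \<longleftrightarrow> (t \<in> N \<longrightarrow> ball t \<rho> \<subseteq> U) \<and>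
     (t \<in> {c<..<d} - N \<longrightarrow> (\<forall>u v. u \<le> t \<and> t \<le> v \<and> u \<in> ball t \<rho> \<and> v \<in> ball t \<rho> \<longrightarrow> f v - f u \<le> e * (v - u)))"
    for t \<rho>
  have "\<exists>\<rho>>0. P t \<rho>" for t
  proof (cases "t \<in> N")
    case True
    then show ?thesis using U(1,2) unfolding P_def by (meson Diff_iff open_contains_ball subsetD)
  next
    case False
    show ?thesis
    proof (cases "t \<in> {c<..<d}")
      case True
      then obtain f' where f': "f' \<le> 0" "(f has_real_derivative f') (at t)"
        using good[of t] False by (auto simp: N_def)
      from f'(2) have "(f has_derivative (\<lambda>h. h * f')) (at t)"
        unfolding has_field_derivative_def by (rule has_derivative_eq_rhs) (simp add: fun_eq_iff)
      then obtain \<rho> where \<rho>: "\<rho> > 0" "\<And>y. \<bar>y - t\<bar> < \<rho> \<Longrightarrow> \<bar>f y - f t - (y - t) * f'\<bar> \<le> e * \<bar>y - t\<bar>"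
        using e unfolding has_derivative_at_alt by (metis real_norm_def)
      have "f v - f u \<le> e * (v - u)" if "u \<le> t" "t \<le> v" "u \<in> ball t \<rho>" "v \<in> ball t \<rho>" for u v
      proof -
        have 1: "f v - f t - (v - t) * f' \<le> e * (v - t)"
          using \<rho>(2)[of v] that by (auto simp: dist_real_def)
        have "\<bar>f u - f t - (u - t) * f'\<bar> \<le> e * (t - u)"
          using \<rho>(2)[of u] that by (auto simp: dist_real_def)
        then have 2: "f t - f u \<le> (t - u) * f' + e * (t - u)"
          by (simp add: abs_le_iff algebra_simps)
        have "(v - t) * f' \<le> 0" "(t - u) * f' \<le> 0"
          using that f' by (auto simp: mult_nonneg_nonpos)
        with 1 2 show ?thesis by (simp add: algebra_simps)
      qed
      then show ?thesis using False \<rho>(1) by (auto simp: P_def)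
    next
      case False
      then show ?thesis using \<open>t \<notin> N\<close> by (intro exI[of _ 1]) (auto simp: P_def)
    qed
  qed
  then obtain \<rho> where \<rho>: "\<And>t. \<rho> t > 0" "\<And>t. P t (\<rho> t)" by metis
  obtain D where D: "D tagged_division_of {c..d}" "(\<lambda>t. ball t (\<rho> t)) fine D"
    using fine_division_exists_real[OF gauge_ball_dependent[of \<rho>]] \<rho> by blast
  have fin: "finite D" using D(1) by blast
  define g where "g = (\<lambda>(x::real, K::real set). f (Sup K) - f (Inf K))"
  \<comment> \<open>Degenerate intervals go to \<open>D2\<close>, where they contribute nothing,
    because \<open>interval_system\<close> admits only u < v.\<close>
  define D1 where "D1 = {(x, K). (x, K) \<in> D \<and> x \<in> N \<and> Inf K < Sup K}"
  define D2 where "D2 = D - D1"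
  have Kint: "K = {Inf K..Sup K}" "Inf K \<le> x" "x \<le> Sup K" "c \<le> Inf K" "Sup K \<le> d"
     "K \<subseteq> ball x (\<rho> x)" if "(x, K) \<in> D" for x K
  proof -
    obtain a b where ab: "K = cbox a b"
      using tagged_division_ofD(4)[OF D(1) \<open>(x, K) \<in> D\<close>] by blast
    moreover have xK: "x \<in> K" using that D(1) by blast
    ultimately have "a \<le> b" by auto
    then have "Inf K = a" "Sup K = b" using ab by auto
    moreover have "K \<subseteq> {c..d}" using that D(1) by blast
    ultimately show "K = {Inf K..Sup K}" "Inf K \<le> x" "x \<le> Sup K" "c \<le> Inf K" "Sup K \<le> d"
      using ab xK by auto
    show "K \<subseteq> ball x (\<rho> x)" using D(2) that by (auto simp: fine_def)
  qed
  have dis: "{Inf K<..<Sup K} \<inter> {Inf K'<..<Sup K'} = {}" if "(x, K) \<in> D" "(x', K') \<in> D" "(x, K) \<noteq> (x', K')" for x K x' K'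
  proof -
    have "interior K \<inter> interior K' = {}" using that D(1) by blast
    moreover have "interior K = {Inf K<..<Sup K}" "interior K' = {Inf K'<..<Sup K'}"
      using Kint[OF that(1)] Kint[OF that(2)] by (metis interior_atLeastAtMost_real)+
    ultimately show ?thesis by simp
  qed
  have sum: "(\<Sum>z\<in>D. g z) = f d - f c"
    using additive_tagged_division_1[OF cd D(1), of f] by (simp add: g_def)
  have lensum: "(\<Sum>z\<in>D. (\<lambda>(x, K). Sup K - Inf K) z) = d - c"
    using additive_tagged_division_1[OF cd D(1), of "\<lambda>x. x"] by simp
  have s2: "(\<Sum>z\<in>D2. g z) \<le> (\<Sum>z\<in>D2. e * (\<lambda>(x, K). Sup K - Inf K) z)"
  proof (rule sum_mono)
    fix z assume z: "z \<in> D2"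
    obtain x K where zeq: "z = (x, K)" by force
    with z have xK: "(x, K) \<in> D2" by simp
    then have xD: "(x, K) \<in> D" by (simp add: D2_def)
    show "g z \<le> e * (\<lambda>(x, K). Sup K - Inf K) z"
    proof (cases "Inf K < Sup K")
      case False
      moreover have "Inf K \<le> Sup K" using Kint(2,3)[OF xD] by linarith
      ultimately have "Sup K = Inf K" by linarith
      then show ?thesis by (simp add: g_def zeq)
    next
      case True
      then have "x \<notin> N" using xK by (auto simp: D2_def D1_def)
      moreover have "x \<in> {c<..<d}" using \<open>x \<notin> N\<close> Kint[OF xD] by (auto simp: N_def)
      moreover have "Inf K \<in> K" "Sup K \<in> K" using Kint[OF xD]
        by (metis atLeastAtMost_iff order.trans order_refl)+
      moreover from this have "Inf K \<in> ball x (\<rho> x)" "Sup K \<in> ball x (\<rho> x)"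
        using Kint(6)[OF xD] by blast+
      ultimately show ?thesis using \<rho>(2)[of x] Kint(2,3)[OF xD] by (simp add: g_def P_def zeq)
    qed
  qed
  have "(\<Sum>z\<in>D2. e * (\<lambda>(x, K). Sup K - Inf K) z) \<le> (\<Sum>z\<in>D. e * (\<lambda>(x, K). Sup K - Inf K) z)"
    using fin e by (intro sum_mono2) (auto simp: D1_def D2_def)
  also have "\<dots> = e * (d - c)" using lensum by (simp add: sum_distrib_left[symmetric])
  finally have s2': "(\<Sum>z\<in>D2. g z) \<le> e * (d - c)" using s2 by linarith
  define \<phi> where "\<phi> = (\<lambda>(x::real, K::real set). (Inf K, Sup K))"
  \<comment> \<open>Distinct members of \<open>D1\<close> have disjoint nonempty interiors, so
    forgetting the tags identifies no two of them.\<close>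
  have inj: "inj_on \<phi> D1"
  proof (rule inj_onI, clarify)
    fix x K x' K' assume "(x, K) \<in> D1" "(x', K') \<in> D1" and eq: "\<phi> (x, K) = \<phi> (x', K')"
    then have *: "(x, K) \<in> D" "(x', K') \<in> D" "Inf K < Sup K" by (auto simp: D1_def)
    with eq have "{Inf K<..<Sup K} \<inter> {Inf K'<..<Sup K'} \<noteq> {}" by (simp add: \<phi>_def)
    then show "x = x' \<and> K = K'" using dis[of x K x' K'] * by blast
  qed
  have fin1: "finite D1" using fin by (rule rev_finite_subset) (auto simp: D1_def)
  have djI: "disjoint_family_on (\<lambda>(u, v). {u<..<v}) (\<phi> ` D1)"
    unfolding disjoint_family_on_def
  proof (intro ballI impI)
    fix z z' assume "z \<in> \<phi> ` D1" "z' \<in> \<phi> ` D1" and ne: "z \<noteq> z'"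
    then obtain x K x' K' where *: "(x, K) \<in> D1" "(x', K') \<in> D1" "z = \<phi> (x, K)" "z' = \<phi> (x', K')"
      by force
    then have "{Inf K<..<Sup K} \<inter> {Inf K'<..<Sup K'} = {}"
      using dis[of x K x' K'] ne by (auto simp: D1_def)
    then show "(case z of (u, v) \<Rightarrow> {u<..<v}) \<inter> (case z' of (u, v) \<Rightarrow> {u<..<v}) = {}"
      using * by (simp add: \<phi>_def)
  qed
  have "(\<Sum>(u, v)\<in>\<phi> ` D1. v - u) = (\<Sum>z\<in>\<phi> ` D1. measure lebesgue ((\<lambda>(u, v). {u<..<v}) z))"
    by (rule sum.cong) (auto simp: \<phi>_def D1_def)
  also have "\<dots> = measure lebesgue (\<Union>z\<in>\<phi> ` D1. (\<lambda>(u, v). {u<..<v}) z)"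
    using fin1 djI by (intro measure_finite_Union[symmetric]) (auto simp: \<phi>_def D1_def less_imp_le)
  also have "\<dots> \<le> measure lebesgue U"
  proof (intro measure_mono_fmeasurable Um)
    show "(\<Union>z\<in>\<phi> ` D1. (\<lambda>(u, v). {u<..<v}) z) \<subseteq> U"
    proof
      fix t assume "t \<in> (\<Union>z\<in>\<phi> ` D1. (\<lambda>(u, v). {u<..<v}) z)"
      then obtain x K where *: "(x, K) \<in> D1" and t: "t \<in> {Inf K<..<Sup K}"
        by (auto simp: \<phi>_def)
      from * have xD: "(x, K) \<in> D" "x \<in> N" by (auto simp: D1_def)
      have "t \<in> {Inf K..Sup K}" using t by simp
      then have "t \<in> K" using Kint(1)[OF xD(1)] by blast
      then have "t \<in> ball x (\<rho> x)" using Kint(6)[OF xD(1)] by blast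
      then show "t \<in> U" using \<rho>(2)[of x] xD by (auto simp: P_def)
    qed
  qed (use fin1 in \<open>auto intro!: sets.finite_UN split: prod.splits\<close>)
  finally have "interval_system c d \<delta> (\<phi> ` D1)"
    using Umeas fin1 djI unfolding interval_system_def by (auto simp: \<phi>_def D1_def dest: Kint)
  then have "variation f (\<phi> ` D1) < e" by (rule ac')
  moreover have "variation f (\<phi> ` D1) = (\<Sum>z\<in>D1. \<bar>g z\<bar>)"
    unfolding variation_def by (subst sum.reindex[OF inj]) (auto simp: g_def \<phi>_def case_prod_unfold intro!: sum.cong)
  ultimately have "(\<Sum>z\<in>D1. \<bar>g z\<bar>) < e" by simp
  then have "(\<Sum>z\<in>D1. g z) < e"
    by (smt (verit, ccfv_SIG) sum_mono)
  moreover have "(\<Sum>z\<in>D. g z) = (\<Sum>z\<in>D1. g z) + (\<Sum>z\<in>D2. g z)"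
    unfolding D2_def using fin by (intro sum.subset_diff[THEN trans[OF _ add.commute]]) (auto simp: D1_def)
  ultimately show "f d \<le> f c + e0" using sum s2' e0 by linarith
qed

section \<open>Lipschitz functions on compact intervals\<close>

definition lip :: "real \<Rightarrow> real \<Rightarrow> (real \<Rightarrow> real) \<Rightarrow> bool" where
  "lip c d f \<longleftrightarrow> (\<exists>C. C-lipschitz_on {c..d} f)"

lemma lip_imp_abs_cont:
  assumes "lip c d f" shows "absolutely_continuous_on c d f"
  unfolding absolutely_continuous_on_iff
proof (intro allI impI)
  fix e :: real assume e: "e > 0"
  obtain C0 where C0: "C0-lipschitz_on {c..d} f" using assms by (auto simp: lip_def)
  define C where "C = C0 + 1"
  have C: "C > 0" "C-lipschitz_on {c..d} f"
    using C0 lipschitz_on_nonneg[OF C0] by (auto simp: C_def intro: lipschitz_on_le)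
  show "\<exists>\<delta>>0. \<forall>F. interval_system c d \<delta> F \<longrightarrow> variation f F < e"
  proof (intro exI[of _ "e / C"] conjI allI impI)
    show "e / C > 0" using C e by simp
    fix F assume F: "interval_system c d (e / C) F"
    have "variation f F \<le> (\<Sum>(u, v)\<in>F. C * (v - u))"
      unfolding variation_def
    proof (rule sum_mono, clarify)
      fix u v assume "(u, v) \<in> F"
      then have "c \<le> u \<and> u < v \<and> v \<le> d" using F unfolding interval_system_def by blast
      then show "\<bar>f v - f u\<bar> \<le> C * (v - u)"
        using lipschitz_onD[OF C(2), of v u] by (simp add: dist_real_def)
    qed
    also have "\<dots> = C * (\<Sum>(u, v)\<in>F. v - u)" by (simp add: sum_distrib_left case_prod_unfold)
    also have "\<dots> < e" using F C unfolding interval_system_def by (simp add: field_simps)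
    finally show "variation f F < e" .
  qed
qed

lemma interval_system_mono:
  assumes "interval_system c' d' \<delta> F" "c \<le> c'" "d' \<le> d" "\<delta> \<le> \<delta>'"
  shows "interval_system c d \<delta>' F"
  using assms unfolding interval_system_def by force

lemma abs_cont_subset:
  assumes "absolutely_continuous_on c d f" "c \<le> c'" "d' \<le> d"
  shows "absolutely_continuous_on c' d' f"
  using assms interval_system_mono[OF _ assms(2,3) order_refl]
  unfolding absolutely_continuous_on_iff by blast

lemma variation_add: "variation (\<lambda>t. f t + g t) F \<le> variation f F + variation g F"
  unfolding variation_def case_prod_unfold sum.distrib[symmetric] by (rule sum_mono) auto

lemma abs_cont_add_lip:
  assumes f: "absolutely_continuous_on c d f" and g: "lip c d g"
  shows "absolutely_continuous_on c d (\<lambda>t. f t + g t)"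
  unfolding absolutely_continuous_on_iff
proof (intro allI impI)
  fix e :: real assume "e > 0"
  then have e: "e / 2 > 0" by simp
  obtain \<delta>1 where 1: "\<delta>1 > 0" "\<And>F. interval_system c d \<delta>1 F \<Longrightarrow> variation f F < e / 2"
    using f e unfolding absolutely_continuous_on_iff by blast
  obtain \<delta>2 where 2: "\<delta>2 > 0" "\<And>F. interval_system c d \<delta>2 F \<Longrightarrow> variation g F < e / 2"
    using lip_imp_abs_cont[OF g] e unfolding absolutely_continuous_on_iff by blast
  show "\<exists>\<delta>>0. \<forall>F. interval_system c d \<delta> F \<longrightarrow> variation (\<lambda>t. f t + g t) F < e"
  proof (intro exI[of _ "min \<delta>1 \<delta>2"] conjI allI impI)
    fix F assume F: "interval_system c d (min \<delta>1 \<delta>2) F"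
    have "variation f F < e / 2" "variation g F < e / 2"
      by (intro 1(2) 2(2) interval_system_mono[OF F]; simp)+
    then show "variation (\<lambda>t. f t + g t) F < e" using variation_add[of f g F] by linarith
  qed (use 1 2 in auto)
qed

lemma abs_cont_uminus:
  "absolutely_continuous_on c d f \<Longrightarrow> absolutely_continuous_on c d (\<lambda>t. - f t)"
  by (simp add: absolutely_continuous_on_iff variation_def abs_minus_commute)

lemma lip_linear: "lip c d (\<lambda>t. B * t)"
  unfolding lip_def
  by (rule exI[of _ "\<bar>B\<bar>"], rule lipschitz_onI) (auto simp: dist_real_def abs_mult[symmetric] right_diff_distrib)

lemma abs_cont_bounded_deriv_increment:
  assumes ac: "absolutely_continuous_on c d f" and cd: "c \<le> d"
    and ae: "AE t in lebesgue. c < t \<and> t < d \<longrightarrow> (\<exists>f'\<le>B. (f has_real_derivative f') (at t))"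
  shows "f d - f c \<le> B * (d - c)"
proof -
  have "absolutely_continuous_on c d (\<lambda>t. f t + (- B) * t)"
    by (intro abs_cont_add_lip ac lip_linear)
  then have "f d + (- B) * d \<le> f c + (- B) * c"
  proof (rule abs_cont_decreasing[OF _ cd], goal_cases)
    case 1
    from ae show ?case
    proof eventually_elim
      case (elim t)
      show ?case (is "_ \<longrightarrow> ?C")
      proof
        assume "c < t \<and> t < d"
        then obtain f' where f': "f' \<le> B" "(f has_real_derivative f') (at t)" using elim by blast
        then have "((\<lambda>t. f t + (- B) * t) has_real_derivative (f' + (-B) * 1)) (at t)"
          by (intro DERIV_add DERIV_cmult DERIV_ident)
        then show ?C
          using f'(1) by (intro exI[of _ "f' + (-B) * 1"]) auto
      qed
    qed
  qed
  then show ?thesis by (simp add: algebra_simps)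
qed

text \<open>Apply the increment bound to f and to -f. The constant is |B| because the hypothesis is
  vacuous on a degenerate interval, so B may be negative, which a Lipschitz constant may not
  be.\<close>

lemma abs_cont_bounded_deriv_lip:
  assumes ac: "absolutely_continuous_on c d f"
    and ae: "AE t in lebesgue. c < t \<and> t < d \<longrightarrow> (\<exists>f'. \<bar>f'\<bar> \<le> B \<and> (f has_real_derivative f') (at t))"
  shows "\<bar>B\<bar>-lipschitz_on {c..d} f"
proof -
  have key: "\<bar>f v - f u\<bar> \<le> \<bar>B\<bar> * (v - u)" if "c \<le> u" "u \<le> v" "v \<le> d" for u v
  proof -
    have ac': "absolutely_continuous_on u v f" using ac that by (blast intro: abs_cont_subset)
    have 1: "f v - f u \<le> \<bar>B\<bar> * (v - u)"
    proof (rule abs_cont_bounded_deriv_increment[OF ac' that(2)], rule AE_mp[OF ae], intro AE_I2 impI)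
      fix t assume "c < t \<and> t < d \<longrightarrow> (\<exists>f'. \<bar>f'\<bar> \<le> B \<and> (f has_real_derivative f') (at t))"
        "u < t \<and> t < v"
      then obtain f' where f': "\<bar>f'\<bar> \<le> B" "(f has_real_derivative f') (at t)" using \<open>c \<le> u\<close> \<open>v \<le> d\<close> by fastforce
      then show "\<exists>f'\<le>\<bar>B\<bar>. (f has_real_derivative f') (at t)"
        by (intro exI[of _ f']) auto
    qed
    have 2: "- f v - - f u \<le> \<bar>B\<bar> * (v - u)"
    proof (rule abs_cont_bounded_deriv_increment[OF abs_cont_uminus[OF ac'] that(2)], rule AE_mp[OF ae], intro AE_I2 impI)
      fix t assume "c < t \<and> t < d \<longrightarrow> (\<exists>f'. \<bar>f'\<bar> \<le> B \<and> (f has_real_derivative f') (at t))"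
        "u < t \<and> t < v"
      then obtain f' where f': "\<bar>f'\<bar> \<le> B" "(f has_real_derivative f') (at t)" using \<open>c \<le> u\<close> \<open>v \<le> d\<close> by fastforce
      then show "\<exists>f'\<le>\<bar>B\<bar>. ((\<lambda>t. - f t) has_real_derivative f') (at t)"
        by (intro exI[of _ "- f'"]) (auto intro!: derivative_eq_intros)
    qed
    from 1 2 show ?thesis by linarith
  qed
  show ?thesis
  proof (rule lipschitz_on_leI)
    fix x y assume "x \<in> {c..d}" "y \<in> {c..d}" "x \<le> y"
    then show "dist (f x) (f y) \<le> \<bar>B\<bar> * dist x y"
      using key[of x y] by (simp add: dist_real_def abs_minus_commute)
  qed simp
qed

lemma lip_continuous_on: "lip c d f \<Longrightarrow> continuous_on {c..d} f"
  by (auto simp: lip_def intro: lipschitz_on_continuous_on)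

lemma lip_subset: "lip c d f \<Longrightarrow> c \<le> c' \<Longrightarrow> d' \<le> d \<Longrightarrow> lip c' d' f"
  unfolding lip_def by (elim exE, rule exI, erule lipschitz_on_subset) auto

lemma lip_cong: "(\<And>t. c \<le> t \<Longrightarrow> t \<le> d \<Longrightarrow> f t = g t) \<Longrightarrow> lip c d f \<longleftrightarrow> lip c d g"
  unfolding lip_def by (intro arg_cong[where f=Ex] ext lipschitz_on_cong) auto

lemma lip_add [intro]: "lip c d f \<Longrightarrow> lip c d g \<Longrightarrow> lip c d (\<lambda>t. f t + g t)"
  unfolding lip_def by (elim exE, rule exI, erule (1) lipschitz_on_add)

lemma lip_diff [intro]: "lip c d f \<Longrightarrow> lip c d g \<Longrightarrow> lip c d (\<lambda>t. f t - g t)"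
  unfolding lip_def by (elim exE, rule exI, erule (1) lipschitz_on_diff)

lemma lip_uminus [intro]: "lip c d f \<Longrightarrow> lip c d (\<lambda>t. - f t)"
  unfolding lip_def by (elim exE, rule exI, erule lipschitz_on_minus)

lemma lip_const [intro]: "lip c d (\<lambda>t. k)"
  unfolding lip_def by (rule exI, rule lipschitz_on_constant)

lemma lip_bounded:
  assumes "lip c d f" obtains B where "B \<ge> 0" "\<And>t. t \<in> {c..d} \<Longrightarrow> \<bar>f t\<bar> \<le> B"
proof -
  have "bounded (f ` {c..d})"
    using lip_continuous_on[OF assms] compact_continuous_image compact_imp_bounded by blast
  then obtain B where "\<forall>x\<in>f ` {c..d}. norm x \<le> B" unfolding bounded_iff by blast
  then show ?thesis by (intro that[of "max B 0"]) (auto simp: le_max_iff_disj)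
qed

text \<open>Comparison arguments multiply by exponential weights, so closure under products matters.
  Bounded coefficients make all truncated solutions Lipschitz on compact intervals, which is why
  this class can be used in place of the absolutely continuous functions.\<close>

lemma lip_mult [intro]:
  assumes f: "lip c d f" and g: "lip c d g"
  shows "lip c d (\<lambda>t. f t * g t)"
proof -
  obtain A where A: "A \<ge> 0" "\<And>t. t \<in> {c..d} \<Longrightarrow> \<bar>f t\<bar> \<le> A" using lip_bounded[OF f] by blast
  obtain B where B: "B \<ge> 0" "\<And>t. t \<in> {c..d} \<Longrightarrow> \<bar>g t\<bar> \<le> B" using lip_bounded[OF g] by blast
  obtain F where F: "F-lipschitz_on {c..d} f" using f by (auto simp: lip_def)
  obtain G where G: "G-lipschitz_on {c..d} g" using g by (auto simp: lip_def)
  have "(A * G + B * F)-lipschitz_on {c..d} (\<lambda>t. f t * g t)"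
  proof (rule lipschitz_onI)
    fix x y assume xy: "x \<in> {c..d}" "y \<in> {c..d}"
    have "f x * g x - f y * g y = f x * (g x - g y) + g y * (f x - f y)" by (simp add: algebra_simps)
    then have "\<bar>f x * g x - f y * g y\<bar> \<le> \<bar>f x\<bar> * \<bar>g x - g y\<bar> + \<bar>g y\<bar> * \<bar>f x - f y\<bar>"
      by (metis abs_mult abs_triangle_ineq)
    also have "\<dots> \<le> A * (G * \<bar>x - y\<bar>) + B * (F * \<bar>x - y\<bar>)"
      using A B xy lipschitz_onD[OF F xy] lipschitz_onD[OF G xy]
      by (intro add_mono mult_mono) (auto simp: dist_real_def)
    finally show "dist (f x * g x) (f y * g y) \<le> (A * G + B * F) * dist x y"
      by (simp add: dist_real_def algebra_simps)
  qed (use A B lipschitz_on_nonneg[OF F] lipschitz_on_nonneg[OF G] in auto)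
  then show ?thesis by (auto simp: lip_def)
qed

lemma lip_C1:
  assumes "\<And>t. t \<in> {c..d} \<Longrightarrow> (f has_real_derivative f' t) (at t within {c..d})"
    and "continuous_on {c..d} f'"
  shows "lip c d f"
proof -
  have "bounded (f' ` {c..d})"
    using assms(2) compact_continuous_image compact_imp_bounded by blast
  then obtain B where B: "B > 0" "\<And>t. t \<in> {c..d} \<Longrightarrow> norm (f' t) \<le> B" unfolding bounded_pos by blast
  have "B-lipschitz_on {c..d} f"
  proof (rule lipschitz_onI)
    fix x y assume xy: "x \<in> {c..d}" "y \<in> {c..d}"
    show "dist (f x) (f y) \<le> B * dist x y"
      using field_differentiable_bound[of "{c..d}" f f' B x y] assms(1) B(2) xy by (auto simp: dist_norm)
  qed (use B in auto)
  then show ?thesis by (auto simp: lip_def)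
qed

lemma lip_exp_linear: "lip c d (\<lambda>t. exp (L * t))"
  by (rule lip_C1[where f'="\<lambda>t. L * exp (L * t)"]) (auto intro!: derivative_eq_intros continuous_intros)

lemma lip_comp_exp:
  assumes "lip c d f" shows "lip c d (\<lambda>t. exp (f t))"
proof -
  obtain B where B: "B \<ge> 0" "\<And>t. t \<in> {c..d} \<Longrightarrow> \<bar>f t\<bar> \<le> B" using lip_bounded[OF assms] by blast
  obtain F where F: "F-lipschitz_on {c..d} f" using assms by (auto simp: lip_def)
  obtain E where E: "E-lipschitz_on {-B..B} exp"
    using lip_exp_linear[of "-B" B 1] by (auto simp: lip_def)
  have "(E * F)-lipschitz_on {c..d} (\<lambda>t. exp (f t))"
    by (rule lipschitz_on_compose2[OF F lipschitz_on_subset[OF E]]) (use B in \<open>auto simp: abs_le_iff\<close>, fastforce)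
  then show ?thesis by (auto simp: lip_def)
qed

text \<open>After the last time \<sigma> at which D is nonpositive, D' \<le> L D holds almost
  everywhere, so D exp(-L t) cannot increase from its nonpositive value at \<sigma>. Asking for the
  inequality only where D > 0 makes one-sided estimates sufficient in the comparisons.\<close>

lemma differential_inequality:
  assumes lipD: "lip s t D" and st: "s \<le> t" and Ds: "D s \<le> 0"
    and ae: "AE \<tau> in lebesgue. s < \<tau> \<and> \<tau> < t \<and> D \<tau> > 0 \<longrightarrow> (\<exists>D'. (D has_real_derivative D') (at \<tau>) \<and> D' \<le> L * D \<tau>)"
  shows "D t \<le> 0"
proof (rule ccontr)
  assume "\<not> D t \<le> 0"
  then have Dt: "D t > 0" by simp
  have cont: "continuous_on {s..t} D" using lipD by (rule lip_continuous_on)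
  define S where "S = {\<tau> \<in> {s..t}. D \<tau> \<le> 0}"
  have "S = {s..t} \<inter> D -` {..0}" by (auto simp: S_def)
  then have "closed S" using continuous_closed_preimage[OF cont, of "{..0}"] by simp
  moreover have "s \<in> S" using st Ds by (simp add: S_def)
  moreover have bdd: "bdd_above S" by (auto simp: S_def)
  ultimately have SS: "Sup S \<in> S" by (intro closed_contains_Sup) auto
  define \<sigma> where "\<sigma> = Sup S"
  have \<sigma>: "s \<le> \<sigma>" "\<sigma> \<le> t" "D \<sigma> \<le> 0" using SS by (auto simp: S_def \<sigma>_def)
  have pos: "D \<tau> > 0" if "\<sigma> < \<tau>" "\<tau> \<le> t" for \<tau>
  proof (rule ccontr)
    assume "\<not> D \<tau> > 0"
    then have "\<tau> \<in> S" using that \<sigma> by (simp add: S_def)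
    then show False using cSup_upper[OF _ bdd, of \<tau>] that by (simp add: \<sigma>_def)
  qed
  have "D t * exp (-L * t) \<le> D \<sigma> * exp (-L * \<sigma>)"
  proof (rule abs_cont_decreasing[OF lip_imp_abs_cont \<sigma>(2)])
    show "lip \<sigma> t (\<lambda>t. D t * exp (-L * t))"
      using lip_subset[OF lipD \<sigma>(1) order_refl] lip_exp_linear by (rule lip_mult)
    from ae show "AE \<tau> in lebesgue. \<sigma> < \<tau> \<and> \<tau> < t \<longrightarrow> (\<exists>f'\<le>0. ((\<lambda>t. D t * exp (-L * t)) has_real_derivative f') (at \<tau>))"
    proof eventually_elim
      case (elim \<tau>)
      show ?case (is "_ \<longrightarrow> ?C")
      proof
        assume \<tau>: "\<sigma> < \<tau> \<and> \<tau> < t"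
        then obtain D' where D': "(D has_real_derivative D') (at \<tau>)" "D' \<le> L * D \<tau>"
          using elim pos \<sigma> by auto
        show ?C
        proof (intro exI[of _ "(D' - L * D \<tau>) * exp (-L * \<tau>)"] conjI)
          show "(D' - L * D \<tau>) * exp (- L * \<tau>) \<le> 0" using D'(2) by (intro mult_nonpos_nonneg) auto
          show "((\<lambda>t. D t * exp (-L * t)) has_real_derivative (D' - L * D \<tau>) * exp (- L * \<tau>)) (at \<tau>)"
            using D'(1) by (auto intro!: derivative_eq_intros simp: algebra_simps)
        qed
      qed
    qed
  qed
  also have "\<dots> \<le> 0" using \<sigma>(3) by (simp add: mult_nonpos_nonneg)
  finally show False using Dt by (simp add: mult_le_0_iff)
qed

section \<open>Reflection and translation of the time variable\<close>

lemma AE_lebesgue_uminus: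
  assumes "AE t in lebesgue. P t"
  shows "AE t in lebesgue. P (- t :: real)"
proof -
  obtain N where N: "N \<in> null_sets lebesgue" "\<And>t. t \<notin> N \<Longrightarrow> P t"
    using assms by (auto simp: eventually_ae_filter)
  have "negligible (uminus ` N)"
    using N(1) by (intro negligible_differentiable_image_negligible)
       (auto simp: negligible_iff_null_sets intro!: derivative_intros)
  then have "uminus ` N \<in> null_sets lebesgue" by (simp add: negligible_iff_null_sets)
  moreover have "P (-t)" if "t \<notin> uminus ` N" for t
    using N(2)[of "-t"] that by (metis image_eqI minus_minus)
  ultimately show ?thesis by (auto simp: eventually_ae_filter)
qed

lemma AE_lebesgue_shift:
  assumes "AE t in lebesgue. P t"
  shows "AE t in lebesgue. P (s + t :: real)"
proof -
  obtain N where N: "N \<in> null_sets lebesgue" "\<And>t. t \<notin> N \<Longrightarrow> P t"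
    using assms by (auto simp: eventually_ae_filter)
  have "negligible ((+) (-s) ` N)"
    using N(1) by (intro negligible_translation) (auto simp: negligible_iff_null_sets)
  then have "(+) (-s) ` N \<in> null_sets lebesgue" by (simp add: negligible_iff_null_sets)
  moreover have "P (s + t)" if "t \<notin> (+) (-s) ` N" for t
    using N(2)[of "s + t"] that by force
  ultimately show ?thesis by (auto simp: eventually_ae_filter)
qed

lemma lip_reflect:
  assumes "lip c d f" shows "lip (-d) (-c) (\<lambda>t. f (- t))"
proof -
  obtain C where C: "C-lipschitz_on {c..d} f" using assms by (auto simp: lip_def)
  have "C-lipschitz_on {-d..-c} (\<lambda>t. f (- t))"
    using lipschitz_on_nonneg[OF C]
    by (intro lipschitz_onI) (use lipschitz_onD[OF C, of "- x" "- y" for x y] in \<open>auto simp: dist_real_def abs_minus_commute\<close>)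
  then show ?thesis by (auto simp: lip_def)
qed

lemma deriv_reflect:
  "(f has_real_derivative D) (at (- t)) \<Longrightarrow> ((\<lambda>t. f (- t)) has_real_derivative - D) (at t)"
  by (drule DERIV_chain2[of f D "\<lambda>t. - t" t "-1"]) (auto intro!: derivative_eq_intros)

lemma differential_inequality_backward:
  assumes lipD: "lip s t D" and st: "s \<le> t" and Dt: "D t \<le> 0"
    and ae: "AE \<tau> in lebesgue. s < \<tau> \<and> \<tau> < t \<and> D \<tau> > 0 \<longrightarrow> (\<exists>D'. (D has_real_derivative D') (at \<tau>) \<and> - (L * D \<tau>) \<le> D')"
  shows "D s \<le> 0"
proof -
  have "(\<lambda>t. D (- t)) (- s) \<le> 0"
  proof (rule differential_inequality[OF lip_reflect[OF lipD]])
    from AE_lebesgue_uminus[OF ae]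
    show "AE \<tau> in lebesgue. - t < \<tau> \<and> \<tau> < - s \<and> 0 < D (- \<tau>) \<longrightarrow>
         (\<exists>D'. ((\<lambda>t. D (- t)) has_real_derivative D') (at \<tau>) \<and> D' \<le> L * D (- \<tau>))"
    proof eventually_elim
      case (elim \<tau>)
      show ?case (is "_ \<longrightarrow> ?C")
      proof
        assume "- t < \<tau> \<and> \<tau> < - s \<and> 0 < D (- \<tau>)"
        then obtain D' where "(D has_real_derivative D') (at (-\<tau>))" "- (L * D (-\<tau>)) \<le> D'"
          using elim by auto
        then show ?C
          by (intro exI[of _ "- D'"]) (auto dest: deriv_reflect)
      qed
    qed
  qed (use st Dt in auto)
  then show ?thesis by simp
qed

section \<open>The truncated Riccati equation\<close>

text \<open>The bound holds at every point, not just almost everywhere; elements of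
  \<open>Linf\<close> are first replaced by such representatives. This spares exceptional sets in
  the pointwise estimates of the field.\<close>

definition bdd_meas :: "real \<Rightarrow> (real \<Rightarrow> real) \<Rightarrow> bool" where
  "bdd_meas B f \<longleftrightarrow> f \<in> borel_measurable lebesgue \<and> (\<forall>t. \<bar>f t\<bar> \<le> B)"

lemma bdd_measD: "bdd_meas B f \<Longrightarrow> f \<in> borel_measurable lebesgue" "bdd_meas B f \<Longrightarrow> \<bar>f t\<bar> \<le> B"
  by (auto simp: bdd_meas_def)

lemma bdd_meas_nonneg: "bdd_meas B f \<Longrightarrow> 0 \<le> B"
  using bdd_measD(2)[of B f 0] by linarith

lemma bdd_meas_mono: "bdd_meas B f \<Longrightarrow> B \<le> C \<Longrightarrow> bdd_meas C f"
  by (auto simp: bdd_meas_def intro: order_trans)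

lemma AE_lebesgueI: "N \<in> null_sets lebesgue \<Longrightarrow> (\<And>t :: real. t \<notin> N \<Longrightarrow> P t) \<Longrightarrow> AE t in lebesgue. P t"
  by (rule AE_I') auto

lemma continuous_imp_measurable_lebesgue:
  "continuous_on UNIV (f :: real \<Rightarrow> real) \<Longrightarrow> f \<in> borel_measurable lebesgue"
  by (rule measurable_completion) (simp add: borel_measurable_continuous_onI)

lemma measurable_lebesgue_reflect:
  assumes "f \<in> borel_measurable lebesgue" shows "(\<lambda>t. f (- t :: real) :: real) \<in> borel_measurable lebesgue"
proof -
  have "(\<lambda>t. - t :: real) \<in> lebesgue \<rightarrow>\<^sub>M lebesgue"
    using lebesgue_affine_measurable[of "\<lambda>_. -1 :: real" "0 :: real"]
    by (simp add: sum_negf euclidean_representation del: sum_negf[symmetric])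
  from measurable_compose[OF this assms] show ?thesis .
qed

lemma measurable_lebesgue_shift:
  assumes "f \<in> borel_measurable lebesgue" shows "(\<lambda>t. f (s + t :: real) :: real) \<in> borel_measurable lebesgue"
proof -
  have "(\<lambda>t. s + t :: real) \<in> lebesgue \<rightarrow>\<^sub>M lebesgue"
    using lebesgue_affine_measurable[of "\<lambda>_. 1 :: real" s] by (simp add: Basis_real_def)
  from measurable_compose[OF this assms] show ?thesis .
qed

lemma bdd_meas_reflect: "bdd_meas B f \<Longrightarrow> bdd_meas B (\<lambda>t. f (- t))"
  by (auto simp: bdd_meas_def measurable_lebesgue_reflect)

lemma bdd_meas_uminus: "bdd_meas B f \<Longrightarrow> bdd_meas B (\<lambda>t. - f t)"
  by (auto simp: bdd_meas_def)

lemma bdd_meas_shift: "bdd_meas B f \<Longrightarrow> bdd_meas B (\<lambda>t. f (s + t))"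
  by (auto simp: bdd_meas_def measurable_lebesgue_shift)

lemma bdd_meas_diff:
  assumes "bdd_meas B f" "bdd_meas C g" shows "bdd_meas (B + C) (\<lambda>t. f t - g t)"
proof -
  have [measurable]: "f \<in> borel_measurable lebesgue" "g \<in> borel_measurable lebesgue"
    using assms by (auto dest: bdd_measD)
  have "(\<lambda>t. f t - g t) \<in> borel_measurable lebesgue" by measurable
  moreover have "\<bar>f t - g t\<bar> \<le> B + C" for t
    using bdd_measD(2)[OF assms(1), of t] bdd_measD(2)[OF assms(2), of t] by linarith
  ultimately show ?thesis by (simp add: bdd_meas_def)
qed

lemma bdd_meas_integrable:
  assumes "bdd_meas B f" shows "f integrable_on {c..d}"
proof (rule measurable_bounded_by_integrable_imp_integrable[where g="\<lambda>_. B"])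
  show "f \<in> borel_measurable (lebesgue_on {c..d})"
    using bdd_measD(1)[OF assms] by (rule measurable_restrict_space1)
qed (use bdd_measD(2)[OF assms] in auto)

lemma bdd_meas_integral_bound:
  assumes "bdd_meas B f" "c \<le> d" shows "\<bar>integral {c..d} f\<bar> \<le> B * (d - c)"
proof -
  have "norm (integral {c..d} f) \<le> integral {c..d} (\<lambda>_. B)"
    using bdd_measD(2)[OF assms(1)] by (intro integral_norm_bound_integral bdd_meas_integrable[OF assms(1)]) auto
  then show ?thesis using assms(2) by (simp add: mult.commute)
qed

lemma bdd_meas_integral_diff:
  assumes "bdd_meas B f" "c \<le> u" "u \<le> v"
  shows "integral {c..v} f - integral {c..u} f = integral {u..v} f"
  using Henstock_Kurzweil_Integration.integral_combine[OF assms(2,3) bdd_meas_integrable[OF assms(1)]] by simp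

lemma bdd_meas_integral_lipschitz:
  assumes f: "bdd_meas B f"
  shows "B-lipschitz_on S (\<lambda>t. integral {c..t} f)"
proof (rule lipschitz_on_leI)
  fix u v :: real assume uv: "u \<le> v"
  have B: "B \<ge> 0" by (rule bdd_meas_nonneg[OF f])
  consider "c \<le> u" | "u < c" "c \<le> v" | "v < c" using uv by linarith
  then have "\<bar>integral {c..v} f - integral {c..u} f\<bar> \<le> B * (v - u)"
  proof cases
    case 1
    then show ?thesis using bdd_meas_integral_diff[OF f 1 uv] bdd_meas_integral_bound[OF f uv] by simp
  next
    case 2
    then have "\<bar>integral {c..v} f - integral {c..u} f\<bar> \<le> B * (v - c)"
      using bdd_meas_integral_bound[OF f 2(2)] by simp
    also have "\<dots> \<le> B * (v - u)" using 2 B by (intro mult_left_mono) auto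
    finally show ?thesis .
  next
    case 3
    then show ?thesis using uv B by simp
  qed
  then show "dist (integral {c..u} f) (integral {c..v} f) \<le> B * dist u v"
    using uv by (simp add: dist_real_def abs_minus_commute)
qed (rule bdd_meas_nonneg[OF f])

text \<open>The right half of Lebesgue differentiation, phrased without a base point so that it also
  applies to the reflected function and then yields the left half.\<close>

lemma bdd_meas_integral_right_deriv:
  assumes f: "bdd_meas B f"
  shows "AE t in lebesgue. \<forall>e>0. \<exists>d>0. \<forall>h. 0 < h \<and> h < d \<longrightarrow> \<bar>integral {t..t + h} f - h * f t\<bar> \<le> e * h"
proof -
  have "\<And>a b :: real. f integrable_on cbox a b" using bdd_meas_integrable[OF f] by simp
  then obtain N where N: "negligible N" "\<And>x e. \<lbrakk>x \<notin> N; 0 < e\<rbrakk> \<Longrightarrow>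
      \<exists>d>0. \<forall>h. 0 < h \<and> h < d \<longrightarrow> norm(integral (cbox x (x + h *\<^sub>R One)) f /\<^sub>R h ^ DIM(real) - f x) < e"
    using integrable_ccontinuous_explicit[of f] by metis
  have "\<forall>e>0. \<exists>d>0. \<forall>h. 0 < h \<and> h < d \<longrightarrow> \<bar>integral {t..t + h} f - h * f t\<bar> \<le> e * h" if t: "t \<notin> N" for t
  proof (intro allI impI)
    fix e :: real assume "e > 0"
    then obtain d where d: "d > 0" "\<And>h. 0 < h \<Longrightarrow> h < d \<Longrightarrow> \<bar>integral {t..t + h} f / h - f t\<bar> < e"
      using N(2)[OF t, of e] by (auto simp: divide_inverse mult.commute)
    show "\<exists>d>0. \<forall>h. 0 < h \<and> h < d \<longrightarrow> \<bar>integral {t..t + h} f - h * f t\<bar> \<le> e * h"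
    proof (intro exI[of _ d] conjI allI impI d(1))
      fix h assume h: "0 < h \<and> h < d"
      have "integral {t..t + h} f - h * f t = (integral {t..t + h} f / h - f t) * h"
        using h by (simp add: field_simps)
      then show "\<bar>integral {t..t + h} f - h * f t\<bar> \<le> e * h"
        using d(2)[of h] h by (simp add: abs_mult)
    qed
  qed
  then show ?thesis using N(1) by (intro AE_lebesgueI) (auto simp: negligible_iff_null_sets)
qed

text \<open>Right and left difference quotients are joined, the latter obtained by reflection. The
  condition c < t is there because \<open>integral {c..t} f\<close> vanishes identically to the left
  of c.\<close>

lemma bdd_meas_integral_deriv:
  assumes f: "bdd_meas B f"
  shows "AE t in lebesgue. c < t \<longrightarrow> ((\<lambda>t. integral {c..t} f) has_real_derivative f t) (at t)"
proof -
  have L: "AE t in lebesgue. \<forall>e>0. \<exists>d>0. \<forall>h. 0 < h \<and> h < d \<longrightarrow> \<bar>integral {t - h..t} f - h * f t\<bar> \<le> e * h"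
  proof -
    have eq: "integral {- t..- t + h} (\<lambda>t. f (- t)) = integral {t - h..t} f" for t h
      using Henstock_Kurzweil_Integration.integral_reflect_real[of t "t - h" f] by simp
    show ?thesis
      using AE_lebesgue_uminus[OF bdd_meas_integral_right_deriv[OF bdd_meas_reflect[OF f]]]
      unfolding eq by simp
  qed
  from bdd_meas_integral_right_deriv[OF f] L show ?thesis
  proof eventually_elim
    case (elim t)
    show ?case (is "_ \<longrightarrow> ?C")
    proof
      assume ct: "c < t"
      show ?C
        unfolding has_field_derivative_def has_derivative_at_alt
      proof (intro conjI allI impI)
        show "bounded_linear ((*) (f t))" by (rule bounded_linear_mult_right)
        fix e :: real assume e: "e > 0"
        obtain d1 where d1: "d1 > 0" "\<And>h. 0 < h \<and> h < d1 \<Longrightarrow> \<bar>integral {t..t + h} f - h * f t\<bar> \<le> e * h"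
          using elim(1) e by blast
        obtain d2 where d2: "d2 > 0" "\<And>h. 0 < h \<and> h < d2 \<Longrightarrow> \<bar>integral {t - h..t} f - h * f t\<bar> \<le> e * h"
          using elim(2) e by blast
        show "\<exists>d>0. \<forall>y. norm (y - t) < d \<longrightarrow>
            norm (integral {c..y} f - integral {c..t} f - f t * (y - t)) \<le> e * norm (y - t)"
        \<comment> \<open>The entry t - c keeps y to the right of c, where integrals from c can be
          subtracted.\<close>
        proof (intro exI[of _ "Min {d1, d2, t - c}"] conjI allI impI)
          fix y assume y: "norm (y - t) < Min {d1, d2, t - c}"
          consider "y = t" | "t < y" | "y < t" by linarith
          then show "norm (integral {c..y} f - integral {c..t} f - f t * (y - t)) \<le> e * norm (y - t)"
          proof cases
            case 2
            then show ?thesis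
              using d1(2)[of "y - t"] y bdd_meas_integral_diff[OF f, of c t y] ct by (simp add: mult.commute)
          next
            case 3
            then have "integral {c..t} f - integral {c..y} f = integral {y..t} f"
              using y bdd_meas_integral_diff[OF f, of c y t] ct by simp
            moreover have "\<bar>integral {y..t} f - (t - y) * f t\<bar> \<le> e * (t - y)"
              using d2(2)[of "t - y"] y 3 by simp
            ultimately show ?thesis using 3 by (simp add: abs_real_def algebra_simps split: if_splits)
          qed simp
        qed (use d1 d2 ct in auto)
      qed
    qed
  qed
qed

text \<open>
  Cutting \<open>x\<close> off at \<open>\<plusminus>M\<close> makes the equation globally Lipschitz in \<open>x\<close>, so that all its solutions are
  global; solutions with values in \<open>[-M, M]\<close> are the same as before.
\<close>

definition trunc :: "real \<Rightarrow> real \<Rightarrow> real" where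
  "trunc M x = max (- M) (min M x)"

definition tfield :: "real \<Rightarrow> (real \<Rightarrow> real) \<Rightarrow> (real \<Rightarrow> real) \<Rightarrow> real \<Rightarrow> real \<Rightarrow> real" where
  "tfield M \<Delta> q t x = - (trunc M x - \<Delta> t)\<^sup>2 + q t"

text \<open>The truncated field is bounded, so Lipschitz continuity takes the place of absolute
  continuity. Derivatives are two-sided and asked for only inside the interval, which makes
  restriction immediate. For c > d the predicate holds trivially, so that one solution can be
  quantified over all endpoints.\<close>

definition tsol :: "(real \<Rightarrow> real) \<Rightarrow> (real \<Rightarrow> real) \<Rightarrow> real \<Rightarrow> real \<Rightarrow> real \<Rightarrow> (real \<Rightarrow> real) \<Rightarrow> bool" where
  "tsol \<Delta> q M c d x \<longleftrightarrow> lip c d x \<and>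
     (AE t in lebesgue. c < t \<and> t < d \<longrightarrow> (x has_real_derivative tfield M \<Delta> q t (x t)) (at t))"

lemma tsol_deriv:
  "tsol \<Delta> q M c d x \<Longrightarrow>
    AE t in lebesgue. c < t \<and> t < d \<longrightarrow> (x has_real_derivative tfield M \<Delta> q t (x t)) (at t)"
  by (simp add: tsol_def)

lemma tsol_subset: "tsol \<Delta> q M c d x \<Longrightarrow> c \<le> c' \<Longrightarrow> d' \<le> d \<Longrightarrow> tsol \<Delta> q M c' d' x"
  unfolding tsol_def by (auto intro: lip_subset elim: eventually_mono)

lemma abs_trunc: "M \<ge> 0 \<Longrightarrow> \<bar>trunc M x\<bar> \<le> M"
  by (auto simp: trunc_def)

lemma trunc_id: "\<bar>x\<bar> \<le> M \<Longrightarrow> trunc M x = x"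
  by (auto simp: trunc_def)

lemma tfield_id: "\<bar>x\<bar> \<le> M \<Longrightarrow> tfield M \<Delta> q t x = - (x - \<Delta> t)\<^sup>2 + q t"
  by (simp add: tfield_def trunc_id)

lemma trunc_lip: "\<bar>trunc M x - trunc M y\<bar> \<le> \<bar>x - y\<bar>"
  by (auto simp: trunc_def)

lemma tfield_bound:
  assumes "bdd_meas B \<Delta>" "bdd_meas B q" "M \<ge> 0"
  shows "\<bar>tfield M \<Delta> q t x\<bar> \<le> (M + B)\<^sup>2 + B"
proof -
  have "\<bar>trunc M x - \<Delta> t\<bar> \<le> M + B"
    using abs_trunc[OF assms(3), of x] bdd_measD(2)[OF assms(1), of t] by linarith
  then have "\<bar>trunc M x - \<Delta> t\<bar>\<^sup>2 \<le> (M + B)\<^sup>2" by (intro power_mono) auto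
  then have "(trunc M x - \<Delta> t)\<^sup>2 \<le> (M + B)\<^sup>2" by simp
  moreover have "(trunc M x - \<Delta> t)\<^sup>2 \<ge> 0" by simp
  moreover have "\<bar>q t\<bar> \<le> B" by (rule bdd_measD(2)[OF assms(2)])
  ultimately show ?thesis unfolding tfield_def by linarith
qed

text \<open>Factor the difference of squares: one factor is a difference of truncations, the other
  is at most 2 (M + B). This constant is the growth rate in all comparisons and the price of a unit
  vertical shift of a lower solution.\<close>

lemma tfield_lip:
  assumes "bdd_meas B \<Delta>" "M \<ge> 0"
  shows "\<bar>tfield M \<Delta> q t x - tfield M \<Delta> q t y\<bar> \<le> 2 * (M + B) * \<bar>x - y\<bar>"
proof -
  have "tfield M \<Delta> q t x - tfield M \<Delta> q t y =
     - ((trunc M x - trunc M y) * (trunc M x + trunc M y - 2 * \<Delta> t))"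
    by (simp add: tfield_def power2_eq_square algebra_simps)
  moreover have "\<bar>trunc M x + trunc M y - 2 * \<Delta> t\<bar> \<le> 2 * (M + B)"
    using abs_trunc[OF assms(2), of x] abs_trunc[OF assms(2), of y] bdd_measD(2)[OF assms(1), of t]
    unfolding abs_le_iff by auto
  ultimately have "\<bar>tfield M \<Delta> q t x - tfield M \<Delta> q t y\<bar> \<le> \<bar>x - y\<bar> * (2 * (M + B))"
    using trunc_lip[of M x y] by (simp only: abs_minus_cancel abs_mult) (intro mult_mono, auto)
  then show ?thesis by (simp add: mult.commute)
qed

lemma tfield_measurable:
  assumes "bdd_meas B \<Delta>" "bdd_meas B q" "M \<ge> 0" "continuous_on UNIV x"
  shows "bdd_meas ((M + B)\<^sup>2 + B) (\<lambda>t. tfield M \<Delta> q t (x t))"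
proof -
  have "continuous_on UNIV (\<lambda>t. trunc M (x t))" unfolding trunc_def by (intro continuous_intros assms(4))
  then have [measurable]: "(\<lambda>t. trunc M (x t)) \<in> borel_measurable lebesgue"
    by (rule continuous_imp_measurable_lebesgue)
  have [measurable]: "\<Delta> \<in> borel_measurable lebesgue" "q \<in> borel_measurable lebesgue"
    using assms by (auto dest: bdd_measD)
  have "(\<lambda>t. tfield M \<Delta> q t (x t)) \<in> borel_measurable lebesgue"
    unfolding tfield_def by measurable
  then show ?thesis using tfield_bound[OF assms(1-3)] by (simp add: bdd_meas_def)
qed

text \<open>Freezing x at its endpoint values extends it continuously to the line, so that
  \<open>tfield_measurable\<close> applies to functions known only on an interval.\<close>

lemma continuous_on_clamped:
  assumes "continuous_on {c..d} (x :: real \<Rightarrow> real)" "c \<le> d"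
  shows "continuous_on UNIV (\<lambda>t. x (max c (min d t)))"
  by (rule continuous_on_compose2[OF assms(1)]) (use assms(2) in \<open>auto intro!: continuous_intros\<close>)

lemma tsol_from_integral:
  assumes \<Delta>: "bdd_meas B \<Delta>" and q: "bdd_meas B q" and M: "M \<ge> 0"
    and cont: "continuous_on {c..d} x" and cd: "c \<le> d"
    and eq: "\<And>t. c \<le> t \<Longrightarrow> t \<le> d \<Longrightarrow> x t = x c + integral {c..t} (\<lambda>\<tau>. tfield M \<Delta> q \<tau> (x \<tau>))"
  shows "tsol \<Delta> q M c d x"
proof -
  define x' where "x' t = x (max c (min d t))" for t
  define g where "g \<tau> = tfield M \<Delta> q \<tau> (x' \<tau>)" for \<tau>
  have x': "x' t = x t" if "c \<le> t" "t \<le> d" for t using that by (simp add: x'_def)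
  have g: "bdd_meas ((M + B)\<^sup>2 + B) g"
    unfolding g_def by (rule tfield_measurable[OF \<Delta> q M]) (auto simp: x'_def continuous_on_clamped[OF cont cd])
  have eq': "x t = x c + integral {c..t} g" if "c \<le> t" "t \<le> d" for t
  proof -
    have "integral {c..t} (\<lambda>\<tau>. tfield M \<Delta> q \<tau> (x \<tau>)) = integral {c..t} g"
      by (rule integral_cong) (use that in \<open>auto simp: g_def x'\<close>)
    then show ?thesis using eq[OF that] by simp
  qed
  have "lip c d (\<lambda>t. x c + integral {c..t} g)"
    using bdd_meas_integral_lipschitz[OF g] by (intro lip_add lip_const) (auto simp: lip_def)
  then have lip: "lip c d x" using lip_cong[of c d x "\<lambda>t. x c + integral {c..t} g"] eq' by blast
  have "AE t in lebesgue. c < t \<and> t < d \<longrightarrow> (x has_real_derivative tfield M \<Delta> q t (x t)) (at t)"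
    using bdd_meas_integral_deriv[OF g, of c]
  proof eventually_elim
    case (elim t)
    show ?case (is "_ \<longrightarrow> ?C")
    proof
      assume t: "c < t \<and> t < d"
      with elim have "((\<lambda>t. x c + integral {c..t} g) has_real_derivative 0 + g t) (at t)"
        by (intro DERIV_add) auto
      then have "(x has_real_derivative 0 + g t) (at t)"
        by (rule has_field_derivative_transform_within_open[of _ _ _ "{c<..<d}"]) (use t in \<open>auto simp: eq'[symmetric]\<close>)
      then show ?C
        using t x'[of t] by (simp add: g_def)
    qed
  qed
  with lip show ?thesis by (simp add: tsol_def)
qed

lemma tsol_integral:
  assumes \<Delta>: "bdd_meas B \<Delta>" and q: "bdd_meas B q" and M: "M \<ge> 0"
    and x: "tsol \<Delta> q M c d x" and t: "c \<le> t" "t \<le> d"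
  shows "x t = x c + integral {c..t} (\<lambda>\<tau>. tfield M \<Delta> q \<tau> (x \<tau>))"
    and "(\<lambda>\<tau>. tfield M \<Delta> q \<tau> (x \<tau>)) integrable_on {c..t}"
    and "\<bar>x t - x c\<bar> \<le> ((M + B)\<^sup>2 + B) * (t - c)"
proof -
  define x' where "x' t = x (max c (min d t))" for t
  define g where "g \<tau> = tfield M \<Delta> q \<tau> (x' \<tau>)" for \<tau>
  have x': "x' t = x t" if "c \<le> t" "t \<le> d" for t using that by (simp add: x'_def)
  have lip: "lip c d x" using x by (simp add: tsol_def)
  have cd: "c \<le> d" using t by simp
  have g: "bdd_meas ((M + B)\<^sup>2 + B) g"
    unfolding g_def by (rule tfield_measurable[OF \<Delta> q M])
      (auto simp: x'_def continuous_on_clamped[OF lip_continuous_on[OF lip] cd])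
  have lipg: "lip c d (\<lambda>t. integral {c..t} g)"
    using bdd_meas_integral_lipschitz[OF g] by (auto simp: lip_def)
  \<comment> \<open>The difference has derivative 0 almost everywhere, hence Lipschitz constant 0,
    hence is constant.\<close>
  have "\<bar>0\<bar>-lipschitz_on {c..d} (\<lambda>t. x t - integral {c..t} g)"
  proof (rule abs_cont_bounded_deriv_lip[OF lip_imp_abs_cont[OF lip_diff[OF lip lipg]]])
    from tsol_deriv[OF x] bdd_meas_integral_deriv[OF g, of c]
    show "AE t in lebesgue. c < t \<and> t < d \<longrightarrow>
       (\<exists>f'. \<bar>f'\<bar> \<le> 0 \<and> ((\<lambda>t. x t - integral {c..t} g) has_real_derivative f') (at t))"
    proof eventually_elim
      case (elim t)
      show ?case (is "_ \<longrightarrow> ?C")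
      proof
        assume t: "c < t \<and> t < d"
        with elim have "((\<lambda>t. x t - integral {c..t} g) has_real_derivative tfield M \<Delta> q t (x t) - g t) (at t)"
          by (intro DERIV_diff) auto
        moreover have "tfield M \<Delta> q t (x t) - g t = 0" using t x'[of t] by (simp add: g_def)
        ultimately show ?C
          by (intro exI[of _ 0]) simp
      qed
    qed
  qed
  from lipschitz_onD[OF this, of t c] have *: "x t = x c + integral {c..t} g"
    using t by (simp add: dist_real_def)
  have cg: "tfield M \<Delta> q \<tau> (x \<tau>) = g \<tau>" if "\<tau> \<in> {c..t}" for \<tau> using that t by (simp add: g_def x')
  note *
  also have "integral {c..t} g = integral {c..t} (\<lambda>\<tau>. tfield M \<Delta> q \<tau> (x \<tau>))"
    by (rule integral_cong) (rule cg[symmetric])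
  finally show "x t = x c + integral {c..t} (\<lambda>\<tau>. tfield M \<Delta> q \<tau> (x \<tau>))" .
  show "(\<lambda>\<tau>. tfield M \<Delta> q \<tau> (x \<tau>)) integrable_on {c..t}"
    by (rule integrable_eq[OF bdd_meas_integrable[OF g]]) (rule cg[symmetric])
  show "\<bar>x t - x c\<bar> \<le> ((M + B)\<^sup>2 + B) * (t - c)"
    using * bdd_meas_integral_bound[OF g t(1)] by simp
qed

text \<open>A fixed point in an exponentially weighted norm: writing x = E z with z bounded and
  continuous makes the integral operator a contraction on the whole line at once, so that no local
  solutions have to be continued. To the left of s the weight is 1 and the integral is 0, so x is
  constant there.\<close>

lemma tsol_exists:
  assumes \<Delta>: "bdd_meas B \<Delta>" and q: "bdd_meas B q" and M: "M \<ge> 0"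
  obtains x where "x s = x0" "\<And>T. tsol \<Delta> q M s T x"
proof -
  define L where "L = 2 * (M + B)"
  define C where "C = (M + B)\<^sup>2 + B"
  \<comment> \<open>The weight exp (K (t - s)) turns the Lipschitz constant L into L / K \<le> 1/2.
    The summand 1 makes K \<ge> 1, which is used to bound t - s by E.\<close>
  define K where "K = 2 * L + 1"
  have B: "B \<ge> 0" by (rule bdd_meas_nonneg[OF \<Delta>])
  have L: "L \<ge> 0" and C: "C \<ge> 0" using M B by (auto simp: L_def C_def)
  have K: "K \<ge> 1" using L by (simp add: K_def)
  define E where "E t = exp (K * max 0 (t - s))" for t
  have E1: "E t \<ge> 1" for t using K by (simp add: E_def)
  have Econt: "continuous_on UNIV E" unfolding E_def by (intro continuous_intros)
  define G where "G z \<tau> = tfield M \<Delta> q \<tau> (E \<tau> * z \<tau>)" for z :: "real \<Rightarrow> real" and \<tau>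
  have G: "bdd_meas C (G (apply_bcontfun z))" for z
    unfolding G_def C_def by (rule tfield_measurable[OF \<Delta> q M]) (intro continuous_intros Econt continuous_on_apply_bcontfun)
  define T where "T z t = (x0 + integral {s..t} (G z)) / E t" for z t
  have Tb: "T (apply_bcontfun z) \<in> bcontfun" for z
  proof (rule bcontfun_normI)
    have "continuous_on UNIV (\<lambda>t. integral {s..t} (G z))"
      by (rule lipschitz_on_continuous_on[OF bdd_meas_integral_lipschitz[OF G]])
    then show "continuous_on UNIV (T z)" unfolding T_def
      by (intro continuous_intros Econt) (auto simp: E_def)
    fix t
    have "\<bar>integral {s..t} (G z)\<bar> \<le> C * max 0 (t - s)"
    proof (cases "s \<le> t")
      case True then show ?thesis using bdd_meas_integral_bound[OF G True, of z] by simp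
    next
      case False then show ?thesis by simp
    qed
    also have "\<dots> \<le> C * E t"
    proof (rule mult_left_mono[OF _ C])
      have "max 0 (t - s) \<le> K * max 0 (t - s)" using K by (simp add: mult_le_cancel_right1)
      also have "\<dots> \<le> E t" unfolding E_def using exp_ge_add_one_self[of "K * max 0 (t - s)"] by linarith
      finally show "max 0 (t - s) \<le> E t" .
    qed
    finally have 1: "\<bar>integral {s..t} (G z)\<bar> \<le> C * E t" .
    have "\<bar>x0\<bar> * 1 \<le> \<bar>x0\<bar> * E t" by (intro mult_left_mono E1) auto
    with 1 have "\<bar>x0 + integral {s..t} (G z)\<bar> \<le> (\<bar>x0\<bar> + C) * E t"
      by (simp add: distrib_right)
    then show "norm (T z t) \<le> \<bar>x0\<bar> + C" using E1[of t] by (simp add: T_def abs_div pos_divide_le_eq)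
  qed
  define TT where "TT z = Bcontfun (T (apply_bcontfun z))" for z
  have TT: "apply_bcontfun (TT z) = T (apply_bcontfun z)" for z
    unfolding TT_def by (rule Bcontfun_inverse[OF Tb])
  have "dist (TT z) (TT w) \<le> 1/2 * dist z w" for z w
  proof (rule dist_bound)
    fix t
    show "dist (TT z t) (TT w t) \<le> 1/2 * dist z w"
    proof (cases "s \<le> t")
      case False
      then show ?thesis by (simp add: TT T_def)
    next
      case True
      have hi: "((\<lambda>\<tau>. L * dist z w * exp (K * (\<tau> - s))) has_integral
            L * dist z w / K * exp (K * (t - s)) - L * dist z w / K * exp (K * (s - s))) {s..t}"
        by (rule fundamental_theorem_of_calculus[OF True])
          (use K in \<open>auto intro!: derivative_eq_intros simp: has_real_derivative_iff_has_vector_derivative[symmetric]\<close>)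
      have "\<bar>integral {s..t} (G z) - integral {s..t} (G w)\<bar> = norm (integral {s..t} (\<lambda>\<tau>. G z \<tau> - G w \<tau>))"
        using bdd_meas_integrable[OF G] by (simp add: integral_diff)
      also have "\<dots> \<le> integral {s..t} (\<lambda>\<tau>. L * dist z w * exp (K * (\<tau> - s)))"
      proof (rule integral_norm_bound_integral)
        show "(\<lambda>\<tau>. G z \<tau> - G w \<tau>) integrable_on {s..t}" by (intro integrable_diff bdd_meas_integrable[OF G])
        show "(\<lambda>\<tau>. L * dist z w * exp (K * (\<tau> - s))) integrable_on {s..t}" using hi by blast
        fix \<tau> assume \<tau>: "\<tau> \<in> {s..t}"
        have "norm (G z \<tau> - G w \<tau>) \<le> L * \<bar>E \<tau> * z \<tau> - E \<tau> * w \<tau>\<bar>"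
          unfolding G_def L_def real_norm_def by (rule tfield_lip[OF \<Delta> M])
        also have "\<bar>E \<tau> * z \<tau> - E \<tau> * w \<tau>\<bar> = E \<tau> * dist (z \<tau>) (w \<tau>)"
          using E1[of \<tau>] by (simp add: right_diff_distrib[symmetric] abs_mult dist_real_def)
        also have "L * (E \<tau> * dist (z \<tau>) (w \<tau>)) \<le> L * (E \<tau> * dist z w)"
          using L E1[of \<tau>] by (intro mult_left_mono dist_bounded) auto
        also have "\<dots> = L * dist z w * exp (K * (\<tau> - s))" using \<tau> by (simp add: E_def)
        finally show "norm (G z \<tau> - G w \<tau>) \<le> L * dist z w * exp (K * (\<tau> - s))" .
      qed
      also have "\<dots> = L * dist z w / K * exp (K * (t - s)) - L * dist z w / K"
        using integral_unique[OF hi] by simp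
      also have "\<dots> \<le> L * dist z w / K * E t" using True L K by (simp add: E_def)
      also have "\<dots> \<le> 1/2 * dist z w * E t"
      proof (rule mult_right_mono)
        have "L / K \<le> 1/2" using K L by (simp add: K_def field_simps)
        then show "L * dist z w / K \<le> 1/2 * dist z w"
          using mult_right_mono[of "L / K" "1/2" "dist z w"] by simp
      qed (use E1[of t] in simp)
      finally have "\<bar>integral {s..t} (G z) - integral {s..t} (G w)\<bar> \<le> 1/2 * dist z w * E t" .
      moreover have "dist (TT z t) (TT w t) = \<bar>integral {s..t} (G z) - integral {s..t} (G w)\<bar> / E t"
        using E1[of t] by (simp add: TT T_def dist_real_def diff_divide_distrib[symmetric] abs_div)
      ultimately show ?thesis using E1[of t] by (simp add: pos_divide_le_eq)
    qed
  qed
  then obtain z where z: "TT z = z" using banach_fix_type[of "1/2" TT] by auto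
  define x where "x t = E t * z t" for t
  have xeq: "x t = x0 + integral {s..t} (\<lambda>\<tau>. tfield M \<Delta> q \<tau> (x \<tau>))" for t
  proof -
    have "z t = T z t" using TT[of z] z by simp
    then have "E t * z t = x0 + integral {s..t} (G z)" using E1[of t] by (simp add: T_def)
    then show ?thesis by (simp add: x_def G_def[abs_def])
  qed
  have xs: "x s = x0" using xeq[of s] by simp
  show ?thesis
  proof (rule that[of x])
    show "x s = x0" by (rule xs)
    show "tsol \<Delta> q M s T x" for T
    proof (cases "s \<le> T")
      case True
      show ?thesis
      proof (rule tsol_from_integral[OF \<Delta> q M _ True])
        show "continuous_on {s..T} x" unfolding x_def
          by (intro continuous_intros continuous_on_subset[OF Econt]) auto
        show "x t = x s + integral {s..t} (\<lambda>\<tau>. tfield M \<Delta> q \<tau> (x \<tau>))" for t using xeq[of t] xs by simp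
      qed
    next
      case False
      then show ?thesis by (auto simp: tsol_def lip_def intro!: exI[of _ 0] AE_I2)
    qed
  qed
qed

text \<open>Pointwise convergence suffices: the common bound (M + B)^2 + B of the field makes the
  solutions equi-Lipschitz and dominates the integrands in the integral equation.\<close>

lemma tsol_limit:
  assumes \<Delta>: "bdd_meas B \<Delta>" and q: "bdd_meas B q" and M: "M \<ge> 0" and cd: "c \<le> d"
    and x: "\<And>n. tsol \<Delta> q M c d (X n)"
    and lim: "\<And>t. c \<le> t \<Longrightarrow> t \<le> d \<Longrightarrow> (\<lambda>n. X n t) \<longlonglongrightarrow> x t"
  shows "tsol \<Delta> q M c d x"
proof (rule tsol_from_integral[OF \<Delta> q M _ cd])
  define C where "C = (M + B)\<^sup>2 + B"
  have C: "C \<ge> 0" using bdd_meas_nonneg[OF \<Delta>] by (simp add: C_def)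
  have "C-lipschitz_on {c..d} x"
  proof (rule lipschitz_on_leI)
    fix u v assume uv: "u \<in> {c..d}" "v \<in> {c..d}" "u \<le> v"
    have "\<bar>X n v - X n u\<bar> \<le> C * (v - u)" for n
      using tsol_integral(3)[OF \<Delta> q M tsol_subset[OF x], of u v v] uv by (simp add: C_def)
    moreover have "(\<lambda>n. \<bar>X n v - X n u\<bar>) \<longlonglongrightarrow> \<bar>x v - x u\<bar>"
      using uv by (intro tendsto_intros lim) auto
    ultimately have "\<bar>x v - x u\<bar> \<le> C * (v - u)" by (intro LIMSEQ_le_const2) auto
    then show "dist (x u) (x v) \<le> C * dist u v" using uv by (simp add: dist_real_def abs_minus_commute)
  qed (rule C)
  then show "continuous_on {c..d} x" by (rule lipschitz_on_continuous_on)
  fix t assume t: "c \<le> t" "t \<le> d"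
  have "(\<lambda>n. integral {c..t} (\<lambda>\<tau>. tfield M \<Delta> q \<tau> (X n \<tau>))) \<longlonglongrightarrow> integral {c..t} (\<lambda>\<tau>. tfield M \<Delta> q \<tau> (x \<tau>))"
  proof (rule dominated_convergence(2)[where h="\<lambda>_. C"])
    show "(\<lambda>\<tau>. tfield M \<Delta> q \<tau> (X n \<tau>)) integrable_on {c..t}" for n
      by (rule tsol_integral(2)[OF \<Delta> q M x t])
    show "norm (tfield M \<Delta> q \<tau> (X n \<tau>)) \<le> C" for n \<tau>
      using tfield_bound[OF \<Delta> q M] by (simp add: C_def)
    fix \<tau> assume \<tau>: "\<tau> \<in> {c..t}"
    show "(\<lambda>n. tfield M \<Delta> q \<tau> (X n \<tau>)) \<longlonglongrightarrow> tfield M \<Delta> q \<tau> (x \<tau>)"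
      unfolding tfield_def trunc_def using \<tau> t by (intro tendsto_intros lim) auto
  qed auto
  then have "(\<lambda>n. X n c + integral {c..t} (\<lambda>\<tau>. tfield M \<Delta> q \<tau> (X n \<tau>))) \<longlonglongrightarrow>
      x c + integral {c..t} (\<lambda>\<tau>. tfield M \<Delta> q \<tau> (x \<tau>))"
    using t by (intro tendsto_add lim) auto
  then have "(\<lambda>n. X n t) \<longlonglongrightarrow> x c + integral {c..t} (\<lambda>\<tau>. tfield M \<Delta> q \<tau> (x \<tau>))"
    using tsol_integral(1)[OF \<Delta> q M x t] by simp
  then show "x t = x c + integral {c..t} (\<lambda>\<tau>. tfield M \<Delta> q \<tau> (x \<tau>))"
    using lim[OF t] LIMSEQ_unique by blast
qed

section \<open>Comparison and attractor-repeller pairs\<close>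

abbreviation (input) ae_deriv_le :: "real \<Rightarrow> real \<Rightarrow> (real \<Rightarrow> real) \<Rightarrow> (real \<Rightarrow> real) \<Rightarrow> bool" where
  "ae_deriv_le c d y F \<equiv> AE t in lebesgue. c < t \<and> t < d \<longrightarrow>
     (\<exists>y'. (y has_real_derivative y') (at t) \<and> y' \<le> F t)"

text \<open>Lower solutions in the sense of differential inequalities, for the truncated
  equation.\<close>

definition tsub :: "(real \<Rightarrow> real) \<Rightarrow> (real \<Rightarrow> real) \<Rightarrow> real \<Rightarrow> real \<Rightarrow> real \<Rightarrow> (real \<Rightarrow> real) \<Rightarrow> bool" where
  "tsub \<Delta> q M c d y \<longleftrightarrow> lip c d y \<and>
     (ae_deriv_le c d y (\<lambda>t. tfield M \<Delta> q t (y t)))"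

lemma tsol_imp_tsub: "tsol \<Delta> q M c d x \<Longrightarrow> tsub \<Delta> q M c d x"
  unfolding tsol_def tsub_def by (auto elim!: eventually_mono)

lemma tsub_subset: "tsub \<Delta> q M c d x \<Longrightarrow> c \<le> c' \<Longrightarrow> d' \<le> d \<Longrightarrow> tsub \<Delta> q M c' d' x"
  unfolding tsub_def by (auto intro: lip_subset elim: eventually_mono)

text \<open>Wherever y > x, the Lipschitz bound of the field gives (y - x)' \<le> 2 (M + B) (y - x),
  which is exactly where \<open>differential_inequality\<close> asks for it.\<close>

lemma tsub_le_tsol:
  assumes \<Delta>: "bdd_meas B \<Delta>" and M: "M \<ge> 0"
    and y: "tsub \<Delta> q M c d y" and x: "tsol \<Delta> q M c d x" and cd: "c \<le> d" and le: "y c \<le> x c"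
  shows "y d \<le> x d"
proof -
  have "y d - x d \<le> 0"
  proof (rule differential_inequality[where L="2 * (M + B)" and D="\<lambda>t. y t - x t", OF _ cd])
    show "lip c d (\<lambda>t. y t - x t)" using x y by (auto simp: tsol_def tsub_def)
    show "y c - x c \<le> 0" using le by simp
    have "ae_deriv_le c d y (\<lambda>t. tfield M \<Delta> q t (y t))" using y by (simp add: tsub_def)
    then show "AE \<tau> in lebesgue. c < \<tau> \<and> \<tau> < d \<and> 0 < y \<tau> - x \<tau> \<longrightarrow>
         (\<exists>D'. ((\<lambda>t. y t - x t) has_real_derivative D') (at \<tau>) \<and> D' \<le> 2 * (M + B) * (y \<tau> - x \<tau>))"
      using tsol_deriv[OF x]
    proof eventually_elim
      case (elim t)
      show ?case (is "_ \<longrightarrow> ?C")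
      proof
        assume t: "c < t \<and> t < d \<and> 0 < y t - x t"
        then obtain y' where y': "(y has_real_derivative y') (at t)" "y' \<le> tfield M \<Delta> q t (y t)"
          using elim by blast
        have "((\<lambda>t. y t - x t) has_real_derivative y' - tfield M \<Delta> q t (x t)) (at t)"
          using y'(1) elim(2) t by (intro DERIV_diff) auto
        moreover have "y' - tfield M \<Delta> q t (x t) \<le> 2 * (M + B) * (y t - x t)"
          using y'(2) tfield_lip[OF \<Delta> M, of q t "y t" "x t"] t by simp
        ultimately show ?C
          by blast
      qed
    qed
  qed
  then show ?thesis by simp
qed

text \<open>The origin of the threshold 2 B + 1: at \<plusminus>M the distance to \<Delta> is at
  least B + 1, and (B + 1)^2 exceeds the bound B of q.\<close>

lemma tfield_outside:
  assumes "bdd_meas B \<Delta>" "bdd_meas B q" "M \<ge> 2 * B + 1" "\<bar>x\<bar> \<ge> M"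
  shows "tfield M \<Delta> q t x \<le> 0"
proof -
  have B: "B \<ge> 0" by (rule bdd_meas_nonneg[OF assms(1)])
  have \<Delta>: "\<bar>\<Delta> t\<bar> \<le> B" and q: "\<bar>q t\<bar> \<le> B" using assms by (auto dest: bdd_measD)
  have "trunc M x = M \<or> trunc M x = - M" using assms(4) by (auto simp: trunc_def)
  then have "B + 1 \<le> \<bar>trunc M x - \<Delta> t\<bar>" using \<Delta> assms(3) B by auto
  then have "(B + 1)\<^sup>2 \<le> \<bar>trunc M x - \<Delta> t\<bar>\<^sup>2" using B by (intro power_mono) auto
  moreover have "B \<le> (B + 1)\<^sup>2" using B by (simp add: power2_eq_square algebra_simps)
  ultimately show ?thesis using q by (simp add: tfield_def)
qed

text \<open>Since the field is nonpositive beyond \<plusminus>M, the level M cannot be crossed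
  upwards. The same sign lets forward solutions fall through -M; at that level only backward
  solutions are confined.\<close>

lemma tsol_le_M:
  assumes \<Delta>: "bdd_meas B \<Delta>" "bdd_meas B q" and M: "M \<ge> 2 * B + 1"
    and x: "tsol \<Delta> q M c d x" and cd: "c \<le> d" and le: "x c \<le> M"
  shows "x d \<le> M"
proof -
  have "x d - M \<le> 0"
  proof (rule differential_inequality[where L=0 and D="\<lambda>t. x t - M", OF _ cd])
    show "lip c d (\<lambda>t. x t - M)" using x by (auto simp: tsol_def)
    show "x c - M \<le> 0" using le by simp
    from tsol_deriv[OF x] show "AE \<tau> in lebesgue. c < \<tau> \<and> \<tau> < d \<and> 0 < x \<tau> - M \<longrightarrow>
         (\<exists>D'. ((\<lambda>t. x t - M) has_real_derivative D') (at \<tau>) \<and> D' \<le> 0 * (x \<tau> - M))"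
    proof eventually_elim
      case (elim t)
      show ?case (is "_ \<longrightarrow> ?C")
      proof
        assume t: "c < t \<and> t < d \<and> 0 < x t - M"
        have "((\<lambda>t. x t - M) has_real_derivative tfield M \<Delta> q t (x t) - 0) (at t)"
          using elim t by (intro DERIV_diff) auto
        moreover have "tfield M \<Delta> q t (x t) - 0 \<le> 0 * (x t - M)"
          using tfield_outside[OF \<Delta> M, of "x t" t] t M bdd_meas_nonneg[OF \<Delta>(1)] by simp
        ultimately show ?C
          by blast
      qed
    qed
  qed
  then show ?thesis by simp
qed

section \<open>Time reversal\<close>

lemma trunc_uminus: "M \<ge> 0 \<Longrightarrow> trunc M (- x) = - trunc M x"
  by (auto simp: trunc_def)

text \<open>The map (t, x) to (-t, -x) preserves the form of the equation, with \<Delta>(t) replaced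
  by -\<Delta>(-t) and q(t) by q(-t), and exchanges attractor and repeller. Statements about the
  past or about a thus yield statements about the future or about r.\<close>

lemma tfield_reflect:
  "M \<ge> 0 \<Longrightarrow> tfield M (\<lambda>t. - \<Delta> (- t)) (\<lambda>t. q (- t)) t (- x) = tfield M \<Delta> q (- t) x"
  by (simp add: tfield_def trunc_uminus power2_commute)

lemma tsol_reflect:
  assumes "M \<ge> 0" and x: "tsol \<Delta> q M c d x"
  shows "tsol (\<lambda>t. - \<Delta> (- t)) (\<lambda>t. q (- t)) M (- d) (- c) (\<lambda>t. - x (- t))"
proof -
  from AE_lebesgue_uminus[OF tsol_deriv[OF x]]
  have "AE t in lebesgue. - d < t \<and> t < - c \<longrightarrow>
      ((\<lambda>t. - x (- t)) has_real_derivative tfield M (\<lambda>t. - \<Delta> (- t)) (\<lambda>t. q (- t)) t (- x (- t))) (at t)"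
  proof eventually_elim
    case (elim t)
    then show ?case
      by (auto simp: tfield_reflect[OF assms(1)] dest!: deriv_reflect intro: DERIV_minus[THEN DERIV_cong])
  qed
  then show ?thesis using x by (auto simp: tsol_def intro: lip_reflect)
qed

lemma bdd_meas_reflect_uminus: "bdd_meas B f \<Longrightarrow> bdd_meas B (\<lambda>t. - f (- t))"
  by (intro bdd_meas_uminus bdd_meas_reflect)

lemma tsub_reflect:
  assumes "M \<ge> 0" and y: "tsub \<Delta> q M c d y"
  shows "tsub (\<lambda>t. - \<Delta> (- t)) (\<lambda>t. q (- t)) M (- d) (- c) (\<lambda>t. - y (- t))"
proof -
  have "ae_deriv_le c d y (\<lambda>t. tfield M \<Delta> q t (y t))"
    using y by (auto simp: tsub_def)
  from AE_lebesgue_uminus[OF this]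
  have "ae_deriv_le (- d) (- c) (\<lambda>t. - y (- t)) (\<lambda>t. tfield M (\<lambda>t. - \<Delta> (- t)) (\<lambda>t. q (- t)) t (- y (- t)))"
  proof eventually_elim
    case (elim t)
    show ?case (is "_ \<longrightarrow> ?C")
    proof
      assume "- d < t \<and> t < - c"
      then obtain y' where "(y has_real_derivative y') (at (- t))" "y' \<le> tfield M \<Delta> q (- t) (y (- t))"
        using elim by auto
      then show ?C
        using DERIV_minus[OF deriv_reflect, of y y' t] by (auto simp: tfield_reflect[OF assms(1)])
    qed
  qed
  then show ?thesis using y by (auto simp: tsub_def intro: lip_reflect)
qed

text \<open>Reflection maps lower solutions to lower solutions, because the two sign changes in the
  derivative cancel. In effect a solution can cross a lower solution only upwards as time
  increases.\<close>

lemma tsol_le_tsub_backward: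
  assumes \<Delta>: "bdd_meas B \<Delta>" and M: "M \<ge> 0"
    and y: "tsub \<Delta> q M c d y" and x: "tsol \<Delta> q M c d x" and cd: "c \<le> d" and le: "x d \<le> y d"
  shows "x c \<le> y c"
  using tsub_le_tsol[OF bdd_meas_reflect_uminus[OF \<Delta>] M tsub_reflect[OF M y] tsol_reflect[OF M x]] cd le
  by simp

lemma tsol_ge_M_backward:
  assumes \<Delta>: "bdd_meas B \<Delta>" "bdd_meas B q" and M: "M \<ge> 2 * B + 1"
    and x: "tsol \<Delta> q M c d x" and cd: "c \<le> d" and le: "- M \<le> x d"
  shows "- M \<le> x c"
proof -
  have "M \<ge> 0" using M bdd_meas_nonneg[OF \<Delta>(1)] by simp
  from tsol_le_M[OF bdd_meas_reflect_uminus[OF \<Delta>(1)] bdd_meas_reflect[OF \<Delta>(2)] M tsol_reflect[OF this x]]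
  show ?thesis using cd le by simp
qed

lemma tsol_exists_backward:
  assumes \<Delta>: "bdd_meas B \<Delta>" and q: "bdd_meas B q" and M: "M \<ge> 0"
  obtains x where "x s = x0" "\<And>T. tsol \<Delta> q M T s x"
proof -
  obtain x where x: "x (- s) = - x0" "\<And>T. tsol (\<lambda>t. - \<Delta> (- t)) (\<lambda>t. q (- t)) M (- s) T x"
    using tsol_exists[OF bdd_meas_reflect_uminus[OF \<Delta>] bdd_meas_reflect[OF q] M] by metis
  show ?thesis
  proof (rule that[of "\<lambda>t. - x (- t)"])
    show "- x (- s) = x0" using x(1) by simp
    show "tsol \<Delta> q M T s (\<lambda>t. - x (- t))" for T
      using tsol_reflect[OF M x(2)[of "- T"]] by simp
  qed
qed

lemma tsol_mono:
  assumes "bdd_meas B \<Delta>" "M \<ge> 0" "tsol \<Delta> q M c d x" "tsol \<Delta> q M c d y" "c \<le> d" "x c \<le> y c"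
  shows "x d \<le> y d"
  using tsub_le_tsol[OF assms(1,2) tsol_imp_tsub[OF assms(3)] assms(4-6)] .

lemma tsol_strict_mono:
  assumes "bdd_meas B \<Delta>" "M \<ge> 0" "tsol \<Delta> q M c d x" "tsol \<Delta> q M c d y" "c \<le> d" "x c < y c"
  shows "x d < y d"
  using tsol_le_tsub_backward[OF assms(1,2) tsol_imp_tsub[OF assms(3)] assms(4,5)] assms(6) by linarith

section \<open>Passing between the original and the truncated equation\<close>

lemma continuous_on_UNIV_if_lip:
  assumes "\<And>c d. lip c d f" shows "continuous_on UNIV f"
proof -
  have "isCont f t" for t
    using continuous_on_interior[OF lip_continuous_on[OF assms[of "t - 1" "t + 1"]], of t] by simp
  then show ?thesis by (simp add: continuous_on_eq_continuous_at)
qed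

lemma tsol_change_M:
  assumes "\<And>t. c \<le> t \<Longrightarrow> t \<le> d \<Longrightarrow> \<bar>x t\<bar> \<le> M" "M \<le> M'"
  shows "tsol \<Delta> q M c d x \<longleftrightarrow> tsol \<Delta> q M' c d x"
proof -
  have "c < t \<Longrightarrow> t < d \<Longrightarrow> tfield M \<Delta> q t (x t) = tfield M' \<Delta> q t (x t)" for t
    using assms(1)[of t] assms(2) by (simp add: tfield_id)
  then show ?thesis unfolding tsol_def by (intro conj_cong arg_cong[where f="\<lambda>P. eventually P _"] ext) auto
qed

lemma solution_imp_tsol:
  assumes \<Delta>: "bdd_meas B \<Delta>" and q: "bdd_meas B q" and M: "M \<ge> 0"
    and sol: "solution_on \<Delta> q I x" and sub: "{c..d} \<subseteq> I" and bd: "\<And>t. c \<le> t \<Longrightarrow> t \<le> d \<Longrightarrow> \<bar>x t\<bar> \<le> M"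
  shows "tsol \<Delta> q M c d x"
proof -
  have ac: "absolutely_continuous_on c d x" using sol sub by (auto simp: solution_on_def)
  have "AE t in lebesgue. t \<in> I \<longrightarrow> (x has_real_derivative (- (x t - \<Delta> t)\<^sup>2 + q t)) (at t within I)"
    using sol by (auto simp: solution_on_def)
  then have ae: "AE t in lebesgue. c < t \<and> t < d \<longrightarrow> (x has_real_derivative tfield M \<Delta> q t (x t)) (at t)"
  proof eventually_elim
    case (elim t)
    show ?case (is "_ \<longrightarrow> ?C")
    proof
      assume t: "c < t \<and> t < d"
      then have "t \<in> interior I" using sub interior_mono[OF sub] by (simp add: subset_iff)
      then have "at t within I = at t" by (rule at_within_interior)
      moreover have "t \<in> I" using \<open>t \<in> interior I\<close> interior_subset by blast
      ultimately show ?C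
        using elim bd[of t] t by (simp add: tfield_id)
    qed
  qed
  have "lip c d x" unfolding lip_def
  proof (rule exI, rule abs_cont_bounded_deriv_lip[OF ac])
    from ae show "AE t in lebesgue. c < t \<and> t < d \<longrightarrow>
        (\<exists>f'. \<bar>f'\<bar> \<le> (M + B)\<^sup>2 + B \<and> (x has_real_derivative f') (at t))"
      by eventually_elim (use tfield_bound[OF \<Delta> q M] in blast)
  qed
  with ae show ?thesis by (simp add: tsol_def)
qed

lemma AE_real_if_AE_intervals:
  assumes "\<And>n :: nat. AE t in lebesgue. - real n < t \<and> t < real n \<longrightarrow> P t"
  shows "AE t in lebesgue. P t"
proof -
  have "AE t in lebesgue. \<forall>n :: nat. - real n < t \<and> t < real n \<longrightarrow> P t"
    by (subst AE_all_countable) (use assms in blast)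
  then show ?thesis
  proof eventually_elim
    case (elim t)
    obtain n :: nat where "\<bar>t\<bar> < real n" using reals_Archimedean2 by blast
    with elim show ?case by (auto simp: abs_less_iff)
  qed
qed

lemma tsol_imp_solution:
  assumes "\<And>c d. tsol \<Delta> q M c d x" and "\<And>t. \<bar>x t\<bar> \<le> M"
  shows "bounded_solution \<Delta> q x"
  unfolding bounded_solution_def solution_on_def
proof (intro conjI allI impI)
  show "absolutely_continuous_on c d x" for c d
    using assms(1)[of c d] by (auto simp: tsol_def intro: lip_imp_abs_cont)
  show "AE t in lebesgue. t \<in> UNIV \<longrightarrow> (x has_real_derivative - (x t - \<Delta> t)\<^sup>2 + q t) (at t within UNIV)"
  proof (rule AE_real_if_AE_intervals)
    fix n :: nat
    from tsol_deriv[OF assms(1)] show "AE t in lebesgue. - real n < t \<and> t < real n \<longrightarrow> t \<in> UNIV \<longrightarrow>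
        (x has_real_derivative - (x t - \<Delta> t)\<^sup>2 + q t) (at t within UNIV)"
      by eventually_elim (simp add: tfield_id[OF assms(2)])
  qed
  show "bounded (range x)" using assms(2) by (auto simp: bounded_iff)
qed (simp add: is_interval_univ)

text \<open>With e = exp (c (\<tau> - s)) and K = k / c, the quantity W e grows at rate at most c -
  2 z where W > 0, whereas u \<ge> c makes K u grow at rate at least c - 2 z. Hence D = W e - K u
  satisfies D' \<le> (c - 2 z) D \<le> (c + L) D where D > 0, and D s \<le> 0 by the choice of K. As
  only inequalities are asked of W and u, W may be an exponential or a difference of solutions, and
  u the distance to a solution or to a lower solution.\<close>

lemma exponential_domination:
  assumes st: "s \<le> t" and lW: "lip s t W" and lu: "lip s t u" and c: "c > 0" and k: "k \<ge> 0" "W s \<le> k"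
    and L: "\<And>\<tau>. s \<le> \<tau> \<Longrightarrow> \<tau> \<le> t \<Longrightarrow> \<bar>2 * z \<tau>\<bar> \<le> L"
    and W: "AE \<tau> in lebesgue. s < \<tau> \<and> \<tau> < t \<and> W \<tau> > 0 \<longrightarrow>
        (\<exists>W'. (W has_real_derivative W') (at \<tau>) \<and> W' \<le> - 2 * z \<tau> * W \<tau>)"
    and u: "AE \<tau> in lebesgue. s < \<tau> \<and> \<tau> < t \<longrightarrow>
        (\<exists>u'. (u has_real_derivative u') (at \<tau>) \<and> - u \<tau> * (2 * z \<tau> - u \<tau>) \<le> u')"
    and uc: "\<And>\<tau>. s \<le> \<tau> \<Longrightarrow> \<tau> \<le> t \<Longrightarrow> c \<le> u \<tau>"
  shows "W t * exp (c * (t - s)) \<le> k / c * u t"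
proof -
  define K where "K = k / c"
  have K: "K \<ge> 0" using c k by (simp add: K_def)
  define e where "e \<tau> = exp (c * \<tau> + - (c * s))" for \<tau>
  have e: "e \<tau> > 0" for \<tau> by (simp add: e_def)
  have "W t * e t - K * u t \<le> 0"
  proof (rule differential_inequality[where D="\<lambda>\<tau>. W \<tau> * e \<tau> - K * u \<tau>" and L="c + L", OF _ st])
    show "lip s t (\<lambda>\<tau>. W \<tau> * e \<tau> - K * u \<tau>)"
      unfolding e_def by (intro lip_diff lip_mult lW lu lip_const lip_comp_exp lip_add lip_linear)
    have "K * c \<le> K * u s" using uc[of s] st K by (intro mult_left_mono) auto
    then show "W s * e s - K * u s \<le> 0" using k c by (simp add: e_def K_def)
    from W u show "AE \<tau> in lebesgue. s < \<tau> \<and> \<tau> < t \<and> 0 < W \<tau> * e \<tau> - K * u \<tau> \<longrightarrow>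
       (\<exists>D'. ((\<lambda>\<tau>. W \<tau> * e \<tau> - K * u \<tau>) has_real_derivative D') (at \<tau>) \<and>
              D' \<le> (c + L) * (W \<tau> * e \<tau> - K * u \<tau>))"
    proof eventually_elim
      case (elim \<tau>)
      show ?case (is "_ \<longrightarrow> ?C")
      proof
        assume \<tau>: "s < \<tau> \<and> \<tau> < t \<and> 0 < W \<tau> * e \<tau> - K * u \<tau>"
        have uc': "c \<le> u \<tau>" using uc \<tau> by simp
        have "0 \<le> K * u \<tau>" using K uc' c by simp
        then have "W \<tau> * e \<tau> > 0" using \<tau> by linarith
        then have W0: "W \<tau> > 0" using e[of \<tau>] by (simp add: zero_less_mult_iff)
        obtain W' where W': "(W has_real_derivative W') (at \<tau>)" "W' \<le> - 2 * z \<tau> * W \<tau>"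
          using elim(1) \<tau> W0 by blast
        obtain u' where u': "(u has_real_derivative u') (at \<tau>)" "- u \<tau> * (2 * z \<tau> - u \<tau>) \<le> u'"
          using elim(2) \<tau> by blast
        have de: "(e has_real_derivative c * e \<tau>) (at \<tau>)"
          unfolding e_def by (auto intro!: derivative_eq_intros)
        have "((\<lambda>\<tau>. W \<tau> * e \<tau> - K * u \<tau>) has_real_derivative (W' * e \<tau> + c * e \<tau> * W \<tau>) - K * u') (at \<tau>)"
          by (intro DERIV_diff DERIV_cmult DERIV_mult W'(1) u'(1) de)
        moreover have "(W' * e \<tau> + c * e \<tau> * W \<tau>) - K * u' \<le> (c + L) * (W \<tau> * e \<tau> - K * u \<tau>)"
        proof -
          have 1: "W' * e \<tau> \<le> - 2 * z \<tau> * W \<tau> * e \<tau>" using W'(2) e[of \<tau>] by (intro mult_right_mono) auto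
          have 2: "K * (- u \<tau> * (2 * z \<tau> - u \<tau>)) \<le> K * u'" using u'(2) K by (intro mult_left_mono) auto
          have 3: "K * (c * u \<tau>) \<le> K * (u \<tau> * u \<tau>)" using K uc' c by (intro mult_left_mono mult_right_mono) auto
          have 4: "- (2 * z \<tau>) * (W \<tau> * e \<tau> - K * u \<tau>) \<le> L * (W \<tau> * e \<tau> - K * u \<tau>)"
            using L[of \<tau>] \<tau> by (intro mult_right_mono) (auto simp: abs_le_iff)
          have "(W' * e \<tau> + c * e \<tau> * W \<tau>) - K * u' \<le>
              - (2 * z \<tau>) * (W \<tau> * e \<tau> - K * u \<tau>) + c * (W \<tau> * e \<tau> - K * u \<tau>)"
            using 1 2 3 by (simp add: algebra_simps)
          also have "\<dots> \<le> L * (W \<tau> * e \<tau> - K * u \<tau>) + c * (W \<tau> * e \<tau> - K * u \<tau>)" using 4 by simp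
          finally show ?thesis by (simp add: distrib_right)
        qed
        ultimately show ?C by blast
      qed
    qed
  qed
  then show ?thesis by (simp add: e_def K_def right_diff_distrib)
qed

text \<open>Both parts compare with u = a - r \<le> 2 M. In the first, W is the exponential itself,
  so W s = 1. In the second, W = x - a obeys W' = -2 (a - \<Delta>) W - W^2; letting s recede rules
  out a positive value at t, so a is maximal among these solutions.\<close>

lemma separated_attractive:
  assumes \<Delta>: "bdd_meas B \<Delta>" and q: "bdd_meas B q"
    and a: "\<And>c d. tsol \<Delta> q M c d a" "\<And>t. \<bar>a t\<bar> \<le> M"
    and r: "\<And>c d. tsol \<Delta> q M c d r" "\<And>t. \<bar>r t\<bar> \<le> M"
    and c: "c > 0" and sep: "\<And>t. c \<le> a t - r t"
  shows "s \<le> t \<Longrightarrow> exp (integral {s..t} (\<lambda>l. - 2 * (a l - \<Delta> l))) \<le> 2 * M / c * exp (- c * (t - s))"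
    and "\<lbrakk>\<And>c d. tsol \<Delta> q M c d x; \<And>t. \<bar>x t\<bar> \<le> M\<rbrakk> \<Longrightarrow> x t \<le> a t"
proof -
  have M: "M \<ge> 0" using a(2)[of 0] by linarith
  have ae: "AE t in lebesgue. s < t \<and> t < t' \<longrightarrow> (y has_real_derivative (- (y t - \<Delta> t)\<^sup>2 + q t)) (at t)"
    if "\<And>c d. tsol \<Delta> q M c d y" "\<And>t. \<bar>y t\<bar> \<le> M" for s t' y
  proof -
    show ?thesis using tsol_deriv[OF that(1), of s t'] by eventually_elim (simp add: tfield_id[OF that(2)])
  qed
  have lip: "lip s t y" if "\<And>c d. tsol \<Delta> q M c d y" for s t y
    using that[of s t] by (simp add: tsol_def)
  have L: "\<bar>2 * (a \<tau> - \<Delta> \<tau>)\<bar> \<le> 2 * (M + B)" for \<tau>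
    using a(2)[of \<tau>] bdd_measD(2)[OF \<Delta>, of \<tau>] by (auto simp: abs_le_iff)
  have u: "AE \<tau> in lebesgue. s < \<tau> \<and> \<tau> < t \<longrightarrow> (\<exists>u'. ((\<lambda>t. a t - r t) has_real_derivative u') (at \<tau>) \<and>
       - (a \<tau> - r \<tau>) * (2 * (a \<tau> - \<Delta> \<tau>) - (a \<tau> - r \<tau>)) \<le> u')" for s t
    using ae[OF a, of s t] ae[OF r, of s t]
  proof eventually_elim
    case (elim \<tau>)
    show ?case (is "_ \<longrightarrow> ?C")
    proof
      assume "s < \<tau> \<and> \<tau> < t"
      with elim have "((\<lambda>t. a t - r t) has_real_derivative (- (a \<tau> - \<Delta> \<tau>)\<^sup>2 + q \<tau>) - (- (r \<tau> - \<Delta> \<tau>)\<^sup>2 + q \<tau>)) (at \<tau>)"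
        by (intro DERIV_diff) auto
      moreover have "- (a \<tau> - r \<tau>) * (2 * (a \<tau> - \<Delta> \<tau>) - (a \<tau> - r \<tau>)) = (- (a \<tau> - \<Delta> \<tau>)\<^sup>2 + q \<tau>) - (- (r \<tau> - \<Delta> \<tau>)\<^sup>2 + q \<tau>)"
        by (simp add: power2_eq_square algebra_simps)
      ultimately show ?C by (metis order_refl)
    qed
  qed
  have ub: "a t - r t \<le> 2 * M" for t using a(2)[of t] r(2)[of t] by (simp add: abs_le_iff)
  {
    assume st: "s \<le> t"
    define f where "f l = - 2 * (a l - \<Delta> l)" for l
    have ca: "continuous_on UNIV a" by (rule continuous_on_UNIV_if_lip) (rule lip[OF a(1)])
    have f: "bdd_meas (2 * (M + B)) f"
      unfolding bdd_meas_def
    proof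
      have [measurable]: "a \<in> borel_measurable lebesgue" "\<Delta> \<in> borel_measurable lebesgue"
        using continuous_imp_measurable_lebesgue[OF ca] bdd_measD(1)[OF \<Delta>] .
      show "f \<in> borel_measurable lebesgue" unfolding f_def by measurable
      show "\<forall>t. \<bar>f t\<bar> \<le> 2 * (M + B)" using L unfolding f_def abs_mult by simp
    qed
    define W where "W \<tau> = exp (integral {s..\<tau>} f)" for \<tau>
    have "W t * exp (c * (t - s)) \<le> 1 / c * (a t - r t)"
    proof (rule exponential_domination[where z="\<lambda>\<tau>. a \<tau> - \<Delta> \<tau>", OF st _ lip_diff[OF lip[OF a(1)] lip[OF r(1)]] c _ _ L _ u sep])
      show "lip s t W" unfolding W_def
        using bdd_meas_integral_lipschitz[OF f] by (intro lip_comp_exp) (auto simp: lip_def)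
      show "W s \<le> 1" by (simp add: W_def)
      from bdd_meas_integral_deriv[OF f, of s]
      show "AE \<tau> in lebesgue. s < \<tau> \<and> \<tau> < t \<and> 0 < W \<tau> \<longrightarrow>
         (\<exists>W'. (W has_real_derivative W') (at \<tau>) \<and> W' \<le> - 2 * (a \<tau> - \<Delta> \<tau>) * W \<tau>)"
      proof eventually_elim
        case (elim \<tau>)
        show ?case (is "_ \<longrightarrow> ?C")
        proof
          assume "s < \<tau> \<and> \<tau> < t \<and> 0 < W \<tau>"
          then have "(W has_real_derivative W \<tau> * f \<tau>) (at \<tau>)"
            unfolding W_def using elim by (intro DERIV_fun_exp) auto
          then show ?C
            by (intro exI[of _ "W \<tau> * f \<tau>"]) (auto simp: f_def)
        qed
      qed
    qed simp
    also have "\<dots> \<le> 1 / c * (2 * M)" using ub[of t] c by (intro mult_left_mono) auto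
    finally have "W t * exp (c * (t - s)) * exp (- c * (t - s)) \<le> 2 * M / c * exp (- c * (t - s))"
      by (intro mult_right_mono) auto
    then show "exp (integral {s..t} (\<lambda>l. - 2 * (a l - \<Delta> l))) \<le> 2 * M / c * exp (- c * (t - s))"
      by (simp add: W_def f_def[abs_def] mult.assoc exp_add[symmetric])
  }
  {
    assume x: "\<And>c d. tsol \<Delta> q M c d x" "\<And>t. \<bar>x t\<bar> \<le> M"
    have bound: "(x t - a t) * exp (c * (t - s)) \<le> 2 * M / c * (2 * M)" if st: "s \<le> t" for s
    proof -
      have "(x t - a t) * exp (c * (t - s)) \<le> 2 * M / c * (a t - r t)"
      proof (rule exponential_domination[where z="\<lambda>\<tau>. a \<tau> - \<Delta> \<tau>", OF st lip_diff[OF lip[OF x(1)] lip[OF a(1)]]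
            lip_diff[OF lip[OF a(1)] lip[OF r(1)]] c _ _ L _ u sep])
        show "2 * M \<ge> 0" using M by simp
        show "x s - a s \<le> 2 * M" using x(2)[of s] a(2)[of s] by (simp add: abs_le_iff)
        from ae[OF x, of s t] ae[OF a, of s t]
        show "AE \<tau> in lebesgue. s < \<tau> \<and> \<tau> < t \<and> 0 < x \<tau> - a \<tau> \<longrightarrow>
         (\<exists>W'. ((\<lambda>\<tau>. x \<tau> - a \<tau>) has_real_derivative W') (at \<tau>) \<and> W' \<le> - 2 * (a \<tau> - \<Delta> \<tau>) * (x \<tau> - a \<tau>))"
        proof eventually_elim
          case (elim \<tau>)
          show ?case (is "_ \<longrightarrow> ?C")
          proof
            assume "s < \<tau> \<and> \<tau> < t \<and> 0 < x \<tau> - a \<tau>"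
            with elim have "((\<lambda>t. x t - a t) has_real_derivative (- (x \<tau> - \<Delta> \<tau>)\<^sup>2 + q \<tau>) - (- (a \<tau> - \<Delta> \<tau>)\<^sup>2 + q \<tau>)) (at \<tau>)"
              by (intro DERIV_diff) auto
            moreover have "(- (x \<tau> - \<Delta> \<tau>)\<^sup>2 + q \<tau>) - (- (a \<tau> - \<Delta> \<tau>)\<^sup>2 + q \<tau>) =
                - 2 * (a \<tau> - \<Delta> \<tau>) * (x \<tau> - a \<tau>) - (x \<tau> - a \<tau>)\<^sup>2"
              by (simp add: power2_eq_square algebra_simps)
            ultimately show ?C
              by (intro exI[of _ "(- (x \<tau> - \<Delta> \<tau>)\<^sup>2 + q \<tau>) - (- (a \<tau> - \<Delta> \<tau>)\<^sup>2 + q \<tau>)"]) simp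
          qed
        qed
      qed
      also have "\<dots> \<le> 2 * M / c * (2 * M)" using ub[of t] c M by (intro mult_left_mono) auto
      finally show ?thesis .
    qed
    show "x t \<le> a t"
    proof (rule ccontr)
      assume "\<not> x t \<le> a t"
      then have w: "x t - a t > 0" by simp
      define Q where "Q = 2 * M / c * (2 * M)"
      have Q: "Q \<ge> 0" using M c by (simp add: Q_def)
      \<comment> \<open>With this h, (x t - a t) (1 + c h) = (x t - a t) + Q > Q, which contradicts
        the bound with starting time t - h without passing to a limit.\<close>
      define h where "h = Q / (c * (x t - a t))"
      have h: "h \<ge> 0" using Q c w by (simp add: h_def)
      have "(x t - a t) * exp (c * h) \<le> Q" using bound[of "t - h"] h by (simp add: Q_def)
      moreover have "(x t - a t) * (1 + c * h) \<le> (x t - a t) * exp (c * h)"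
        using w exp_ge_add_one_self by (intro mult_left_mono) auto
      moreover have "(x t - a t) * (c * h) = Q" using w c by (simp add: h_def)
      ultimately show False using w by (simp add: distrib_left)
    qed
  }
qed

lemma separated_imp_attractor_repeller_pair:
  assumes \<Delta>: "bdd_meas B \<Delta>" and q: "bdd_meas B q"
    and a: "\<And>c d. tsol \<Delta> q M c d a" "\<And>t. \<bar>a t\<bar> \<le> M"
    and r: "\<And>c d. tsol \<Delta> q M c d r" "\<And>t. \<bar>r t\<bar> \<le> M"
    and c: "c > 0" and sep: "\<And>t. c \<le> a t - r t"
  shows "attractor_repeller_pair \<Delta> q a r"
proof -
  have M0: "M \<ge> 0" using a(2)[of 0] by linarith
  define \<Delta>' where "\<Delta>' t = - \<Delta> (- t)" for t
  define q' where "q' t = q (- t)" for t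
  have \<Delta>': "bdd_meas B \<Delta>'" unfolding \<Delta>'_def by (rule bdd_meas_reflect_uminus[OF \<Delta>])
  have q': "bdd_meas B q'" unfolding q'_def by (rule bdd_meas_reflect[OF q])
  have refl: "tsol \<Delta>' q' M c d (\<lambda>t. - y (- t))" if "\<And>c d. tsol \<Delta> q M c d y" "M \<ge> 0" for y c d M
    using tsol_reflect[OF that(2) that(1)[of "- d" "- c"]] by (simp add: \<Delta>'_def[abs_def] q'_def[abs_def])
  have max: "r t \<le> x t \<and> x t \<le> a t" if "bounded_solution \<Delta> q x" for x t
  proof -
    from that obtain Mx where Mx: "\<And>t. \<bar>x t\<bar> \<le> Mx" by (auto simp: bounded_solution_def bounded_iff)
    \<comment> \<open>The competitor x may exceed M; a and r also solve the equation truncated at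
      the larger level.\<close>
    define M' where "M' = max M Mx"
    have M': "M' \<ge> 0" "M \<le> M'" using M0 by (auto simp: M'_def)
    have x': "\<bar>x t\<bar> \<le> M'" for t using Mx[of t] by (simp add: M'_def)
    have x: "tsol \<Delta> q M' c d x" for c d
      using that x' by (intro solution_imp_tsol[OF \<Delta> q M'(1)]) (auto simp: bounded_solution_def)
    have a': "tsol \<Delta> q M' c d a" "\<bar>a t\<bar> \<le> M'" for c d t
      using a tsol_change_M[of c d a M M' \<Delta> q] M'(2) order_trans[OF a(2)[of t]] by auto
    have r': "tsol \<Delta> q M' c d r" "\<bar>r t\<bar> \<le> M'" for c d t
      using r tsol_change_M[of c d r M M' \<Delta> q] M'(2) order_trans[OF r(2)[of t]] by auto
    have "x t \<le> a t" by (rule separated_attractive(2)[OF \<Delta> q a' r' c sep x x'])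
    \<comment> \<open>After reflection -r(-t) is the upper solution and -a(-t) the lower
      one.\<close>
    moreover have "- x (- (- t)) \<le> - r (- (- t))"
      by (rule separated_attractive(2)[where M=M' and a="\<lambda>t. - r (- t)" and r="\<lambda>t. - a (- t)" and c=c, OF \<Delta>' q'])
        (use refl[OF r'(1) M'(1)] refl[OF a'(1) M'(1)] refl[OF x M'(1)] r' a' x' c sep in auto)
    ultimately show ?thesis by simp
  qed
  define k where "k = max 1 (2 * M / c)"
  have att: "exp (integral {s..t} (\<lambda>l. - 2 * (a l - \<Delta> l))) \<le> k * exp (- c * (t - s))" if "s \<le> t" for s t
  proof -
    have "exp (integral {s..t} (\<lambda>l. - 2 * (a l - \<Delta> l))) \<le> 2 * M / c * exp (- c * (t - s))"
      by (rule separated_attractive(1)[OF \<Delta> q a r c sep that])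
    also have "\<dots> \<le> k * exp (- c * (t - s))" by (intro mult_right_mono) (auto simp: k_def)
    finally show ?thesis .
  qed
  have rep: "exp (- integral {t..s} (\<lambda>l. - 2 * (r l - \<Delta> l))) \<le> k * exp (c * (t - s))" if "t \<le> s" for s t
  proof -
    have "exp (integral {- s..- t} (\<lambda>l. - 2 * (- r (- l) - \<Delta>' l))) \<le> 2 * M / c * exp (- c * (- t - - s))"
      by (rule separated_attractive(1)[where M=M and a="\<lambda>t. - r (- t)" and r="\<lambda>t. - a (- t)" and c=c, OF \<Delta>' q'])
        (use refl[OF r(1) M0] refl[OF a(1) M0] r a c sep that in auto)
    also have "integral {- s..- t} (\<lambda>l. - 2 * (- r (- l) - \<Delta>' l)) =
        integral {- s..- t} (\<lambda>l. (\<lambda>l. - (- 2 * (r l - \<Delta> l))) (- l))"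
      by (intro arg_cong[where f="integral _"] ext) (simp add: \<Delta>'_def)
    also have "\<dots> = integral {t..s} (\<lambda>l. - (- 2 * (r l - \<Delta> l)))"
      by (rule Henstock_Kurzweil_Integration.integral_reflect_real)
    also have "\<dots> = - integral {t..s} (\<lambda>l. - 2 * (r l - \<Delta> l))" by (rule integral_neg)
    also have "2 * M / c * exp (- c * (- t - - s)) \<le> k * exp (- c * (- t - - s))"
      by (intro mult_right_mono) (auto simp: k_def)
    also have "- c * (- t - - s) = c * (t - s)" by (simp add: algebra_simps)
    finally show ?thesis .
  qed
  show ?thesis
    unfolding attractor_repeller_pair_def
  proof (intro conjI)
    show "bounded_solution \<Delta> q a" "bounded_solution \<Delta> q r"
      using tsol_imp_solution[OF a] tsol_imp_solution[OF r] .
    show "\<forall>x. bounded_solution \<Delta> q x \<longrightarrow> (\<forall>t. r t \<le> x t \<and> x t \<le> a t)" using max by blast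
    have "1 \<le> k" by (simp add: k_def)
    then show "\<exists>k\<ge>1. \<exists>\<beta>>0.
        (\<forall>s t. s \<le> t \<longrightarrow> exp (integral {s..t} (\<lambda>l. - 2 * (a l - \<Delta> l))) \<le> k * exp (- \<beta> * (t - s))) \<and>
        (\<forall>s t. t \<le> s \<longrightarrow> exp (- integral {t..s} (\<lambda>l. - 2 * (r l - \<Delta> l))) \<le> k * exp (\<beta> * (t - s)))"
      using c att rep by blast
  qed
qed

section \<open>Limits of solutions started far in the past or in the future\<close>

lemma decreasing_limit:
  fixes f :: "nat \<Rightarrow> real"
  assumes "\<And>n. N \<le> n \<Longrightarrow> f (Suc n) \<le> f n" "\<And>n. N \<le> n \<Longrightarrow> L \<le> f n"
  shows "convergent f"
proof -
  have "decseq (\<lambda>n. f (n + N))" using assms(1) by (intro decseq_SucI) simp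
  moreover have "Bseq (\<lambda>n. f (n + N))"
  proof (rule BseqI')
    fix n
    have "f (n + N) \<le> f N" using \<open>decseq (\<lambda>n. f (n + N))\<close> by (auto dest: decseqD[of _ 0 n])
    then show "norm (f (n + N)) \<le> \<bar>L\<bar> + \<bar>f N\<bar>" using assms(2)[of "n + N"] by auto
  qed
  ultimately have "convergent (\<lambda>n. f (n + N))"
    by (intro Bseq_monoseq_convergent) (auto simp: decseq_imp_monoseq)
  then show ?thesis by (simp add: convergent_ignore_initial_segment)
qed

definition pullback_pair ::
  "(real \<Rightarrow> real) \<Rightarrow> (real \<Rightarrow> real) \<Rightarrow> real \<Rightarrow> nat \<Rightarrow> (real \<Rightarrow> real) \<Rightarrow> (real \<Rightarrow> real) \<Rightarrow> bool" where
  "pullback_pair \<Delta> q M n x X \<longleftrightarrow>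
     tsol \<Delta> q M (- real n) (real n) x \<and> x (- real n) = M \<and>
     tsol \<Delta> q M (- real n) (real n) X \<and> X (real n) = - M"

text \<open>At time -n the solution started at -(n + 1) is at most M, so \<open>x n\<close>
  decreases with n; likewise \<open>X n\<close> increases. The order \<open>X n \<le> x n\<close>
  supplies the missing bounds, since \<open>X n\<close> is at least -M and \<open>x n\<close> at
  most M. It also keeps the limits in [-M, M], where the truncation is invisible.\<close>

lemma pullback_limits:
  assumes \<Delta>: "bdd_meas B \<Delta>" and q: "bdd_meas B q" and M: "M \<ge> 2 * B + 1"
    and ord: "\<And>n x X t. pullback_pair \<Delta> q M n x X \<Longrightarrow> - real n \<le> t \<Longrightarrow> t \<le> real n \<Longrightarrow> X t \<le> x t"
  obtains x X a r where
    "\<And>n. x n (- real n) = M" "\<And>n d. tsol \<Delta> q M (- real n) d (x n)"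
    "\<And>n. X n (real n) = - M" "\<And>n c. tsol \<Delta> q M c (real n) (X n)"
    "\<And>t. (\<lambda>n. x n t) \<longlonglongrightarrow> a t" "\<And>t. (\<lambda>n. X n t) \<longlonglongrightarrow> r t"
    "\<And>c d. tsol \<Delta> q M c d a" "\<And>c d. tsol \<Delta> q M c d r"
    "\<And>t. \<bar>a t\<bar> \<le> M" "\<And>t. \<bar>r t\<bar> \<le> M"
proof -
  have M0: "M \<ge> 0" using M bdd_meas_nonneg[OF \<Delta>] by simp
  have "\<exists>x. x (- real n) = M \<and> (\<forall>d. tsol \<Delta> q M (- real n) d x)" for n
    using tsol_exists[OF \<Delta> q M0] by metis
  then obtain x where x: "\<And>n. x n (- real n) = M" "\<And>n d. tsol \<Delta> q M (- real n) d (x n)" by metis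
  have "\<exists>X. X (real n) = - M \<and> (\<forall>c. tsol \<Delta> q M c (real n) X)" for n
    using tsol_exists_backward[OF \<Delta> q M0] by metis
  then obtain X where X: "\<And>n. X n (real n) = - M" "\<And>n c. tsol \<Delta> q M c (real n) (X n)" by metis
  have le: "X n t \<le> x n t" if "\<bar>t\<bar> \<le> real n" for n t
    using ord[of n "x n" "X n" t] x X that by (auto simp: abs_le_iff pullback_pair_def)
  have xM: "x n t \<le> M" if "\<bar>t\<bar> \<le> real n" for n t
    using tsol_le_M[OF \<Delta> q M x(2)[of n t]] x(1)[of n] that by (auto simp: abs_le_iff)
  have XM: "- M \<le> X n t" if "\<bar>t\<bar> \<le> real n" for n t
    using tsol_ge_M_backward[OF \<Delta> q M X(2)[of t n]] X(1)[of n] that by (auto simp: abs_le_iff)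
  have dec: "x (Suc n) t \<le> x n t" if "\<bar>t\<bar> \<le> real n" for n t
  proof (rule tsol_mono[OF \<Delta> M0 tsol_subset[OF x(2)[of "Suc n" t]] x(2)[of n t]])
    show "x (Suc n) (- real n) \<le> x n (- real n)" using xM[of "- real n" "Suc n"] x(1)[of n] by simp
  qed (use that in \<open>auto simp: abs_le_iff\<close>)
  have inc: "X n t \<le> X (Suc n) t" if "\<bar>t\<bar> \<le> real n" for n t
  proof (rule tsol_le_tsub_backward[OF \<Delta> M0 tsol_imp_tsub[OF tsol_subset[OF X(2)[of t "Suc n"]]] X(2)[of t n]])
    show "X n (real n) \<le> X (Suc n) (real n)" using XM[of "real n" "Suc n"] X(1)[of n] by simp
  qed (use that in \<open>auto simp: abs_le_iff\<close>)
  have "convergent (\<lambda>n. x n t)" for t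
  proof -
    obtain N where N: "\<bar>t\<bar> \<le> real N" using real_arch_simple by blast
    show ?thesis
    proof (rule decreasing_limit[of N _ "- M"])
      fix n assume "N \<le> n"
      then have n: "\<bar>t\<bar> \<le> real n" using N by simp
      show "x (Suc n) t \<le> x n t" using dec[OF n] .
      show "- M \<le> x n t" using le[OF n] XM[OF n] by simp
    qed
  qed
  then obtain a where a: "\<And>t. (\<lambda>n. x n t) \<longlonglongrightarrow> a t" unfolding convergent_def by metis
  have "convergent (\<lambda>n. - X n t)" for t
  proof -
    obtain N where N: "\<bar>t\<bar> \<le> real N" using real_arch_simple by blast
    show ?thesis
    proof (rule decreasing_limit[of N _ "- M"])
      fix n assume "N \<le> n"
      then have n: "\<bar>t\<bar> \<le> real n" using N by simp
      show "- X (Suc n) t \<le> - X n t" using inc[OF n] by simp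
      show "- M \<le> - X n t" using le[OF n] xM[OF n] by simp
    qed
  qed
  then have "convergent (\<lambda>n. X n t)" for t by (simp add: convergent_minus_iff[symmetric])
  then obtain r where r: "\<And>t. (\<lambda>n. X n t) \<longlonglongrightarrow> r t" unfolding convergent_def by metis
  have ev: "\<exists>N. \<forall>n\<ge>N. \<bar>t\<bar> \<le> real n" for t
  proof -
    obtain N where N: "\<bar>t\<bar> \<le> real N" using real_arch_simple by blast
    then have "\<forall>n\<ge>N. \<bar>t\<bar> \<le> real n" by (auto intro: order_trans)
    then show ?thesis by blast
  qed
  have tsol_lim: "tsol \<Delta> q M c d f" if "\<And>n. c \<ge> - real n \<Longrightarrow> d \<le> real n \<Longrightarrow> tsol \<Delta> q M c d (F n)"
    "\<And>t. (\<lambda>n. F n t) \<longlonglongrightarrow> f t" for c d f F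
  proof (cases "c \<le> d")
    case False
    then show ?thesis by (auto simp: tsol_def lip_def intro!: exI[of _ 0] AE_I2)
  next
    case True
    obtain N :: nat where N: "max \<bar>c\<bar> \<bar>d\<bar> \<le> real N" using real_arch_simple by blast
    show ?thesis
    proof (rule tsol_limit[OF \<Delta> q M0 True, where X="\<lambda>n. F (n + N)"])
      show "tsol \<Delta> q M c d (F (n + N))" for n using N by (intro that(1)) auto
      show "(\<lambda>n. F (n + N) t) \<longlonglongrightarrow> f t" for t using that(2) by (rule LIMSEQ_ignore_initial_segment)
    qed
  qed
  have at: "tsol \<Delta> q M c d a" for c d by (rule tsol_lim[OF _ a]) (use tsol_subset[OF x(2)] in auto)
  have rt: "tsol \<Delta> q M c d r" for c d by (rule tsol_lim[OF _ r]) (use tsol_subset[OF X(2)] in auto)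
  have ra: "r t \<le> a t" "a t \<le> M" "- M \<le> r t" for t
  proof -
    show "r t \<le> a t" by (rule LIMSEQ_le[OF r a]) (use ev[of t] le in blast)
    show "a t \<le> M" by (rule LIMSEQ_le_const2[OF a]) (use ev[of t] xM in blast)
    show "- M \<le> r t" by (rule LIMSEQ_le_const[OF r]) (use ev[of t] XM in blast)
  qed
  show ?thesis
  proof (rule that[OF x X a r at rt])
    show "\<bar>a t\<bar> \<le> M" "\<bar>r t\<bar> \<le> M" for t using ra[of t] by (simp_all add: abs_le_iff)
  qed
qed

section \<open>Total tracking on the hull\<close>

lemma Linf_bounded_representative:
  assumes "p \<in> Linf"
  obtains B p' where "bdd_meas B p'" "AE t in lebesgue. p t = p' t"
proof -
  obtain M where M: "AE t in lebesgue. \<bar>p t\<bar> \<le> M" and [measurable]: "p \<in> borel_measurable lebesgue"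
    using assms by (auto simp: Linf_def)
  define p' where "p' t = (if \<bar>p t\<bar> \<le> M then p t else 0)" for t
  have "p' \<in> borel_measurable lebesgue" unfolding p'_def by measurable
  then have "bdd_meas \<bar>M\<bar> p'" by (auto simp: bdd_meas_def p'_def)
  moreover from M have "AE t in lebesgue. p t = p' t" by eventually_elim (simp add: p'_def)
  ultimately show ?thesis by (rule that)
qed

lemma solution_on_cong_AE:
  assumes "AE t in lebesgue. q t = q' t"
  shows "solution_on \<Delta> q I x \<longleftrightarrow> solution_on \<Delta> q' I x"
proof -
  have "(AE t in lebesgue. t \<in> I \<longrightarrow> (x has_real_derivative (- (x t - \<Delta> t)\<^sup>2 + q t)) (at t within I)) \<longleftrightarrow>
        (AE t in lebesgue. t \<in> I \<longrightarrow> (x has_real_derivative (- (x t - \<Delta> t)\<^sup>2 + q' t)) (at t within I))"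
    by (rule eventually_subst) (use assms in eventually_elim, simp)
  then show ?thesis by (simp add: solution_on_def)
qed

lemma attractor_repeller_pair_cong_AE:
  assumes "AE t in lebesgue. q t = q' t"
  shows "attractor_repeller_pair \<Delta> q a r \<longleftrightarrow> attractor_repeller_pair \<Delta> q' a r"
  unfolding attractor_repeller_pair_def bounded_solution_def solution_on_cong_AE[OF assms] ..

lemma attractor_repeller_pair_bounds:
  assumes p: "bdd_meas B p" and ar: "attractor_repeller_pair (\<lambda>t. 0) p a r"
  obtains M where "M \<ge> 0" "\<And>t. \<bar>a t\<bar> \<le> M" "\<And>t. \<bar>r t\<bar> \<le> M" "\<And>t. r t \<le> a t"
    "\<And>c d. lip c d a" "\<And>c d. lip c d r"
    "AE t in lebesgue. (a has_real_derivative - (a t)\<^sup>2 + p t) (at t)"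
    "AE t in lebesgue. (r has_real_derivative - (r t)\<^sup>2 + p t) (at t)"
proof -
  have bs: "bounded_solution (\<lambda>t. 0) p a" "bounded_solution (\<lambda>t. 0) p r" and ra: "\<And>t. r t \<le> a t"
    using ar by (auto simp: attractor_repeller_pair_def)
  obtain Ma where Ma: "\<And>t. \<bar>a t\<bar> \<le> Ma" using bs(1) by (auto simp: bounded_solution_def bounded_iff)
  obtain Mr where Mr: "\<And>t. \<bar>r t\<bar> \<le> Mr" using bs(2) by (auto simp: bounded_solution_def bounded_iff)
  define M where "M = max Ma Mr"
  have M: "\<bar>a t\<bar> \<le> M" "\<bar>r t\<bar> \<le> M" for t using Ma[of t] Mr[of t] by (auto simp: M_def)
  have M0: "M \<ge> 0" using M(1)[of 0] by linarith
  have z: "bdd_meas B (\<lambda>t. 0)" using bdd_meas_nonneg[OF p] by (simp add: bdd_meas_def)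
  show ?thesis
  proof (rule that[OF M0 M ra])
    show "lip c d a" "lip c d r" for c d
      using solution_imp_tsol[OF z p M0, of UNIV a c d] solution_imp_tsol[OF z p M0, of UNIV r c d] bs M
      by (auto simp: bounded_solution_def tsol_def)
    show "AE t in lebesgue. (a has_real_derivative - (a t)\<^sup>2 + p t) (at t)"
      "AE t in lebesgue. (r has_real_derivative - (r t)\<^sup>2 + p t) (at t)"
      using bs by (simp_all add: bounded_solution_def solution_on_def)
  qed
qed

text \<open>On a window of length l, hyperbolicity forces the integral of a to be at least 1/2 and
  that of r at most -1/2, so a - r has integral at least 1. Since (a - r)' = -(a + r) (a - r) \<ge>
  -2 M (a - r), a value in the window is at most exp (2 M l) times the value at its right end, which
  bounds a t - r t from below.\<close>

lemma attractor_repeller_pair_separated: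
  assumes p: "bdd_meas B p" and ar: "attractor_repeller_pair (\<lambda>t. 0) p a r"
  obtains \<eta> where "\<eta> > 0" "\<And>t. \<eta> \<le> a t - r t"
proof -
  from attractor_repeller_pair_bounds[OF p ar] obtain M where M: "M \<ge> 0" "\<And>t. \<bar>a t\<bar> \<le> M" "\<And>t. \<bar>r t\<bar> \<le> M"
    and ra: "\<And>t. r t \<le> a t" and lip: "\<And>c d. lip c d a" "\<And>c d. lip c d r"
    and ae: "AE t in lebesgue. (a has_real_derivative - (a t)\<^sup>2 + p t) (at t)"
    "AE t in lebesgue. (r has_real_derivative - (r t)\<^sup>2 + p t) (at t)" by metis
  obtain k \<beta> where k: "k \<ge> 1" and \<beta>: "\<beta> > 0"
    and att: "\<And>s t. s \<le> t \<Longrightarrow> exp (integral {s..t} (\<lambda>l. - 2 * (a l - 0))) \<le> k * exp (- \<beta> * (t - s))"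
    and rep: "\<And>s t. t \<le> s \<Longrightarrow> exp (- integral {t..s} (\<lambda>l. - 2 * (r l - 0))) \<le> k * exp (\<beta> * (t - s))"
    using ar unfolding attractor_repeller_pair_def by blast
  \<comment> \<open>The window is long enough for the hyperbolic estimate: k exp (-\<beta> l) = exp
    (-1).\<close>
  define l where "l = (ln k + 1) / \<beta>"
  have l: "l > 0" using k \<beta> by (simp add: l_def add_nonneg_pos)
  have kl: "k * exp (- \<beta> * l) = exp (- 1)"
  proof -
    have "- \<beta> * l = - ln k + - 1" using \<beta> by (simp add: l_def)
    then have "exp (- \<beta> * l) = exp (- ln k) * exp (- 1)" by (simp only: exp_add)
    then show ?thesis using k by (simp add: exp_minus)
  qed
  have int: "f integrable_on {s..t}" if "\<And>c d. lip c d f" for f and s t :: real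
    by (rule integrable_continuous_real) (rule lip_continuous_on[OF that])
  show ?thesis
  proof (rule that[of "1 / (l * exp (2 * M * l))"])
    fix t
    define w where "w \<tau> = a \<tau> - r \<tau>" for \<tau>
    have w0: "w \<tau> \<ge> 0" for \<tau> using ra[of \<tau>] by (simp add: w_def)
    have lw: "lip c d w" for c d unfolding w_def by (intro lip_diff lip)
    have up: "w \<tau> \<le> w t * exp (2 * M * l)" if \<tau>: "t - l \<le> \<tau>" "\<tau> \<le> t" for \<tau>
    proof -
      have "w \<tau> * exp (2 * M * \<tau>) - w t * exp (2 * M * t) \<le> 0"
      proof (rule differential_inequality_backward[where L=0 and D="\<lambda>\<tau>. w \<tau> * exp (2 * M * \<tau>) - w t * exp (2 * M * t)", OF _ \<tau>(2)])
        show "lip \<tau> t (\<lambda>\<tau>. w \<tau> * exp (2 * M * \<tau>) - w t * exp (2 * M * t))"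
          by (intro lip_diff lip_mult lw lip_exp_linear lip_const)
        from ae show "AE \<tau>' in lebesgue. \<tau> < \<tau>' \<and> \<tau>' < t \<and> 0 < w \<tau>' * exp (2 * M * \<tau>') - w t * exp (2 * M * t) \<longrightarrow>
         (\<exists>D'. ((\<lambda>\<tau>. w \<tau> * exp (2 * M * \<tau>) - w t * exp (2 * M * t)) has_real_derivative D') (at \<tau>') \<and>
               - (0 * (w \<tau>' * exp (2 * M * \<tau>') - w t * exp (2 * M * t))) \<le> D')"
        proof eventually_elim
          case (elim x)
          have dw: "(w has_real_derivative (- (a x)\<^sup>2 + p x) - (- (r x)\<^sup>2 + p x)) (at x)"
            unfolding w_def using elim by (intro DERIV_diff)
          have "((\<lambda>\<tau>. w \<tau> * exp (2 * M * \<tau>) - w t * exp (2 * M * t)) has_real_derivative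
              w x * (2 * M - (a x + r x)) * exp (2 * M * x)) (at x)"
          proof -
            have de: "((\<lambda>\<tau>. exp (2 * M * \<tau>)) has_real_derivative 2 * M * exp (2 * M * x)) (at x)"
              by (auto intro!: derivative_eq_intros)
            show ?thesis
              by (rule DERIV_cong[OF DERIV_diff[OF DERIV_mult[OF dw de] DERIV_const]])
                (simp add: w_def power2_eq_square algebra_simps)
          qed
          moreover have "w x * (2 * M - (a x + r x)) * exp (2 * M * x) \<ge> 0"
            using w0[of x] M(2)[of x] M(3)[of x] by (intro mult_nonneg_nonneg) (auto simp: abs_le_iff)
          ultimately show ?case by auto
        qed
      qed simp
      then have "w \<tau> * exp (2 * M * \<tau>) * exp (- 2 * M * \<tau>) \<le> w t * exp (2 * M * t) * exp (- 2 * M * \<tau>)"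
        by (intro mult_right_mono) auto
      then have "w \<tau> \<le> w t * exp (2 * M * (t - \<tau>))"
        by (simp add: mult.assoc exp_add[symmetric] right_diff_distrib)
      also have "\<dots> \<le> w t * exp (2 * M * l)"
        using w0[of t] \<tau> M(1) by (intro mult_left_mono) (auto intro!: mult_left_mono)
      finally show ?thesis .
    qed
    have "exp (integral {t - l..t} (\<lambda>l. - 2 * a l)) \<le> exp (- 1)"
      using att[of "t - l" t] l kl by simp
    then have 1: "integral {t - l..t} (\<lambda>l. - 2 * a l) \<le> - 1" by simp
    have "exp (- integral {t - l..t} (\<lambda>l. - 2 * r l)) \<le> exp (- 1)"
      using rep[of "t - l" t] l kl by simp
    then have 2: "1 \<le> integral {t - l..t} (\<lambda>l. - 2 * r l)" by simp
    have "integral {t - l..t} w = integral {t - l..t} a - integral {t - l..t} r"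
      unfolding w_def by (intro integral_diff int lip)
    then have "1 \<le> integral {t - l..t} w" using 1 2 by simp
    also have "\<dots> \<le> integral {t - l..t} (\<lambda>_. w t * exp (2 * M * l))"
      by (intro integral_le int lw) (use up in auto)
    also have "\<dots> = l * exp (2 * M * l) * w t" using l by simp
    finally show "1 / (l * exp (2 * M * l)) \<le> a t - r t"
      using l by (simp add: w_def pos_divide_le_eq mult.commute)
  qed (use l in simp)
qed

text \<open>Shifting y by \<sigma> changes the field by at most 2 (M + B) |\<sigma>|, which the
  margin \<eta> pays for. A strict lower solution thus comes with a band of lower solutions around
  it.\<close>

lemma tsub_margin:
  assumes \<Delta>: "bdd_meas B \<Delta>" and M: "M \<ge> 0" and lip: "lip c d y"
    and ae: "ae_deriv_le c d y (\<lambda>t. - (y t - \<Delta> t)\<^sup>2 + q t - \<eta>)"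
    and bd: "\<And>t. c \<le> t \<Longrightarrow> t \<le> d \<Longrightarrow> \<bar>y t\<bar> \<le> M" and \<sigma>: "2 * (M + B) * \<bar>\<sigma>\<bar> \<le> \<eta>"
  shows "tsub \<Delta> q M c d (\<lambda>t. y t + \<sigma>)"
  unfolding tsub_def
proof
  show "lip c d (\<lambda>t. y t + \<sigma>)" using lip by auto
  from ae show "ae_deriv_le c d (\<lambda>t. y t + \<sigma>) (\<lambda>t. tfield M \<Delta> q t (y t + \<sigma>))"
  proof eventually_elim
    case (elim t)
    show ?case (is "_ \<longrightarrow> ?C")
    proof
      assume t: "c < t \<and> t < d"
      then obtain y' where y': "(y has_real_derivative y') (at t)" "y' \<le> - (y t - \<Delta> t)\<^sup>2 + q t - \<eta>"
        using elim by blast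
      have "((\<lambda>t. y t + \<sigma>) has_real_derivative y' + 0) (at t)" using y'(1) by (intro DERIV_add) auto
      moreover have "y' + 0 \<le> tfield M \<Delta> q t (y t + \<sigma>)"
        using tfield_lip[OF \<Delta> M, of q t "y t + \<sigma>" "y t"] tfield_id[OF bd[of t], of \<Delta> q t] t y'(2) \<sigma>
        by (simp add: abs_le_iff)
      ultimately show ?C
        by blast
    qed
  qed
qed

text \<open>The lower solution may be a different one for each window [-n, n]; only \<eta> and the
  bound M - 1 are uniform. Forward solutions from M stay above y + c and backward solutions from -M
  stay below y - c, so the gap 2 c does not depend on n and survives the limit.\<close>

lemma attractor_repeller_pair_if_strict_lower:
  assumes \<Delta>: "bdd_meas B \<Delta>" and q: "bdd_meas B q" and M: "M \<ge> 2 * B + 1" and \<eta>: "\<eta> > 0"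
    and Y: "\<And>n :: nat. \<exists>y. lip (- real n) (real n) y \<and>
      (ae_deriv_le (- real n) (real n) y (\<lambda>t. - (y t - \<Delta> t)\<^sup>2 + q t - \<eta>)) \<and>
      (\<forall>t. - real n \<le> t \<and> t \<le> real n \<longrightarrow> \<bar>y t\<bar> \<le> M - 1)"
  shows "\<exists>a r. attractor_repeller_pair \<Delta> q a r"
proof -
  have B: "B \<ge> 0" by (rule bdd_meas_nonneg[OF \<Delta>])
  have M0: "M \<ge> 1" using M B by simp
  \<comment> \<open>The entry 1 keeps y \<plusminus> c between -M and M; the other one makes the
    shift affordable in \<open>tsub_margin\<close>.\<close>
  define c where "c = min 1 (\<eta> / (2 * (M + B)))"
  have c: "c > 0" "c \<le> 1" using \<eta> M0 B by (auto simp: c_def)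
  have c2: "2 * (M + B) * c \<le> \<eta>"
  proof -
    have "2 * (M + B) * c \<le> 2 * (M + B) * (\<eta> / (2 * (M + B)))"
      using M0 B by (intro mult_left_mono) (auto simp: c_def)
    then show ?thesis using M0 B by simp
  qed
  have gap: "X t + 2 * c \<le> x t"
    if pair: "pullback_pair \<Delta> q M n x X" and t: "- real n \<le> t" "t \<le> real n" for n :: nat and x X t
  proof -
    have x: "tsol \<Delta> q M (- real n) (real n) x" "x (- real n) = M"
      and X: "tsol \<Delta> q M (- real n) (real n) X" "X (real n) = - M"
      using pair by (auto simp: pullback_pair_def)
    obtain y where y: "lip (- real n) (real n) y"
      "ae_deriv_le (- real n) (real n) y (\<lambda>t. - (y t - \<Delta> t)\<^sup>2 + q t - \<eta>)"
      "\<And>t. - real n \<le> t \<Longrightarrow> t \<le> real n \<Longrightarrow> \<bar>y t\<bar> \<le> M - 1"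
      using Y[of n] by blast
    have ls: "tsub \<Delta> q M (- real n) (real n) (\<lambda>t. y t + \<sigma>)" if "\<bar>\<sigma>\<bar> = c" for \<sigma>
      by (rule tsub_margin[OF \<Delta> _ y(1,2)]) (use M0 y(3) c2 that in force)+
    have "y t + c \<le> x t"
      by (rule tsub_le_tsol[OF \<Delta> _ tsub_subset[OF ls] tsol_subset[OF x(1)]])
        (use M0 c t x(2) y(3)[of "- real n"] in \<open>auto simp: abs_le_iff\<close>)
    moreover have "X t \<le> y t + - c"
      by (rule tsol_le_tsub_backward[OF \<Delta> _ tsub_subset[OF ls] tsol_subset[OF X(1)]])
        (use M0 c t X(2) y(3)[of "real n"] in \<open>auto simp: abs_le_iff\<close>)
    ultimately show ?thesis by simp
  qed
  show ?thesis
  proof (rule pullback_limits[OF \<Delta> q M])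
    show "X t \<le> x t" if "pullback_pair \<Delta> q M n x X" "- real n \<le> t" "t \<le> real n" for n x X t
      using gap[OF that] c by simp
  next
    fix x X a r
    assume x: "\<And>n. x n (- real n) = M" "\<And>n d. tsol \<Delta> q M (- real n) d (x n)" and
      X: "\<And>n. X n (real n) = - M" "\<And>n c. tsol \<Delta> q M c (real n) (X n)" and
      lim: "\<And>t. (\<lambda>n. x n t) \<longlonglongrightarrow> a t" "\<And>t. (\<lambda>n. X n t) \<longlonglongrightarrow> r t" and
      a: "\<And>c d. tsol \<Delta> q M c d a" and r: "\<And>c d. tsol \<Delta> q M c d r" and
      ab: "\<And>t. \<bar>a t\<bar> \<le> M" and rb: "\<And>t. \<bar>r t\<bar> \<le> M"
    have "r t + 2 * c \<le> a t" for t
    proof (rule LIMSEQ_le[OF tendsto_add[OF lim(2) tendsto_const] lim(1)])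
      obtain N :: nat where N: "\<bar>t\<bar> \<le> real N" using real_arch_simple by blast
      show "\<exists>N. \<forall>n\<ge>N. X n t + 2 * c \<le> x n t"
      proof (intro exI[of _ N] allI impI)
        fix n assume "N \<le> n"
        then have "\<bar>t\<bar> \<le> real n" using N by simp
        then show "X n t + 2 * c \<le> x n t" using gap[of n "x n" "X n" t] x X by (simp add: abs_le_iff pullback_pair_def)
      qed
    qed
    then have "attractor_repeller_pair \<Delta> q a r"
      by (intro separated_imp_attractor_repeller_pair[OF \<Delta> q a ab r rb, of "2 * c"]) (use c in \<open>auto simp: le_diff_eq add.commute\<close>)
    then show ?thesis by blast
  qed
qed

section \<open>Sampled coefficients\<close>

lemma sample_measurable:
  assumes "continuous_on UNIV \<Gamma>" shows "sample h \<Gamma> \<in> borel_measurable lebesgue"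
proof -
  have [measurable]: "\<Gamma> \<in> borel_measurable borel" using assms by (rule borel_measurable_continuous_onI)
  have "sample h \<Gamma> \<in> borel_measurable borel" unfolding sample_def by measurable
  then show ?thesis by (intro measurable_completion) simp
qed

lemma sample_bdd_meas:
  assumes "continuous_on UNIV \<Gamma>" "\<And>t. \<bar>\<Gamma> t\<bar> \<le> B" shows "bdd_meas B (sample h \<Gamma>)"
  using sample_measurable[OF assms(1)] assms(2) by (auto simp: bdd_meas_def sample_def)

lemma uniformly_continuous_if_limits:
  fixes \<Gamma> :: "real \<Rightarrow> real"
  assumes cont: "continuous_on UNIV \<Gamma>" and top: "(\<Gamma> \<longlongrightarrow> L1) at_top" and bot: "(\<Gamma> \<longlongrightarrow> L2) at_bot"
  shows "uniformly_continuous_on UNIV \<Gamma>"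
  unfolding uniformly_continuous_on_def
proof (intro allI impI)
  fix e :: real assume e: "e > 0"
  then have e2: "e / 2 > 0" by simp
  obtain T1 where T1: "\<And>t. t \<ge> T1 \<Longrightarrow> dist (\<Gamma> t) L1 < e / 2"
    using tendstoD[OF top e2] by (auto simp: eventually_at_top_linorder)
  obtain T2 where T2: "\<And>t. t \<le> T2 \<Longrightarrow> dist (\<Gamma> t) L2 < e / 2"
    using tendstoD[OF bot e2] by (auto simp: eventually_at_bot_linorder)
  have "uniformly_continuous_on {T2 - 1..T1 + 1} \<Gamma>"
    by (rule compact_uniformly_continuous[OF continuous_on_subset[OF cont]]) auto
  then obtain d where d: "d > 0" "\<And>x x'. x \<in> {T2 - 1..T1 + 1} \<Longrightarrow> x' \<in> {T2 - 1..T1 + 1} \<Longrightarrow> dist x' x < d \<Longrightarrow> dist (\<Gamma> x') (\<Gamma> x) < e"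
    using e unfolding uniformly_continuous_on_def by metis
  show "\<exists>d>0. \<forall>x\<in>UNIV. \<forall>x'\<in>UNIV. dist x' x < d \<longrightarrow> dist (\<Gamma> x') (\<Gamma> x) < e"
  \<comment> \<open>A distance below 1 forces two points that do not lie on a common tail into the
    enlarged compact interval.\<close>
  proof (intro exI[of _ "min d 1"] conjI ballI impI)
    fix x x' :: real assume xx: "dist x' x < min d 1"
    have "x' - x < 1" "x - x' < 1" using xx by (auto simp: dist_real_def)
    consider "x \<ge> T1 \<and> x' \<ge> T1" | "x \<le> T2 \<and> x' \<le> T2" | "x < T1 \<or> x' < T1" "T2 < x \<or> T2 < x'"
      by linarith
    then show "dist (\<Gamma> x') (\<Gamma> x) < e"
    proof cases
      case 1
      then show ?thesis using T1[of x] T1[of x'] by (metis dist_triangle_half_l)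
    next
      case 2
      then show ?thesis using T2[of x] T2[of x'] by (metis dist_triangle_half_l)
    next
      case 3
      then have "x \<in> {T2 - 1..T1 + 1}" "x' \<in> {T2 - 1..T1 + 1}"
        using \<open>x' - x < 1\<close> \<open>x - x' < 1\<close> by auto
      then show ?thesis using d xx by simp
    qed
  qed (use d in auto)
qed

lemma sample_close:
  assumes "uniformly_continuous_on UNIV \<Gamma>" "e > 0"
  obtains h where "h > 0" "\<And>k t. 0 \<le> k \<Longrightarrow> k \<le> h \<Longrightarrow> \<bar>sample k \<Gamma> t - \<Gamma> t\<bar> \<le> e"
proof -
  from assms(1)[unfolded uniformly_continuous_on_def, THEN spec, THEN mp, OF assms(2)]
  obtain d where d: "d > 0" "\<And>x x'. dist x' x < d \<Longrightarrow> dist (\<Gamma> x') (\<Gamma> x) < e"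
    by auto
  show ?thesis
  proof (rule that[of "d / 2"])
    fix k t :: real assume k: "0 \<le> k" "k \<le> d / 2"
    show "\<bar>sample k \<Gamma> t - \<Gamma> t\<bar> \<le> e"
    proof (cases "k > 0")
      case True
      have "of_int \<lfloor>t / k\<rfloor> * k \<le> t / k * k" "t / k * k \<le> (of_int \<lfloor>t / k\<rfloor> + 1) * k"
        using True by (intro mult_right_mono; linarith)+
      then have "\<bar>of_int \<lfloor>t / k\<rfloor> * k - t\<bar> \<le> k" using True by (simp add: distrib_right abs_le_iff)
      then have "dist (of_int \<lfloor>t / k\<rfloor> * k) t < d" using k d by (simp add: dist_real_def)
      from d(2)[OF this] show ?thesis using True by (simp add: sample_def dist_real_def)
    next
      case False
      then show ?thesis using assms(2) by (simp add: sample_def)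
    qed
  qed (use d in simp)
qed

section \<open>Approximation of hull elements by translates\<close>

lemma integral_AE_cong:
  assumes "AE t in lebesgue. f t = g (t :: real)" shows "integral S f = integral S (g :: real \<Rightarrow> real)"
proof -
  obtain N where N: "N \<in> null_sets lebesgue" "\<And>t. t \<notin> N \<Longrightarrow> f t = g t" using AE_lebesgueE[OF assms] by blast
  show ?thesis by (rule integral_spike[of N]) (use N in \<open>auto simp: negligible_iff_null_sets\<close>)
qed

lemma shift_hull_Linf: "q \<in> shift_hull p \<Longrightarrow> q \<in> Linf"
proof -
  assume "q \<in> shift_hull p"
  then have "q \<in> topspace Linf_topology"
    unfolding shift_hull_def using closure_of_subset_topspace[of Linf_topology] by blast
  then show "q \<in> Linf"
    unfolding Linf_topology_def topology_generated_by_topspace by auto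
qed

text \<open>A neighbourhood in the hull topology controls only finitely many integrals with rational
  endpoints, so they are taken up to the grid points -n + j / k; between grid points the integral
  moves by at most 2 B / k. Each of the two parts costs e / 2.\<close>

lemma shift_hull_approx:
  fixes n :: nat
  assumes q: "q \<in> shift_hull p" and p': "bdd_meas B p'" "AE t in lebesgue. p t = p' t"
    and q': "bdd_meas B q'" "AE t in lebesgue. q t = q' t" and e: "e > 0"
  obtains s where "\<And>t. - real n \<le> t \<Longrightarrow> t \<le> real n \<Longrightarrow> \<bar>integral {- real n..t} (\<lambda>\<tau>. q' \<tau> - p' (s + \<tau>))\<bar> \<le> e"
proof -
  have B: "B \<ge> 0" by (rule bdd_meas_nonneg[OF p'(1)])
  obtain k0 :: nat where k0: "4 * B / e \<le> real k0" using real_arch_simple by blast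
  define k where "k = Suc k0"
  have k: "k > 0" "2 * B / real k \<le> e / 2"
    using k0 e by (auto simp: k_def field_simps)
  define \<rho> where "\<rho> j = - real n + real j / real k" for j :: nat
  define U where "U j = {g \<in> Linf. \<bar>integral {- real n..\<rho> j} (\<lambda>t. g t - q t)\<bar> < e / 2}" for j
  have qL: "q \<in> Linf" by (rule shift_hull_Linf[OF q])
  have openU: "openin Linf_topology (U j)" if "j > 0" for j
    unfolding Linf_topology_def
  proof (rule topology_generated_by_Basis, rule CollectI, intro exI conjI)
    show "U j = {g \<in> Linf. \<bar>integral {- real n..\<rho> j} (\<lambda>t. g t - q t)\<bar> < e / 2}" by (rule U_def)
    show "- real n \<in> \<rat>" "\<rho> j \<in> \<rat>" by (auto simp: \<rho>_def intro!: Rats_add Rats_divide)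
    show "- real n < \<rho> j" using that k by (simp add: \<rho>_def)
  qed (use qL e in auto)
  \<comment> \<open>The index starts at 1 because the seminorms need r1 < r2; the intersection with
    the whole space covers n = 0, when no condition remains.\<close>
  define V where "V = (\<Inter>j\<in>{1..2 * n * k}. U j) \<inter> topspace Linf_topology"
  have "openin Linf_topology V" unfolding V_def by (rule openin_INT) (use openU in auto)
  moreover have "q \<in> V"
    using q closure_of_subset_topspace[of Linf_topology] qL e unfolding V_def U_def shift_hull_def by auto
  ultimately obtain g where g: "g \<in> range (\<lambda>s t. p (s + t))" "g \<in> V"
    using q unfolding shift_hull_def in_closure_of by blast
  then obtain s where s: "g = (\<lambda>t. p (s + t))" by blast
  define f where "f \<tau> = q' \<tau> - p' (s + \<tau>)" for \<tau>
  have f: "bdd_meas (2 * B) f"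
    using bdd_meas_diff[OF q'(1) bdd_meas_shift[OF p'(1)]] by (simp add: f_def[abs_def])
  have gf: "integral S (\<lambda>t. g t - q t) = - integral S f" for S
  proof -
    have "AE t in lebesgue. g t - q t = - f t"
      using AE_lebesgue_shift[OF p'(2), of s] q'(2) by eventually_elim (simp add: s f_def)
    then have "integral S (\<lambda>t. g t - q t) = integral S (\<lambda>t. - f t)" by (rule integral_AE_cong)
    then show ?thesis by simp
  qed
  show ?thesis
  proof (rule that[of s])
    fix t assume t: "- real n \<le> t" "t \<le> real n"
    define j where "j = nat \<lfloor>(t + real n) * real k\<rfloor>"
    have nn: "(t + real n) * real k \<ge> 0" using t by simp
    have j1: "real j \<le> (t + real n) * real k" "(t + real n) * real k \<le> real j + 1"
      using nn unfolding j_def by linarith+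
    have r1: "\<rho> j \<le> t" using j1(1) k by (simp add: \<rho>_def field_simps)
    have "t - \<rho> j = ((t + real n) * real k - real j) / real k" using k by (simp add: \<rho>_def field_simps)
    also have "\<dots> \<le> 1 / real k" using j1(2) by (intro divide_right_mono) auto
    finally have r2: "t - \<rho> j \<le> 1 / real k" .
    have r3: "- real n \<le> \<rho> j" by (simp add: \<rho>_def)
    have "\<bar>integral {- real n..\<rho> j} f\<bar> \<le> e / 2"
    proof (cases "j = 0")
      case True
      then show ?thesis using e by (simp add: \<rho>_def)
    next
      case False
      have "real j \<le> 2 * real n * real k"
        using j1(1) mult_right_mono[of "t + real n" "2 * real n" "real k"] t by simp
      then have "j \<le> 2 * n * k" by (metis of_nat_le_iff of_nat_mult of_nat_numeral)
      then have "g \<in> U j" using g(2) False unfolding V_def by simp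
      then show ?thesis using gf[of "{- real n..\<rho> j}"] by (simp add: U_def)
    qed
    moreover have "\<bar>integral {\<rho> j..t} f\<bar> \<le> e / 2"
    proof -
      have "\<bar>integral {\<rho> j..t} f\<bar> \<le> 2 * B * (t - \<rho> j)" by (rule bdd_meas_integral_bound[OF f r1])
      also have "\<dots> \<le> 2 * B * (1 / real k)" using r2 B by (intro mult_left_mono) auto
      also have "\<dots> \<le> e / 2" using k(2) by simp
      finally show ?thesis .
    qed
    moreover have "integral {- real n..t} f = integral {- real n..\<rho> j} f + integral {\<rho> j..t} f"
      using bdd_meas_integral_diff[OF f r3 r1] by simp
    ultimately show "\<bar>integral {- real n..t} (\<lambda>\<tau>. q' \<tau> - p' (s + \<tau>))\<bar> \<le> e" unfolding f_def[abs_def] by linarith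
  qed
qed

text \<open>The cost (2 A + 1) \<epsilon> is the sum of 2 |m e| \<le> 2 A \<epsilon> and e^2 \<le>
  \<epsilon>. In the applications e is the difference between the term added to m and the
  coefficient \<Delta>.\<close>

lemma quadratic_perturbation:
  assumes "\<bar>m\<bar> \<le> A" "\<bar>e\<bar> \<le> \<epsilon>" "\<epsilon> \<le> 1" "(2 * A + 1) * \<epsilon> \<le> \<eta>"
  shows "(m + e)\<^sup>2 \<le> m\<^sup>2 + (\<eta> :: real)"
proof -
  have "2 * m * e \<le> 2 * A * \<epsilon>"
  proof -
    have "\<bar>m\<bar> * \<bar>e\<bar> \<le> A * \<epsilon>" using assms by (intro mult_mono) auto
    moreover have "m * e \<le> \<bar>m\<bar> * \<bar>e\<bar>" by (simp add: abs_mult[symmetric])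
    ultimately show ?thesis by linarith
  qed
  moreover have "e\<^sup>2 \<le> \<epsilon>"
  proof -
    have "\<bar>e\<bar> * \<bar>e\<bar> \<le> 1 * \<epsilon>" using assms by (intro mult_mono) auto
    then show ?thesis by (simp add: power2_eq_square)
  qed
  ultimately show ?thesis using assms(4) by (simp add: power2_sum distrib_right)
qed

lemma perturbation_size:
  assumes "(\<eta> :: real) > 0" "A \<ge> 0"
  obtains \<epsilon> where "\<epsilon> > 0" "\<epsilon> \<le> 1" "(2 * A + 1) * \<epsilon> \<le> \<eta>"
proof (rule that[of "min 1 (\<eta> / (2 * A + 1))"])
  have "(2 * A + 1) * min 1 (\<eta> / (2 * A + 1)) \<le> (2 * A + 1) * (\<eta> / (2 * A + 1))"
    using assms(2) by (intro mult_left_mono) auto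
  then show "(2 * A + 1) * min 1 (\<eta> / (2 * A + 1)) \<le> \<eta>" using assms(2) by simp
qed (use assms in auto)

lemma deriv_shift:
  "(f has_real_derivative D) (at (s + t)) \<Longrightarrow> ((\<lambda>t. f (s + t)) has_real_derivative D) (at t)"
  by (simp add: DERIV_shift add.commute[of s])

lemma lip_shift:
  assumes "\<And>c d. lip c d f" shows "lip c d (\<lambda>t. f (s + t))"
proof -
  obtain C where C: "C-lipschitz_on {s + c..s + d} f" using assms[of "s + c" "s + d"] by (auto simp: lip_def)
  have "C-lipschitz_on {c..d} (\<lambda>t. f (s + t))"
    using lipschitz_on_nonneg[OF C]
    by (intro lipschitz_onI) (use lipschitz_onD[OF C, of "s + x" "s + y" for x y] in \<open>auto simp: dist_real_def\<close>)
  then show ?thesis by (auto simp: lip_def)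
qed

lemma lip_cmult: "lip c d f \<Longrightarrow> lip c d (\<lambda>t. k * f t)"
  using lip_mult[OF lip_const] .

text \<open>The identity (a^2 + r^2) / 2 = m^2 + (a - r)^2 / 4 turns the mean of two solutions into
  a lower solution with margin (a - r)^2 / 4, which is what the slope of \<Gamma> may use
  up.\<close>

lemma attractor_repeller_pair_midpoint:
  assumes p: "bdd_meas B p" and ar: "attractor_repeller_pair (\<lambda>t. 0) p a r"
  obtains m A where "A \<ge> 0" "\<And>t. m t = 1/2 * (a t + r t)" "\<And>t. \<bar>m t\<bar> \<le> A" "\<And>c d. lip c d m"
    "AE t in lebesgue. (m has_real_derivative - (m t)\<^sup>2 - 1/4 * (a t - r t)\<^sup>2 + p t) (at t)"
    "\<And>c d. lip c d a" "\<And>c d. lip c d r"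
proof -
  from attractor_repeller_pair_bounds[OF p ar] obtain A where A: "A \<ge> 0" "\<And>t. \<bar>a t\<bar> \<le> A" "\<And>t. \<bar>r t\<bar> \<le> A"
    and lip: "\<And>c d. lip c d a" "\<And>c d. lip c d r"
    and ae: "AE t in lebesgue. (a has_real_derivative - (a t)\<^sup>2 + p t) (at t)"
    "AE t in lebesgue. (r has_real_derivative - (r t)\<^sup>2 + p t) (at t)" by metis
  define m where "m t = 1/2 * (a t + r t)" for t
  show ?thesis
  proof (rule that[OF A(1) m_def _ _ _ lip])
    show "\<bar>m t\<bar> \<le> A" for t using A(2)[of t] A(3)[of t] by (simp add: m_def abs_le_iff)
    show "lip c d m" for c d unfolding m_def by (intro lip_cmult lip_add lip)
    show "AE t in lebesgue. (m has_real_derivative - (m t)\<^sup>2 - 1/4 * (a t - r t)\<^sup>2 + p t) (at t)"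
      using ae
    proof eventually_elim
      case (elim t)
      have "(m has_real_derivative 1/2 * ((- (a t)\<^sup>2 + p t) + (- (r t)\<^sup>2 + p t))) (at t)"
        unfolding m_def by (intro DERIV_cmult DERIV_add elim)
      then show ?case by (rule DERIV_cong) (simp add: m_def power2_eq_square field_simps)
    qed
  qed
qed

text \<open>The assumption \<open>gap\<close> decouples two times because a translate pairs \<Gamma>
  at t with a - r at s + t. Of the margin 2 \<eta>, one half absorbs \<Gamma> + P - \<Delta> inside
  the square and the other remains as strictness. The bounds B and M depend on q, but \<epsilon> and
  h0 are fixed before q, which makes the step size uniform over the hull.\<close>

lemma total_tracking:
  assumes pL: "p \<in> Linf" and ar: "attractor_repeller_pair (\<lambda>t. 0) p a r"
    and bG: "\<And>t. \<bar>\<Gamma> t\<bar> \<le> G" and cont: "continuous_on UNIV \<Gamma>"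
    and top: "(\<Gamma> \<longlongrightarrow> L1) at_top" and bot: "(\<Gamma> \<longlongrightarrow> L2) at_bot"
    and d\<Gamma>: "\<And>t. (\<Gamma> has_real_derivative \<Gamma>' t) (at t)" and cont': "continuous_on UNIV \<Gamma>'"
    and \<eta>: "\<eta> > 0" and gap: "\<And>t t'. \<Gamma>' t + 2 * \<eta> \<le> 1/4 * (a t' - r t')\<^sup>2"
  shows "\<exists>h_max>0. \<forall>h\<in>{0..h_max}. total_tracking_on_hull (sample h \<Gamma>) p"
proof -
  obtain B0 p' where p': "bdd_meas B0 p'" "AE t in lebesgue. p t = p' t"
    using Linf_bounded_representative[OF pL] by blast
  have ar': "attractor_repeller_pair (\<lambda>t. 0) p' a r" using ar attractor_repeller_pair_cong_AE[OF p'(2)] by blast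
  obtain m A
    where A: "A \<ge> 0" and m: "\<And>t. \<bar>m t\<bar> \<le> A" and mlip: "\<And>c d. lip c d m"
    and dm: "AE t in lebesgue. (m has_real_derivative - (m t)\<^sup>2 - 1/4 * (a t - r t)\<^sup>2 + p' t) (at t)"
    by (rule attractor_repeller_pair_midpoint[OF p'(1) ar']) (rule that)
  obtain \<epsilon> where \<epsilon>: "\<epsilon> > 0" "\<epsilon> \<le> 1" and \<epsilon>2: "(2 * A + 1) * \<epsilon> \<le> \<eta>"
    using perturbation_size[OF \<eta> A] by metis
  obtain h0 where h0: "h0 > 0" "\<And>k t. 0 \<le> k \<Longrightarrow> k \<le> h0 \<Longrightarrow> \<bar>sample k \<Gamma> t - \<Gamma> t\<bar> \<le> \<epsilon> / 2"
    using sample_close[OF uniformly_continuous_if_limits[OF cont top bot], of "\<epsilon> / 2"] \<epsilon> by auto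
  have "\<exists>a r. attractor_repeller_pair (sample h \<Gamma>) q a r" if h: "h \<in> {0..h0}" and q: "q \<in> shift_hull p" for h q
  proof -
    define \<Delta> where "\<Delta> = sample h \<Gamma>"
    have close: "\<bar>\<Delta> t - \<Gamma> t\<bar> \<le> \<epsilon> / 2" for t using h0(2)[of h t] h by (simp add: \<Delta>_def)
    obtain B1 q' where q': "bdd_meas B1 q'" "AE t in lebesgue. q t = q' t"
      using Linf_bounded_representative[OF shift_hull_Linf[OF q]] by blast
    define B where "B = Max {B0, B1, G}"
    have pB: "bdd_meas B p'" and qB: "bdd_meas B q'"
      using bdd_meas_mono[OF p'(1), of B] bdd_meas_mono[OF q'(1), of B] by (auto simp: B_def)
    have "\<bar>\<Gamma> t\<bar> \<le> B" for t using bG[of t] by (auto simp: B_def le_max_iff_disj)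
    then have \<Delta>: "bdd_meas B \<Delta>" unfolding \<Delta>_def by (rule sample_bdd_meas[OF cont])
    have "G \<le> B" by (simp add: B_def)
    have B: "B \<ge> 0" by (rule bdd_meas_nonneg[OF \<Delta>])
    define M where "M = 2 * B + A + 2"
    have "\<exists>a r. attractor_repeller_pair \<Delta> q' a r"
    proof (rule attractor_repeller_pair_if_strict_lower[OF \<Delta> qB _ \<eta>])
      show "M \<ge> 2 * B + 1" using A by (simp add: M_def)
      fix n :: nat
      obtain s where s: "\<And>t. - real n \<le> t \<Longrightarrow> t \<le> real n \<Longrightarrow> \<bar>integral {- real n..t} (\<lambda>\<tau>. q' \<tau> - p' (s + \<tau>))\<bar> \<le> \<epsilon> / 2"
        using shift_hull_approx[OF q pB p'(2) qB q'(2), of "\<epsilon> / 2" n] \<epsilon> by auto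
      define f where "f \<tau> = q' \<tau> - p' (s + \<tau>)" for \<tau>
      have f: "bdd_meas (2 * B) f"
        using bdd_meas_diff[OF qB bdd_meas_shift[OF pB]] by (simp add: f_def[abs_def])
      \<comment> \<open>The derivative of P exchanges the translate of p' for q', and P is small
        although f itself need not be.\<close>
      define P where "P t = integral {- real n..t} f" for t
      have P: "\<bar>P t\<bar> \<le> \<epsilon> / 2" if "- real n \<le> t" "t \<le> real n" for t
        using s[OF that] by (simp add: P_def f_def[abs_def])
      define y where "y t = m (s + t) + \<Gamma> t + P t" for t
      show "\<exists>y. lip (- real n) (real n) y \<and>
         (ae_deriv_le (- real n) (real n) y (\<lambda>t. - (y t - \<Delta> t)\<^sup>2 + q' t - \<eta>)) \<and>
         (\<forall>t. - real n \<le> t \<and> t \<le> real n \<longrightarrow> \<bar>y t\<bar> \<le> M - 1)"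
      proof (intro exI[of _ y] conjI allI impI)
        have "lip c d \<Gamma>" for c d
          by (rule lip_C1[OF has_field_derivative_at_within[OF d\<Gamma>] continuous_on_subset[OF cont']]) auto
        moreover have "lip c d P" for c d
          unfolding P_def using bdd_meas_integral_lipschitz[OF f] by (auto simp: lip_def)
        ultimately show "lip (- real n) (real n) y" unfolding y_def by (intro lip_add lip_shift mlip)
        show "\<bar>y t\<bar> \<le> M - 1" if "- real n \<le> t \<and> t \<le> real n" for t
        proof -
          have "\<bar>P t\<bar> \<le> 1" using P[of t] that \<epsilon>(2) by linarith
          then show ?thesis
            using m[of "s + t"] bG[of t] \<open>G \<le> B\<close> B unfolding y_def M_def by (auto simp: abs_le_iff)
        qed
        from AE_lebesgue_shift[OF dm, of s] bdd_meas_integral_deriv[OF f, of "- real n"]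
        show "ae_deriv_le (- real n) (real n) y (\<lambda>t. - (y t - \<Delta> t)\<^sup>2 + q' t - \<eta>)"
        proof eventually_elim
          case (elim t)
          show ?case (is "_ \<longrightarrow> ?C")
          proof
            assume t: "- real n < t \<and> t < real n"
            define D where "D = - (m (s + t))\<^sup>2 - 1/4 * (a (s + t) - r (s + t))\<^sup>2 + p' (s + t)"
            have "(m has_real_derivative D) (at (s + t))" using elim(1) by (simp only: D_def)
            then have "(y has_real_derivative D + \<Gamma>' t + f t) (at t)"
              unfolding y_def P_def using elim(2) t by (intro DERIV_add deriv_shift d\<Gamma>) auto
            moreover have "D + \<Gamma>' t + f t \<le> - (y t - \<Delta> t)\<^sup>2 + q' t - \<eta>"
            proof -
              have "\<bar>\<Gamma> t + P t - \<Delta> t\<bar> \<le> \<epsilon>" using close[of t] P[of t] t by linarith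
              from quadratic_perturbation[OF m this \<epsilon>(2) \<epsilon>2]
              have "(y t - \<Delta> t)\<^sup>2 \<le> (m (s + t))\<^sup>2 + \<eta>" by (simp add: y_def algebra_simps)
              then show ?thesis using gap[of t "s + t"] by (simp add: f_def D_def)
            qed
            ultimately show ?C by blast
          qed
        qed
      qed
    qed
    then show ?thesis unfolding \<Delta>_def using attractor_repeller_pair_cong_AE[OF q'(2)] by blast
  qed
  then show ?thesis using h0(1) unfolding total_tracking_on_hull_def by blast
qed

section \<open>Tracking under a local rate condition\<close>

text \<open>The majorant E solves E' = L E + \<epsilon> L e with E c = k. Its second term covers the
  effect of \<Delta>1 - \<Delta>2 on the field, which is at most \<epsilon> L because the other
  factor in the difference of squares is at most 2 (M + B) = L.\<close>

lemma tsol_gronwall: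
  assumes \<Delta>1: "bdd_meas B \<Delta>1" and \<Delta>2: "bdd_meas B \<Delta>2" and M: "M \<ge> 0"
    and close: "\<And>t. \<bar>\<Delta>1 t - \<Delta>2 t\<bar> \<le> \<epsilon>"
    and x1: "tsol \<Delta>1 q M c d x1" and x2: "tsol \<Delta>2 q M c d x2" and cd: "c \<le> d"
    and k: "k \<ge> 0" "x1 c \<le> x2 c + k" and L: "L = 2 * (M + B)"
  shows "x1 d \<le> x2 d + (k + \<epsilon> * L * (d - c)) * exp (L * (d - c))"
proof -
  have B: "B \<ge> 0" by (rule bdd_meas_nonneg[OF \<Delta>1])
  have L0: "L \<ge> 0" using B M L by simp
  have \<epsilon>: "\<epsilon> \<ge> 0" using close[of 0] by linarith
  define e where "e t = exp (L * t + - (L * c))" for t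
  define E where "E t = (k + \<epsilon> * L * (t + - c)) * e t" for t
  have de: "(e has_real_derivative L * e t) (at t)" for t
    unfolding e_def by (auto intro!: derivative_eq_intros)
  have dE: "(E has_real_derivative L * E t + \<epsilon> * L * e t) (at t)" for t
    unfolding E_def by (auto intro!: derivative_eq_intros de simp: algebra_simps)
  have "x1 d - x2 d - E d \<le> 0"
  proof (rule differential_inequality[where L=L and D="\<lambda>t. x1 t - x2 t - E t", OF _ cd])
    have "lip c d E" unfolding E_def e_def
      by (intro lip_mult lip_add lip_const lip_linear lip_comp_exp) (simp add: lip_linear[of c d 1, simplified])
    then show "lip c d (\<lambda>t. x1 t - x2 t - E t)"
      using x1 x2 by (intro lip_diff) (auto simp: tsol_def)
    show "x1 c - x2 c - E c \<le> 0" using k by (simp add: E_def e_def)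
    from tsol_deriv[OF x1] tsol_deriv[OF x2] show "AE \<tau> in lebesgue. c < \<tau> \<and> \<tau> < d \<and> 0 < x1 \<tau> - x2 \<tau> - E \<tau> \<longrightarrow>
         (\<exists>D'. ((\<lambda>t. x1 t - x2 t - E t) has_real_derivative D') (at \<tau>) \<and> D' \<le> L * (x1 \<tau> - x2 \<tau> - E \<tau>))"
    proof eventually_elim
      case (elim t)
      show ?case (is "_ \<longrightarrow> ?C")
      proof
        assume t: "c < t \<and> t < d \<and> 0 < x1 t - x2 t - E t"
        have e1: "e t \<ge> 1" using t L0 by (simp add: e_def mult_left_mono)
        have "0 \<le> \<epsilon> * L * (t + - c)" using t L0 \<epsilon> by (intro mult_nonneg_nonneg) auto
        then have "0 \<le> k + \<epsilon> * L * (t + - c)" using k(1) by linarith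
        then have "E t \<ge> 0" using e1 unfolding E_def by (intro mult_nonneg_nonneg) linarith+
        then have pos: "x1 t - x2 t > 0" using t by linarith
        have "((\<lambda>t. x1 t - x2 t - E t) has_real_derivative
            tfield M \<Delta>1 q t (x1 t) - tfield M \<Delta>2 q t (x2 t) - (L * E t + \<epsilon> * L * e t)) (at t)"
          using elim t by (intro DERIV_diff dE) auto
        moreover have "tfield M \<Delta>1 q t (x1 t) - tfield M \<Delta>2 q t (x2 t) - (L * E t + \<epsilon> * L * e t)
            \<le> L * (x1 t - x2 t - E t)"
        proof -
          have 1: "tfield M \<Delta>1 q t (x1 t) - tfield M \<Delta>1 q t (x2 t) \<le> L * (x1 t - x2 t)"
            using tfield_lip[OF \<Delta>1 M, of q t "x1 t" "x2 t"] pos L by simp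
          have "tfield M \<Delta>1 q t (x2 t) - tfield M \<Delta>2 q t (x2 t) =
              - ((\<Delta>1 t - \<Delta>2 t) * (\<Delta>1 t + \<Delta>2 t - 2 * trunc M (x2 t)))"
            by (simp add: tfield_def power2_eq_square algebra_simps)
          also have "\<dots> \<le> \<bar>(\<Delta>1 t - \<Delta>2 t) * (\<Delta>1 t + \<Delta>2 t - 2 * trunc M (x2 t))\<bar>" by simp
          also have "\<dots> = \<bar>\<Delta>1 t - \<Delta>2 t\<bar> * \<bar>\<Delta>1 t + \<Delta>2 t - 2 * trunc M (x2 t)\<bar>" by (rule abs_mult)
          also have "\<dots> \<le> \<epsilon> * L"
          proof (intro mult_mono close)
            show "\<bar>\<Delta>1 t + \<Delta>2 t - 2 * trunc M (x2 t)\<bar> \<le> L"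
              using bdd_measD(2)[OF \<Delta>1, of t] bdd_measD(2)[OF \<Delta>2, of t] abs_trunc[OF M, of "x2 t"] L
              by (auto simp: abs_le_iff)
          qed (use \<epsilon> in auto)
          finally have 2: "tfield M \<Delta>1 q t (x2 t) - tfield M \<Delta>2 q t (x2 t) \<le> \<epsilon> * L" .
          have 3: "\<epsilon> * L * 1 \<le> \<epsilon> * L * e t" using e1 \<epsilon> L0 by (intro mult_left_mono) auto
          show ?thesis using 1 2 3 by (simp add: right_diff_distrib)
        qed
        ultimately show ?C
          by blast
      qed
    qed
  qed
  moreover have "E d = (k + \<epsilon> * L * (d - c)) * exp (L * (d - c))"
    by (simp add: E_def e_def right_diff_distrib)
  ultimately show ?thesis by simp
qed

text \<open>A solution x of the unperturbed equation started just above y stays above y + \<kappa>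
  until T, and this distance forces a positive z - x to decay like exp (-\<kappa> (T - s)). Gronwall
  estimates then carry the result from T to t1 and from \<Gamma> to \<Delta>. The budget z t1 - v is
  split into thirds, one for each transfer and one to spare. Both s and \<epsilon> are chosen before
  \<Delta>, so one starting point serves all small steps.\<close>

lemma past_barrier:
  assumes \<Gamma>: "bdd_meas B \<Gamma>" and p: "bdd_meas B p" and M: "M \<ge> 2 * B + 1"
    and ylip: "\<And>c d. lip c d y" and yM: "\<And>t. \<bar>y t\<bar> \<le> M - 1"
    and y: "AE t in lebesgue. t < T \<longrightarrow>
        (\<exists>y'. (y has_real_derivative y') (at t) \<and> y' \<le> - (y t - \<Gamma> t)\<^sup>2 + p t - \<eta>)"
    and z: "\<And>c. tsol \<Gamma> p M c t1 z" and zM: "\<And>t. t \<le> t1 \<Longrightarrow> \<bar>z t\<bar> \<le> M"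
    and T: "T \<le> t1" and v: "v < z t1"
    and \<kappa>: "\<kappa> > 0" "\<kappa> \<le> 1" "2 * (M + B) * \<kappa> \<le> \<eta>"
  obtains s \<epsilon> where "s \<le> T" "\<epsilon> > 0"
    "\<And>\<Delta> x. \<lbrakk>bdd_meas B \<Delta>; \<And>t. \<bar>\<Delta> t - \<Gamma> t\<bar> \<le> \<epsilon>; tsol \<Delta> p M s t1 x; x s = y s + \<kappa>\<rbrakk> \<Longrightarrow> v < x t1"
proof -
  have B: "B \<ge> 0" by (rule bdd_meas_nonneg[OF \<Gamma>])
  have M0: "M \<ge> 1" using M B by simp
  define L where "L = 2 * (M + B)"
  have L0: "L > 0" using M0 B by (simp add: L_def)
  have \<eta>: "\<eta> \<ge> 0"
  proof -
    have "0 \<le> 2 * (M + B) * \<kappa>" using M0 B \<kappa> by simp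
    then show ?thesis using \<kappa>(3) by linarith
  qed
  define g where "g = z t1 - v"
  have g: "g > 0" using v by (simp add: g_def)
  \<comment> \<open>The constant from \<open>exponential_domination\<close> at T times the growth
    factor from T to t1.\<close>
  define Q where "Q = 2 * M / \<kappa> * (2 * M) * exp (L * (t1 - T))"
  have Q: "Q \<ge> 0" using M0 \<kappa> by (simp add: Q_def)
  \<comment> \<open>Since exp (\<kappa> h) \<ge> \<kappa> h = 3 Q / g, a run of this length reduces
    the error at t1 to at most g / 3.\<close>
  define h where "h = 3 * Q / (g * \<kappa>)"
  have h: "h \<ge> 0" using Q g \<kappa> by (simp add: h_def)
  define s where "s = T - h"
  have sT: "s \<le> T" using h by (simp add: s_def)
  define N where "N = L * (t1 - s) * exp (L * (t1 - s))"
  have N: "N \<ge> 0" using L0 sT T by (simp add: N_def)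
  \<comment> \<open>N is the factor of \<epsilon> in the Gronwall bound; N + 1 avoids a division by
    zero when s = t1.\<close>
  define \<epsilon> where "\<epsilon> = g / (3 * (N + 1))"
  have \<epsilon>: "\<epsilon> > 0" using g N by (simp add: \<epsilon>_def)
  have \<epsilon>N: "\<epsilon> * N \<le> g / 3"
  proof -
    have "\<epsilon> * N \<le> \<epsilon> * (N + 1)" using \<epsilon> by simp
    also have "\<dots> = g / 3" using N by (simp add: \<epsilon>_def field_simps)
    finally show ?thesis .
  qed
  obtain x where xs: "x s = y s + \<kappa>" and x: "\<And>T. tsol \<Gamma> p M s T x"
    using tsol_exists[OF \<Gamma> p, of M s "y s + \<kappa>"] M0 by auto
  have xM: "x t \<le> M" if "s \<le> t" for t
    using tsol_le_M[OF \<Gamma> p M x that] xs yM[of s] \<kappa> by (simp add: abs_le_iff)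
  have ls: "tsub \<Gamma> p M s t (\<lambda>t. y t + \<kappa>)" if "t \<le> T" for t
  proof (rule tsub_margin[OF \<Gamma> _ ylip])
    from y show "ae_deriv_le s t y (\<lambda>\<tau>. - (y \<tau> - \<Gamma> \<tau>)\<^sup>2 + p \<tau> - \<eta>)"
      by eventually_elim (use that in auto)
    show "\<bar>y t\<bar> \<le> M" for t using yM[of t] by simp
  qed (use M0 \<kappa> in auto)
  have xy: "y t + \<kappa> \<le> x t" if "s \<le> t" "t \<le> T" for t
    using tsub_le_tsol[OF \<Gamma> _ ls[OF that(2)] x that(1)] M0 xs by simp
  have xabs: "\<bar>x t\<bar> \<le> M" if "s \<le> t" "t \<le> T" for t
    using xy[OF that] xM[OF that(1)] yM[of t] \<kappa> by (simp add: abs_le_iff)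
  have ux: "x T - y T \<le> 2 * M" using xM[OF sT] yM[of T] by (simp add: abs_le_iff)
  have lipx: "lip c d x" if "s \<le> c" for c d
    using tsol_subset[OF x[of d] that order_refl] by (simp add: tsol_def)
  have "(z T - x T) * exp (\<kappa> * (T - s)) \<le> 2 * M / \<kappa> * (x T - y T)"
  \<comment> \<open>Here u = x - y, where y is only a lower solution; this makes u' larger, which is
    the admissible direction.\<close>
  proof (rule exponential_domination[where z="\<lambda>\<tau>. x \<tau> - \<Gamma> \<tau>" and L=L, OF sT _ _ \<kappa>(1)])
    have zT: "tsol \<Gamma> p M s T z" by (rule tsol_subset[OF z order_refl T])
    then show "lip s T (\<lambda>t. z t - x t)" by (intro lip_diff lipx) (auto simp: tsol_def)
    show "lip s T (\<lambda>t. x t - y t)" by (intro lip_diff lipx ylip order_refl)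
    show "0 \<le> 2 * M" using M0 by simp
    show "z s - x s \<le> 2 * M" using zM[of s] xabs[of s] sT T by (simp add: abs_le_iff)
    show "\<bar>2 * (x \<tau> - \<Gamma> \<tau>)\<bar> \<le> L" if "s \<le> \<tau>" "\<tau> \<le> T" for \<tau>
      using xabs[OF that] bdd_measD(2)[OF \<Gamma>, of \<tau>] by (auto simp: L_def abs_le_iff)
    show "\<kappa> \<le> x \<tau> - y \<tau>" if "s \<le> \<tau>" "\<tau> \<le> T" for \<tau> using xy[OF that] by simp
    note aex = tsol_deriv[OF x[of T]]
    from tsol_deriv[OF zT] show "AE \<tau> in lebesgue. s < \<tau> \<and> \<tau> < T \<and> 0 < z \<tau> - x \<tau> \<longrightarrow>
         (\<exists>W'. ((\<lambda>t. z t - x t) has_real_derivative W') (at \<tau>) \<and> W' \<le> - 2 * (x \<tau> - \<Gamma> \<tau>) * (z \<tau> - x \<tau>))"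
      using aex
    proof eventually_elim
      case (elim \<tau>)
      show ?case (is "_ \<longrightarrow> ?C")
      proof
        assume \<tau>: "s < \<tau> \<and> \<tau> < T \<and> 0 < z \<tau> - x \<tau>"
        have "((\<lambda>t. z t - x t) has_real_derivative tfield M \<Gamma> p \<tau> (z \<tau>) - tfield M \<Gamma> p \<tau> (x \<tau>)) (at \<tau>)"
          using elim \<tau> by (intro DERIV_diff) auto
        moreover have "tfield M \<Gamma> p \<tau> (z \<tau>) - tfield M \<Gamma> p \<tau> (x \<tau>) = - 2 * (x \<tau> - \<Gamma> \<tau>) * (z \<tau> - x \<tau>) - (z \<tau> - x \<tau>)\<^sup>2"
          using tfield_id[OF zM[of \<tau>], of \<Gamma> p \<tau>] tfield_id[OF xabs[of \<tau>], of \<Gamma> p \<tau>] \<tau> T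
          by (simp add: power2_eq_square algebra_simps)
        ultimately show ?C
          by (intro exI[of _ "tfield M \<Gamma> p \<tau> (z \<tau>) - tfield M \<Gamma> p \<tau> (x \<tau>)"]) simp
      qed
    qed
    from y aex show "AE \<tau> in lebesgue. s < \<tau> \<and> \<tau> < T \<longrightarrow>
         (\<exists>u'. ((\<lambda>t. x t - y t) has_real_derivative u') (at \<tau>) \<and> - (x \<tau> - y \<tau>) * (2 * (x \<tau> - \<Gamma> \<tau>) - (x \<tau> - y \<tau>)) \<le> u')"
    proof eventually_elim
      case (elim \<tau>)
      show ?case (is "_ \<longrightarrow> ?C")
      proof
        assume \<tau>: "s < \<tau> \<and> \<tau> < T"
        then obtain y' where y': "(y has_real_derivative y') (at \<tau>)" "y' \<le> - (y \<tau> - \<Gamma> \<tau>)\<^sup>2 + p \<tau> - \<eta>"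
          using elim(1) by blast
        have "((\<lambda>t. x t - y t) has_real_derivative tfield M \<Gamma> p \<tau> (x \<tau>) - y') (at \<tau>)"
          using elim(2) \<tau> y'(1) by (intro DERIV_diff) auto
        moreover have "- (x \<tau> - y \<tau>) * (2 * (x \<tau> - \<Gamma> \<tau>) - (x \<tau> - y \<tau>)) = - (x \<tau> - \<Gamma> \<tau>)\<^sup>2 + (y \<tau> - \<Gamma> \<tau>)\<^sup>2"
          by (simp add: power2_eq_square algebra_simps)
        moreover have "tfield M \<Gamma> p \<tau> (x \<tau>) = - (x \<tau> - \<Gamma> \<tau>)\<^sup>2 + p \<tau>"
          by (rule tfield_id[OF xabs]) (use \<tau> in auto)
        ultimately show ?C
          using y'(2) \<eta> by (intro exI[of _ "tfield M \<Gamma> p \<tau> (x \<tau>) - y'"]) simp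
      qed
    qed
  qed
  also have "\<dots> \<le> 2 * M / \<kappa> * (2 * M)" using ux M0 \<kappa> by (intro mult_left_mono) auto
  finally have zx: "(z T - x T) * exp (\<kappa> * h) \<le> 2 * M / \<kappa> * (2 * M)" by (simp add: s_def)
  \<comment> \<open>\<open>tsol_gronwall\<close> asks for a nonnegative initial error, whereas x may
    already lie above z.\<close>
  define k where "k = max 0 (z T - x T)"
  have kQ: "k * exp (L * (t1 - T)) \<le> g / 3"
  proof -
    have 0: "k * exp (\<kappa> * h) \<le> 2 * M / \<kappa> * (2 * M)"
      using zx M0 \<kappa> by (cases "z T - x T \<ge> 0") (auto simp: k_def max_def)
    have "k * exp (\<kappa> * h) * exp (L * (t1 - T)) \<le> Q"
      unfolding Q_def by (rule mult_right_mono[OF 0]) simp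
    moreover have "3 * Q \<le> g * exp (\<kappa> * h)"
    proof -
      have "3 * Q = g * (\<kappa> * h)" using g \<kappa> by (simp add: h_def)
      also have "\<dots> \<le> g * exp (\<kappa> * h)"
        using exp_ge_add_one_self[of "\<kappa> * h"] g by (intro mult_left_mono) linarith+
      finally show ?thesis .
    qed
    moreover have "3 * (k * exp (L * (t1 - T))) * exp (\<kappa> * h) = 3 * (k * exp (\<kappa> * h) * exp (L * (t1 - T)))"
      by simp
    ultimately have "3 * (k * exp (L * (t1 - T))) * exp (\<kappa> * h) \<le> g * exp (\<kappa> * h)"
      by linarith
    then have "3 * (k * exp (L * (t1 - T))) \<le> g" by (subst (asm) mult_le_cancel_right) simp
    then show ?thesis by simp
  qed
  have "z t1 \<le> x t1 + (k + 0 * L * (t1 - T)) * exp (L * (t1 - T))"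
    by (rule tsol_gronwall[OF \<Gamma> \<Gamma> _ _ z tsol_subset[OF x sT order_refl] T]) (use M0 L_def in \<open>auto simp: k_def\<close>)
  then have x1: "z t1 - g / 3 \<le> x t1" using kQ by simp
  show ?thesis
  proof (rule that[OF sT \<epsilon>])
    fix \<Delta> x' assume \<Delta>: "bdd_meas B \<Delta>" "\<And>t. \<bar>\<Delta> t - \<Gamma> t\<bar> \<le> \<epsilon>" and x': "tsol \<Delta> p M s t1 x'" "x' s = y s + \<kappa>"
    have "x t1 \<le> x' t1 + (0 + \<epsilon> * L * (t1 - s)) * exp (L * (t1 - s))"
      by (rule tsol_gronwall[OF \<Gamma> \<Delta>(1) _ _ x x'(1)])
        (use M0 L_def \<Delta>(2) xs x'(2) sT T in \<open>auto simp: abs_minus_commute\<close>)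
    also have "\<dots> = x' t1 + \<epsilon> * N" by (simp add: N_def)
    finally show "v < x' t1" using \<epsilon>N x1 g by (simp add: g_def field_simps)
  qed
qed

text \<open>Reflection of \<open>past_barrier\<close>: -y(-t) is again a strict lower solution, and
  the end value y s - \<kappa> becomes a starting value just above it.\<close>

lemma future_barrier:
  assumes \<Gamma>: "bdd_meas B \<Gamma>" and p: "bdd_meas B p" and M: "M \<ge> 2 * B + 1"
    and ylip: "\<And>c d. lip c d y" and yM: "\<And>t. \<bar>y t\<bar> \<le> M - 1"
    and y: "AE t in lebesgue. T < t \<longrightarrow>
        (\<exists>y'. (y has_real_derivative y') (at t) \<and> y' \<le> - (y t - \<Gamma> t)\<^sup>2 + p t - \<eta>)"
    and z: "\<And>d. tsol \<Gamma> p M t2 d z" and zM: "\<And>t. t2 \<le> t \<Longrightarrow> \<bar>z t\<bar> \<le> M"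
    and T: "t2 \<le> T" and v: "z t2 < v"
    and \<kappa>: "\<kappa> > 0" "\<kappa> \<le> 1" "2 * (M + B) * \<kappa> \<le> \<eta>"
  obtains s \<epsilon> where "T \<le> s" "\<epsilon> > 0"
    "\<And>\<Delta> x. \<lbrakk>bdd_meas B \<Delta>; \<And>t. \<bar>\<Delta> t - \<Gamma> t\<bar> \<le> \<epsilon>; tsol \<Delta> p M t2 s x; x s = y s - \<kappa>\<rbrakk> \<Longrightarrow> x t2 < v"
proof -
  have M0: "M \<ge> 0" using M bdd_meas_nonneg[OF \<Gamma>] by simp
  have ylip': "lip c d (\<lambda>t. - y (- t))" for c d using lip_uminus[OF lip_reflect[OF ylip[of "- d" "- c"]]] by simp
  have yae: "AE t in lebesgue. t < - T \<longrightarrow> (\<exists>y'. ((\<lambda>t. - y (- t)) has_real_derivative y') (at t) \<and>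
        y' \<le> - (- y (- t) - - \<Gamma> (- t))\<^sup>2 + p (- t) - \<eta>)"
    using AE_lebesgue_uminus[OF y]
  proof eventually_elim
    case (elim t)
    show ?case (is "_ \<longrightarrow> ?C")
    proof
      assume "t < - T"
      then obtain y' where y': "(y has_real_derivative y') (at (- t))" "y' \<le> - (y (- t) - \<Gamma> (- t))\<^sup>2 + p (- t) - \<eta>"
        using elim by auto
      have "((\<lambda>t. - y (- t)) has_real_derivative y') (at t)"
        using DERIV_minus[OF deriv_reflect[OF y'(1)]] by simp
      moreover have "(- y (- t) - - \<Gamma> (- t))\<^sup>2 = (y (- t) - \<Gamma> (- t))\<^sup>2"
        by (simp add: power2_eq_square algebra_simps)
      ultimately show ?C using y'(2) by auto
    qed
  qed
  have zt: "tsol (\<lambda>t. - \<Gamma> (- t)) (\<lambda>t. p (- t)) M c (- t2) (\<lambda>t. - z (- t))" for c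
    using tsol_reflect[OF M0 z[of "- c"]] by simp
  obtain s \<epsilon> where s: "s \<le> - T" "\<epsilon> > 0" and
    *: "\<And>\<Delta> x. \<lbrakk>bdd_meas B \<Delta>; \<And>t. \<bar>\<Delta> t - - \<Gamma> (- t)\<bar> \<le> \<epsilon>; tsol \<Delta> (\<lambda>t. p (- t)) M s (- t2) x; x s = - y (- s) + \<kappa>\<rbrakk>
      \<Longrightarrow> - v < x (- t2)"
  proof (rule past_barrier[OF bdd_meas_reflect_uminus[OF \<Gamma>] bdd_meas_reflect[OF p] M ylip' _ yae zt _ _ _ \<kappa>])
    show "\<bar>- y (- t)\<bar> \<le> M - 1" for t using yM[of "- t"] by simp
    show "\<bar>- z (- t)\<bar> \<le> M" if "t \<le> - t2" for t using zM[of "- t"] that by simp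
    show "- T \<le> - t2" using T by simp
    show "- v < - z (- (- t2))" using v by simp
  qed blast
  show ?thesis
  proof (rule that[of "- s" \<epsilon>])
    fix \<Delta> x assume \<Delta>: "bdd_meas B \<Delta>" "\<And>t. \<bar>\<Delta> t - \<Gamma> t\<bar> \<le> \<epsilon>" and x: "tsol \<Delta> p M t2 (- s) x" "x (- s) = y (- s) - \<kappa>"
    have "- v < - x (- (- t2))"
    proof (rule *)
      show "bdd_meas B (\<lambda>t. - \<Delta> (- t))" by (rule bdd_meas_reflect_uminus[OF \<Delta>(1)])
      show "\<bar>- \<Delta> (- t) - - \<Gamma> (- t)\<bar> \<le> \<epsilon>" for t using \<Delta>(2)[of "- t"] by (simp add: abs_minus_commute)
      show "tsol (\<lambda>t. - \<Delta> (- t)) (\<lambda>t. p (- t)) M s (- t2) (\<lambda>t. - x (- t))"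
        using tsol_reflect[OF M0 x(1)] by simp
    qed (use x(2) in simp)
    then show "x t2 < v" by simp
  qed (use s in auto)
qed

section \<open>Solutions bounded on a half-line\<close>

lemma abs_cont_continuous_on:
  assumes "absolutely_continuous_on c d x" shows "continuous_on {c..d} x"
  unfolding continuous_on_iff
proof (intro ballI allI impI)
  fix t e :: real assume t: "t \<in> {c..d}" and e: "e > 0"
  obtain \<delta> where \<delta>: "\<delta> > 0" "\<And>F. interval_system c d \<delta> F \<Longrightarrow> variation x F < e"
    using assms e unfolding absolutely_continuous_on_iff by blast
  have one: "\<bar>x v - x u\<bar> < e" if "c \<le> u" "u < v" "v \<le> d" "v - u < \<delta>" for u v
    using \<delta>(2)[of "{(u, v)}"] that by (simp add: interval_system_def variation_def disjoint_family_on_def)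
  show "\<exists>\<delta>>0. \<forall>t'\<in>{c..d}. dist t' t < \<delta> \<longrightarrow> dist (x t') (x t) < e"
  proof (intro exI[of _ \<delta>] conjI ballI impI \<delta>(1))
    fix t' assume t': "t' \<in> {c..d}" "dist t' t < \<delta>"
    consider "t' = t" | "t' < t" | "t < t'" by linarith
    then show "dist (x t') (x t) < e"
    proof cases
      case 2
      then show ?thesis using one[of t' t] t t' by (simp add: dist_real_def abs_minus_commute)
    next
      case 3
      then show ?thesis using one[of t t'] t t' by (simp add: dist_real_def)
    qed (use e in simp)
  qed
qed

lemma bounded_on_interval:
  assumes "absolutely_continuous_on c d x"
  obtains K where "\<And>t. c \<le> t \<Longrightarrow> t \<le> d \<Longrightarrow> \<bar>x t\<bar> \<le> K"
proof -
  have "bounded (x ` {c..d})"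
    using abs_cont_continuous_on[OF assms] compact_continuous_image compact_imp_bounded by blast
  then obtain K where "\<forall>y\<in>x ` {c..d}. norm y \<le> K" unfolding bounded_iff by blast
  then show ?thesis by (intro that[of K]) auto
qed

text \<open>\<open>Bfun\<close> controls x only near -\<infinity>; continuity bounds it on the
  remaining compact interval. A single bound is wanted because the truncation level has to dominate
  the solution on the whole half-line.\<close>

lemma bounded_in_pastE:
  assumes "bounded_in_past \<Delta> q s x0"
  obtains x K where "solution_on \<Delta> q {..s} x" "x s = x0" "\<And>t. t \<le> s \<Longrightarrow> \<bar>x t\<bar> \<le> K"
proof -
  obtain x where x: "solution_on \<Delta> q {..s} x" "x s = x0" "Bfun x at_bot"
    using assms by (auto simp: bounded_in_past_def)
  obtain K1 where "eventually (\<lambda>t. norm (x t) \<le> K1) at_bot" using x(3) by (auto elim: BfunE)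
  then obtain t0 where t0: "\<And>t. t \<le> t0 \<Longrightarrow> \<bar>x t\<bar> \<le> K1" by (auto simp: eventually_at_bot_linorder)
  have "absolutely_continuous_on t0 s x" using x(1) by (auto simp: solution_on_def)
  from bounded_on_interval[OF this] obtain K2 where K2: "\<And>t. t0 \<le> t \<Longrightarrow> t \<le> s \<Longrightarrow> \<bar>x t\<bar> \<le> K2" by blast
  show ?thesis
  proof (rule that[OF x(1,2), of "max K1 K2"])
    fix t assume "t \<le> s"
    then show "\<bar>x t\<bar> \<le> max K1 K2" using t0[of t] K2[of t] by (cases "t \<le> t0") auto
  qed
qed

lemma bounded_in_futureE:
  assumes "bounded_in_future \<Delta> q s x0"
  obtains x K where "solution_on \<Delta> q {s..} x" "x s = x0" "\<And>t. s \<le> t \<Longrightarrow> \<bar>x t\<bar> \<le> K"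
proof -
  obtain x where x: "solution_on \<Delta> q {s..} x" "x s = x0" "Bfun x at_top"
    using assms by (auto simp: bounded_in_future_def)
  obtain K1 where "eventually (\<lambda>t. norm (x t) \<le> K1) at_top" using x(3) by (auto elim: BfunE)
  then obtain t0 where t0: "\<And>t. t \<ge> t0 \<Longrightarrow> \<bar>x t\<bar> \<le> K1" by (auto simp: eventually_at_top_linorder)
  have "absolutely_continuous_on s t0 x" using x(1) by (auto simp: solution_on_def)
  from bounded_on_interval[OF this] obtain K2 where K2: "\<And>t. s \<le> t \<Longrightarrow> t \<le> t0 \<Longrightarrow> \<bar>x t\<bar> \<le> K2" by blast
  show ?thesis
  proof (rule that[OF x(1,2), of "max K1 K2"])
    fix t assume "s \<le> t"
    then show "\<bar>x t\<bar> \<le> max K1 K2" using t0[of t] K2[of t] by (cases "t0 \<le> t") auto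
  qed
qed

text \<open>For n < N the pair for the window N lies between X and x on the smaller window, so the
  order for large windows implies it for small ones.\<close>

lemma pullback_order_extend:
  assumes \<Delta>: "bdd_meas B \<Delta>" and q: "bdd_meas B q" and M: "M \<ge> 2 * B + 1"
    and ord: "\<And>n x X t. N \<le> n \<Longrightarrow> pullback_pair \<Delta> q M n x X \<Longrightarrow>
        - real n \<le> t \<Longrightarrow> t \<le> real n \<Longrightarrow> X t \<le> x t"
    and pair: "pullback_pair \<Delta> q M n x X" and t: "- real n \<le> t" "t \<le> real n"
  shows "X t \<le> x t"
proof -
  have x: "tsol \<Delta> q M (- real n) (real n) x" "x (- real n) = M"
    and X: "tsol \<Delta> q M (- real n) (real n) X" "X (real n) = - M"
    using pair by (auto simp: pullback_pair_def)
  have M0: "M \<ge> 0" using M bdd_meas_nonneg[OF \<Delta>] by simp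
  show "X t \<le> x t"
  proof (cases "N \<le> n")
    case True
    then show ?thesis using ord pair t by blast
  next
    case False
    obtain x' where x': "x' (- real N) = M" "\<And>T. tsol \<Delta> q M (- real N) T x'"
      using tsol_exists[OF \<Delta> q M0] by blast
    obtain X' where X': "X' (real N) = - M" "\<And>T. tsol \<Delta> q M T (real N) X'"
      using tsol_exists_backward[OF \<Delta> q M0] by blast
    have "X' t \<le> x' t" by (rule ord[OF order_refl]) (use x' X' t False in \<open>auto simp: pullback_pair_def\<close>)
    moreover have "x' t \<le> x t"
    proof (rule tsol_mono[OF \<Delta> M0 tsol_subset[OF x'(2)[of t]] tsol_subset[OF x(1)]])
      show "x' (- real n) \<le> x (- real n)"
        using tsol_le_M[OF \<Delta> q M x'(2)[of "- real n"]] x'(1) x(2) False by simp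
    qed (use t False in auto)
    moreover have "X t \<le> X' t"
    proof (rule tsol_le_tsub_backward[OF \<Delta> M0 tsol_imp_tsub[OF tsol_subset[OF X'(2)[of t]]] tsol_subset[OF X(1)]])
      show "X (real n) \<le> X' (real n)"
        using tsol_ge_M_backward[OF \<Delta> q M X'(2)[of "real n"]] X'(1) X(2) False by simp
    qed (use t False in auto)
    ultimately show ?thesis by simp
  qed
qed

text \<open>Forwards x stays above the chain of lower solutions ym, xb, y, Xb, yp, and backwards X
  stays below it, as the chain only jumps down at its junctions. Two shifts are used in each tail:
  on the left X is below ym + \<kappa> and x above ym + 2 \<kappa>; on the right X is below yp - 2
  \<kappa> and x above yp - \<kappa>. This leaves the gap \<kappa> in the tails.\<close>

lemma attractor_repeller_pair_if_barrier:
  assumes \<Delta>: "bdd_meas B \<Delta>" and p: "bdd_meas B p" and M: "M \<ge> 2 * B + 1" and \<kappa>: "\<kappa> > 0"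
    and s: "s1 \<le> t1" "t1 \<le> t2" "t2 \<le> s2"
    and ym: "\<And>c. tsub \<Delta> p M c s1 (\<lambda>t. ym t + \<kappa>)" "\<And>c. tsub \<Delta> p M c s1 (\<lambda>t. ym t + 2 * \<kappa>)"
      "\<And>t. ym t + 2 * \<kappa> \<le> M"
    and yp: "\<And>d. tsub \<Delta> p M s2 d (\<lambda>t. yp t - \<kappa>)" "\<And>d. tsub \<Delta> p M s2 d (\<lambda>t. yp t - 2 * \<kappa>)"
      "\<And>t. - M \<le> yp t - 2 * \<kappa>"
    and xb: "tsol \<Delta> p M s1 t1 xb" "xb s1 = ym s1 + \<kappa>" "y t1 \<le> xb t1"
    and y: "tsub \<Delta> p M t1 t2 y"
    and Xb: "tsol \<Delta> p M t2 s2 Xb" "Xb s2 = yp s2 - \<kappa>" "Xb t2 \<le> y t2"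
  shows "\<exists>a r. attractor_repeller_pair \<Delta> p a r"
proof -
  have M0: "M \<ge> 0" using M bdd_meas_nonneg[OF \<Delta>] by simp
  obtain N :: nat where N: "max \<bar>s1\<bar> \<bar>s2\<bar> \<le> real N" using real_arch_simple by blast
  have N': "- real n \<le> s1" "s2 \<le> real n" if "N \<le> n" for n
  proof -
    have "real N \<le> real n" using that by simp
    then show "- real n \<le> s1" "s2 \<le> real n" using N by linarith+
  qed
  have left: "X t + \<kappa> \<le> x t"
    if n: "N \<le> n" and pair: "pullback_pair \<Delta> p M n x X"
      and t: "- real n \<le> t" "t \<le> s1" for n x X t
  proof -
    note n' = N'[OF n]
    have x: "tsol \<Delta> p M (- real n) (real n) x" "x (- real n) = M"
      and X: "tsol \<Delta> p M (- real n) (real n) X" "X (real n) = - M"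
      using pair by (auto simp: pullback_pair_def)
    have "ym t + 2 * \<kappa> \<le> x t"
      by (rule tsub_le_tsol[OF \<Delta> M0 tsub_subset[OF ym(2)] tsol_subset[OF x(1)] t(1)])
        (use x(2) ym(3) t n' s in auto)
    have "X s2 \<le> yp s2 - 2 * \<kappa>"
      by (rule tsol_le_tsub_backward[OF \<Delta> M0 yp(2) tsol_subset[OF X(1)] n'(2)])
        (use X(2) yp(3) n' s in auto)
    then have "X s2 \<le> Xb s2" using Xb(2) \<kappa> by simp
    then have "X t2 \<le> Xb t2"
      by (intro tsol_le_tsub_backward[OF \<Delta> M0 tsol_imp_tsub[OF Xb(1)] tsol_subset[OF X(1)] s(3)]) (use n' s in auto)
    then have "X t2 \<le> y t2" using Xb(3) by simp
    then have "X t1 \<le> y t1"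
      by (intro tsol_le_tsub_backward[OF \<Delta> M0 y tsol_subset[OF X(1)] s(2)]) (use n' s in auto)
    then have "X t1 \<le> xb t1" using xb(3) by simp
    then have "X s1 \<le> xb s1"
      by (intro tsol_le_tsub_backward[OF \<Delta> M0 tsol_imp_tsub[OF xb(1)] tsol_subset[OF X(1)] s(1)]) (use n' s in auto)
    then have "X t \<le> ym t + \<kappa>" using xb(2)
      by (intro tsol_le_tsub_backward[OF \<Delta> M0 ym(1) tsol_subset[OF X(1)] t(2)]) (use n' s t in auto)
    then show ?thesis using \<open>ym t + 2 * \<kappa> \<le> x t\<close> by simp
  qed
  have right: "X t + \<kappa> \<le> x t"
    if n: "N \<le> n" and pair: "pullback_pair \<Delta> p M n x X"
      and t: "s2 \<le> t" "t \<le> real n" for n x X t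
  proof -
    note n' = N'[OF n]
    have x: "tsol \<Delta> p M (- real n) (real n) x" "x (- real n) = M"
      and X: "tsol \<Delta> p M (- real n) (real n) X" "X (real n) = - M"
      using pair by (auto simp: pullback_pair_def)
    have "X t \<le> yp t - 2 * \<kappa>"
      by (rule tsol_le_tsub_backward[OF \<Delta> M0 tsub_subset[OF yp(2)] tsol_subset[OF X(1)] t(2)])
        (use X(2) yp(3) t n' s in auto)
    have "ym s1 + 2 * \<kappa> \<le> x s1"
      by (rule tsub_le_tsol[OF \<Delta> M0 ym(2) tsol_subset[OF x(1)] n'(1)])
        (use x(2) ym(3) n' s in auto)
    then have "xb s1 \<le> x s1" using xb(2) \<kappa> by simp
    then have "xb t1 \<le> x t1"
      by (intro tsol_mono[OF \<Delta> M0 xb(1) tsol_subset[OF x(1)] s(1)]) (use n' s in auto)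
    then have "y t1 \<le> x t1" using xb(3) by simp
    then have "y t2 \<le> x t2"
      by (intro tsub_le_tsol[OF \<Delta> M0 y tsol_subset[OF x(1)] s(2)]) (use n' s in auto)
    then have "Xb t2 \<le> x t2" using Xb(3) by simp
    then have "Xb s2 \<le> x s2"
      by (intro tsol_mono[OF \<Delta> M0 Xb(1) tsol_subset[OF x(1)] s(3)]) (use n' s in auto)
    then have "yp t - \<kappa> \<le> x t" using Xb(2)
      by (intro tsub_le_tsol[OF \<Delta> M0 yp(1) tsol_subset[OF x(1)] t(1)]) (use n' s t in auto)
    then show ?thesis using \<open>X t \<le> yp t - 2 * \<kappa>\<close> by simp
  qed
  have ord: "X t \<le> x t"
    if n: "N \<le> n" and pair: "pullback_pair \<Delta> p M n x X"
      and t: "- real n \<le> t" "t \<le> real n" for n x X t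
  proof (cases "t \<le> s1")
    case True
    then show ?thesis using left[OF n pair t(1)] \<kappa> by simp
  next
    case False
    show ?thesis
    proof (rule tsol_mono[OF \<Delta> M0, where x=X and y=x and c=s1 and d=t])
      show "tsol \<Delta> p M s1 t X" "tsol \<Delta> p M s1 t x"
        using pair N'[OF n] t by (auto simp: pullback_pair_def intro: tsol_subset)
      show "X s1 \<le> x s1" using left[OF n pair N'(1)[OF n]] \<kappa> by simp
    qed (use False N'[OF n] t in auto)
  qed
  show ?thesis
  proof (rule pullback_limits[OF \<Delta> p M])
    show "X t \<le> x t" if "pullback_pair \<Delta> p M n x X" "- real n \<le> t" "t \<le> real n" for n x X t
      by (rule pullback_order_extend[OF \<Delta> p M _ that, of N]) (rule ord)
  next
    fix x X a r
    assume x: "\<And>n. x n (- real n) = M" "\<And>n d. tsol \<Delta> p M (- real n) d (x n)" and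
      X: "\<And>n. X n (real n) = - M" "\<And>n c. tsol \<Delta> p M c (real n) (X n)" and
      lim: "\<And>t. (\<lambda>n. x n t) \<longlonglongrightarrow> a t" "\<And>t. (\<lambda>n. X n t) \<longlonglongrightarrow> r t" and
      a: "\<And>c d. tsol \<Delta> p M c d a" and r: "\<And>c d. tsol \<Delta> p M c d r" and
      ab: "\<And>t. \<bar>a t\<bar> \<le> M" and rb: "\<And>t. \<bar>r t\<bar> \<le> M"
    have outer: "r t + \<kappa> \<le> a t" if "t \<le> s1 \<or> s2 \<le> t" for t
    proof (rule LIMSEQ_le[OF tendsto_add[OF lim(2) tendsto_const] lim(1)])
      obtain N' :: nat where N': "\<bar>t\<bar> \<le> real N'" using real_arch_simple by blast
      show "\<exists>N. \<forall>n\<ge>N. X n t + \<kappa> \<le> x n t"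
      proof (intro exI[of _ "max N N'"] allI impI)
        fix n assume "max N N' \<le> n"
        then have n: "N \<le> n" "real N' \<le> real n" by auto
        then have t: "- real n \<le> t" "t \<le> real n" using N' by linarith+
        have pair: "pullback_pair \<Delta> p M n (x n) (X n)" using x X by (simp add: pullback_pair_def)
        from that show "X n t + \<kappa> \<le> x n t"
        proof
          assume "t \<le> s1"
          then show ?thesis by (rule left[OF n(1) pair t(1)])
        next
          assume "s2 \<le> t"
          then show ?thesis using right[OF n(1) pair _ t(2)] by blast
        qed
      qed
    qed
    have lipar: "lip c d a" "lip c d r" for c d using a[of c d] r[of c d] by (auto simp: tsol_def)
    \<comment> \<open>In the compact middle the gap comes from continuity and strict monotonicity:
      solutions separated at s1 never meet later.\<close>
    have "continuous_on {s1..s2} (\<lambda>t. a t - r t)"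
      by (intro continuous_intros lip_continuous_on lipar)
    then obtain t0 where t0: "t0 \<in> {s1..s2}" "\<And>t. t \<in> {s1..s2} \<Longrightarrow> a t0 - r t0 \<le> a t - r t"
      using continuous_attains_inf[of "{s1..s2}" "\<lambda>t. a t - r t"] s by auto
    have "r t0 < a t0"
      by (rule tsol_strict_mono[OF \<Delta> M0 r a, of s1 t0]) (use t0 outer[of s1] \<kappa> in auto)
    define c where "c = min \<kappa> (a t0 - r t0)"
    have c: "c > 0" using \<kappa> \<open>r t0 < a t0\<close> by (simp add: c_def)
    have "c \<le> a t - r t" for t
      using outer[of t] t0(2)[of t] by (cases "t \<le> s1 \<or> s2 \<le> t") (auto simp: c_def)
    then show ?thesis using separated_imp_attractor_repeller_pair[OF \<Delta> p a ab r rb c] by blast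
  qed
qed

text \<open>In the tails \<Gamma> is replaced by its limits, whose slope is 0, so strictness there
  comes from inf (a - r)^2 > 0. On [t1, t2] the pointwise rate condition becomes uniform by
  compactness.\<close>

lemma tracking_for_small_steps:
  assumes pL: "p \<in> Linf" and ar: "attractor_repeller_pair (\<lambda>t. 0) p a r"
    and bG: "\<And>t. \<bar>\<Gamma> t\<bar> \<le> G" and cont: "continuous_on UNIV \<Gamma>"
    and top: "(\<Gamma> \<longlongrightarrow> L1) at_top" and bot: "(\<Gamma> \<longlongrightarrow> L2) at_bot"
    and t12: "t1 < t2"
    and past: "bounded_in_past \<Gamma> p t1 z1" "1/2 * (a t1 + r t1) + \<Gamma> t1 < z1"
    and future: "bounded_in_future \<Gamma> p t2 z2" "z2 < 1/2 * (a t2 + r t2) + \<Gamma> t2"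
    and d\<Gamma>: "\<And>t. t \<in> {t1..t2} \<Longrightarrow> (\<Gamma> has_real_derivative \<Gamma>' t) (at t within {t1..t2})"
    and cont': "continuous_on {t1..t2} \<Gamma>'"
    and gap: "\<And>t. t \<in> {t1..t2} \<Longrightarrow> \<Gamma>' t < 1/4 * (a t - r t)\<^sup>2"
  shows "\<exists>h_max>0. \<forall>h\<in>{0..h_max}. \<exists>ah rh. attractor_repeller_pair (sample h \<Gamma>) p ah rh"
proof -
  obtain B0 p' where p': "bdd_meas B0 p'" "AE t in lebesgue. p t = p' t"
    using Linf_bounded_representative[OF pL] by blast
  have ar': "attractor_repeller_pair (\<lambda>t. 0) p' a r" using ar attractor_repeller_pair_cong_AE[OF p'(2)] by blast
  obtain m A
    where A: "A \<ge> 0" and m_def: "\<And>t. m t = 1/2 * (a t + r t)" and m: "\<And>t. \<bar>m t\<bar> \<le> A"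
    and mlip: "\<And>c d. lip c d m"
    and dm: "AE t in lebesgue. (m has_real_derivative - (m t)\<^sup>2 - 1/4 * (a t - r t)\<^sup>2 + p' t) (at t)"
    and lip: "\<And>c d. lip c d a" "\<And>c d. lip c d r"
    by (rule attractor_repeller_pair_midpoint[OF p'(1) ar']) (rule that)
  obtain \<sigma> where \<sigma>: "\<sigma> > 0" "\<And>t. \<sigma> \<le> a t - r t" using attractor_repeller_pair_separated[OF p'(1) ar'] by metis
  have sep: "1/4 * \<sigma>\<^sup>2 \<le> 1/4 * (a t - r t)\<^sup>2" for t
    using \<sigma>(1) \<sigma>(2)[of t] by (auto intro!: power_mono)
  have "continuous_on {t1..t2} (\<lambda>t. 1/4 * (a t - r t)\<^sup>2 - \<Gamma>' t)"
    by (intro continuous_intros lip_continuous_on lip cont')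
  then obtain t0 where t0: "t0 \<in> {t1..t2}"
    "\<And>t. t \<in> {t1..t2} \<Longrightarrow> 1/4 * (a t0 - r t0)\<^sup>2 - \<Gamma>' t0 \<le> 1/4 * (a t - r t)\<^sup>2 - \<Gamma>' t"
    using continuous_attains_inf[of "{t1..t2}" "\<lambda>t. 1/4 * (a t - r t)\<^sup>2 - \<Gamma>' t"] t12 by auto
  \<comment> \<open>A third of the smaller of the tail margin and the margin on [t1, t2]; this
    leaves at least \<eta> for the perturbation inside the square and \<eta> for strictness.\<close>
  define \<eta> where "\<eta> = min (1/4 * \<sigma>\<^sup>2) (1/4 * (a t0 - r t0)\<^sup>2 - \<Gamma>' t0) / 3"
  have \<eta>: "\<eta> > 0" using \<sigma>(1) gap[OF t0(1)] by (simp add: \<eta>_def)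
  have \<eta>1: "3 * \<eta> \<le> 1/4 * (a t - r t)\<^sup>2" for t
  proof -
    have "3 * \<eta> = min (1/4 * \<sigma>\<^sup>2) (1/4 * (a t0 - r t0)\<^sup>2 - \<Gamma>' t0)" by (simp add: \<eta>_def)
    also have "\<dots> \<le> 1/4 * \<sigma>\<^sup>2" by (rule min.cobounded1)
    also have "\<dots> \<le> 1/4 * (a t - r t)\<^sup>2" by (rule sep)
    finally show ?thesis .
  qed
  have \<eta>2: "3 * \<eta> + \<Gamma>' t \<le> 1/4 * (a t - r t)\<^sup>2" if "t \<in> {t1..t2}" for t
  proof -
    have "3 * \<eta> = min (1/4 * \<sigma>\<^sup>2) (1/4 * (a t0 - r t0)\<^sup>2 - \<Gamma>' t0)" by (simp add: \<eta>_def)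
    also have "\<dots> \<le> 1/4 * (a t0 - r t0)\<^sup>2 - \<Gamma>' t0" by (rule min.cobounded2)
    finally show ?thesis using t0(2)[OF that] by linarith
  qed
  obtain \<epsilon> where \<epsilon>: "\<epsilon> > 0" "\<epsilon> \<le> 1" and \<epsilon>2: "(2 * A + 1) * \<epsilon> \<le> \<eta>"
    using perturbation_size[OF \<eta> A] by metis
  have half: "\<epsilon> / 2 > 0" using \<epsilon> by simp
  obtain T1 where T1: "\<And>t. t \<ge> T1 \<Longrightarrow> dist (\<Gamma> t) L1 < \<epsilon> / 2"
    using tendstoD[OF top half] by (auto simp: eventually_at_top_linorder)
  obtain T2 where T2: "\<And>t. t \<le> T2 \<Longrightarrow> dist (\<Gamma> t) L2 < \<epsilon> / 2"
    using tendstoD[OF bot half] by (auto simp: eventually_at_bot_linorder)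
  have lim_bound: "\<bar>L1\<bar> \<le> G + 1" "\<bar>L2\<bar> \<le> G + 1"
  proof -
    have "\<bar>\<Gamma> T1 - L1\<bar> < \<epsilon> / 2" "\<bar>\<Gamma> T2 - L2\<bar> < \<epsilon> / 2"
      using T1[of T1] T2[of T2] by (simp_all add: dist_real_def)
    then have 1: "\<bar>\<Gamma> T1 - L1\<bar> \<le> 1" "\<bar>\<Gamma> T2 - L2\<bar> \<le> 1" using \<epsilon>(2) by linarith+
    show "\<bar>L1\<bar> \<le> G + 1" using 1(1) bG[of T1] by linarith
    show "\<bar>L2\<bar> \<le> G + 1" using 1(2) bG[of T2] by linarith
  qed
  obtain zz K1 where zz: "solution_on \<Gamma> p {..t1} zz" "zz t1 = z1" "\<And>t. t \<le> t1 \<Longrightarrow> \<bar>zz t\<bar> \<le> K1"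
    using bounded_in_pastE[OF past(1)] by blast
  obtain ww K2 where ww: "solution_on \<Gamma> p {t2..} ww" "ww t2 = z2" "\<And>t. t2 \<le> t \<Longrightarrow> \<bar>ww t\<bar> \<le> K2"
    using bounded_in_futureE[OF future(1)] by blast
  define B where "B = max B0 G"
  have pB: "bdd_meas B p'" using bdd_meas_mono[OF p'(1), of B] by (simp add: B_def)
  have GB: "\<bar>\<Gamma> t\<bar> \<le> B" for t using bG[of t] by (simp add: B_def)
  have sB: "bdd_meas B (sample h \<Gamma>)" for h by (rule sample_bdd_meas[OF cont GB])
  have \<Gamma>B: "bdd_meas B \<Gamma>" using GB continuous_imp_measurable_lebesgue[OF cont] by (simp add: bdd_meas_def)
  have B: "B \<ge> 0" "G \<le> B" using bdd_meas_nonneg[OF pB] by (auto simp: B_def)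
  \<comment> \<open>K1 and K2 bound the solutions through (t1, z1) and (t2, z2), so that these also
    solve the truncated equation. The summand 4 leaves room for |L1|, |L2| \<le> G + 1 within M -
    1.\<close>
  define M where "M = Max {2 * B + A + 4, K1, K2}"
  have M: "M \<ge> 2 * B + A + 4" "M \<ge> K1" "M \<ge> K2" by (auto simp: M_def)
  have M1: "M \<ge> 2 * B + 1" "M \<ge> 0" using M(1) A B by auto
  \<comment> \<open>Shifts up to 2 \<kappa> occur, hence the requirements 2 \<kappa> \<le> 1 and 2
    (M + B) (2 \<kappa>) \<le> \<eta>.\<close>
  define \<kappa> where "\<kappa> = min (1/2) (\<eta> / (4 * (M + B)))"
  have \<kappa>: "\<kappa> > 0" "\<kappa> \<le> 1/2"
    using \<eta> M(1) A B unfolding \<kappa>_def by (simp, intro min.cobounded1)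
  have \<kappa>2: "2 * (M + B) * (2 * \<kappa>) \<le> \<eta>"
  proof -
    have "4 * (M + B) * \<kappa> \<le> 4 * (M + B) * (\<eta> / (4 * (M + B)))"
      using M1 B by (intro mult_left_mono) (auto simp: \<kappa>_def)
    also have "\<dots> = \<eta>" using M(1) A B by simp
    finally show ?thesis by (simp add: algebra_simps)
  qed
  have \<kappa>1: "2 * (M + B) * \<kappa> \<le> \<eta>"
  proof -
    have "2 * (M + B) * \<kappa> \<le> 2 * (M + B) * (2 * \<kappa>)" using \<kappa> M1 B by (intro mult_left_mono) auto
    then show ?thesis using \<kappa>2 by (rule order_trans)
  qed
  have yl: "lip c d (\<lambda>t. m t + l)" for c d l by (intro lip_add mlip lip_const)
  have yM: "\<bar>m t + l\<bar> \<le> M - 1" if "\<bar>l\<bar> \<le> G + 1" for t l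
    using m[of t] that M(1) B by (auto simp: abs_le_iff)
  have lower: "AE t in lebesgue. t \<in> S \<longrightarrow> (\<exists>y'. ((\<lambda>t. m t + l) has_real_derivative y') (at t) \<and>
      y' \<le> - (m t + l - \<Delta> t)\<^sup>2 + p' t - \<eta>)"
    if "\<And>t. t \<in> S \<Longrightarrow> \<bar>l - \<Delta> t\<bar> \<le> \<epsilon>" for S l and \<Delta> :: "real \<Rightarrow> real"
    using dm
  proof eventually_elim
    case (elim t)
    show ?case (is "_ \<longrightarrow> ?C")
    proof
      assume "t \<in> S"
      have "((\<lambda>t. m t + l) has_real_derivative (- (m t)\<^sup>2 - 1/4 * (a t - r t)\<^sup>2 + p' t) + 0) (at t)"
        by (intro DERIV_add elim DERIV_const)
      moreover have "(- (m t)\<^sup>2 - 1/4 * (a t - r t)\<^sup>2 + p' t) + 0 \<le> - (m t + l - \<Delta> t)\<^sup>2 + p' t - \<eta>"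
        using quadratic_perturbation[OF m that[OF \<open>t \<in> S\<close>] \<epsilon>(2) \<epsilon>2, of t] \<eta>1[of t] \<eta>
        by (simp add: add_diff_eq)
      ultimately show ?C
        by blast
    qed
  qed
  \<comment> \<open>Left of \<open>T2\<close> the function \<Gamma> is close to its limit; the
    minimum also keeps this tail to the left of t1.\<close>
  define Tm where "Tm = min T2 t1"
  define Tp where "Tp = max T1 t2"
  have Tm: "\<bar>L2 - \<Gamma> t\<bar> \<le> \<epsilon> / 2" if "t < Tm" for t using T2[of t] that by (simp add: Tm_def dist_real_def abs_minus_commute)
  have Tp: "\<bar>L1 - \<Gamma> t\<bar> \<le> \<epsilon> / 2" if "Tp < t" for t using T1[of t] that by (simp add: Tp_def dist_real_def abs_minus_commute)
  obtain s1 \<epsilon>1 where s1: "s1 \<le> Tm" "\<epsilon>1 > 0" and bar1: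
    "\<And>\<Delta> x. \<lbrakk>bdd_meas B \<Delta>; \<And>t. \<bar>\<Delta> t - \<Gamma> t\<bar> \<le> \<epsilon>1; tsol \<Delta> p' M s1 t1 x; x s1 = m s1 + L2 + \<kappa>\<rbrakk> \<Longrightarrow> m t1 + \<Gamma> t1 < x t1"
  proof (rule past_barrier[where y="\<lambda>t. m t + L2" and T=Tm and z=zz and v="m t1 + \<Gamma> t1" and ?t1.0=t1 and \<eta>=\<eta> and \<kappa>=\<kappa>, OF \<Gamma>B pB M1(1) yl])
    show "\<bar>m t + L2\<bar> \<le> M - 1" for t by (rule yM[OF lim_bound(2)])
    show "AE t in lebesgue. t < Tm \<longrightarrow> (\<exists>y'. ((\<lambda>t. m t + L2) has_real_derivative y') (at t) \<and>
        y' \<le> - (m t + L2 - \<Gamma> t)\<^sup>2 + p' t - \<eta>)"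
      using lower[of "{..<Tm}" L2 \<Gamma>] Tm \<epsilon>(1) by force
    show "tsol \<Gamma> p' M c t1 zz" for c
      by (rule solution_imp_tsol[OF \<Gamma>B pB M1(2), of "{..t1}"])
        (use zz(1,3) M(2) solution_on_cong_AE[OF p'(2)] in \<open>auto intro: order_trans\<close>)
    show "\<bar>zz t\<bar> \<le> M" if "t \<le> t1" for t using zz(3)[OF that] M(2) by simp
    show "Tm \<le> t1" by (simp add: Tm_def)
    show "m t1 + \<Gamma> t1 < zz t1" using past(2) zz(2) by (simp add: m_def)
    show "\<kappa> > 0" "\<kappa> \<le> 1" "2 * (M + B) * \<kappa> \<le> \<eta>" using \<kappa> \<kappa>1 by auto
  qed blast
  obtain s2 \<epsilon>2' where s2: "Tp \<le> s2" "\<epsilon>2' > 0" and bar2: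
    "\<And>\<Delta> x. \<lbrakk>bdd_meas B \<Delta>; \<And>t. \<bar>\<Delta> t - \<Gamma> t\<bar> \<le> \<epsilon>2'; tsol \<Delta> p' M t2 s2 x; x s2 = m s2 + L1 - \<kappa>\<rbrakk> \<Longrightarrow> x t2 < m t2 + \<Gamma> t2"
  proof (rule future_barrier[where y="\<lambda>t. m t + L1" and T=Tp and z=ww and v="m t2 + \<Gamma> t2" and ?t2.0=t2 and \<eta>=\<eta> and \<kappa>=\<kappa>, OF \<Gamma>B pB M1(1) yl])
    show "\<bar>m t + L1\<bar> \<le> M - 1" for t by (rule yM[OF lim_bound(1)])
    show "AE t in lebesgue. Tp < t \<longrightarrow> (\<exists>y'. ((\<lambda>t. m t + L1) has_real_derivative y') (at t) \<and>
        y' \<le> - (m t + L1 - \<Gamma> t)\<^sup>2 + p' t - \<eta>)"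
      using lower[of "{Tp<..}" L1 \<Gamma>] Tp \<epsilon>(1) by force
    show "tsol \<Gamma> p' M t2 d ww" for d
      by (rule solution_imp_tsol[OF \<Gamma>B pB M1(2), of "{t2..}"])
        (use ww(1,3) M(3) solution_on_cong_AE[OF p'(2)] in \<open>auto intro: order_trans\<close>)
    show "\<bar>ww t\<bar> \<le> M" if "t2 \<le> t" for t using ww(3)[OF that] M(3) by simp
    show "t2 \<le> Tp" by (simp add: Tp_def)
    show "ww t2 < m t2 + \<Gamma> t2" using future(2) ww(2) by (simp add: m_def)
    show "\<kappa> > 0" "\<kappa> \<le> 1" "2 * (M + B) * \<kappa> \<le> \<eta>" using \<kappa> \<kappa>1 by auto
  qed blast
  \<comment> \<open>The distance of \<Gamma> from its limits uses up one half of \<epsilon> and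
    leaves the other for sampling; \<epsilon>1 and \<epsilon>2' are the tolerances of the two
    barriers.\<close>
  define e where "e = Min {\<epsilon> / 2, \<epsilon>1, \<epsilon>2'}"
  have e: "e > 0" "e \<le> \<epsilon> / 2" "e \<le> \<epsilon>1" "e \<le> \<epsilon>2'" using \<epsilon> s1 s2 by (auto simp: e_def)
  obtain h0 where h0: "h0 > 0" "\<And>k t. 0 \<le> k \<Longrightarrow> k \<le> h0 \<Longrightarrow> \<bar>sample k \<Gamma> t - \<Gamma> t\<bar> \<le> e"
    using sample_close[OF uniformly_continuous_if_limits[OF cont top bot] e(1)] by blast
  have "\<exists>ah rh. attractor_repeller_pair (sample h \<Gamma>) p ah rh" if h: "h \<in> {0..h0}" for h
  proof -
    define \<Delta> where "\<Delta> = sample h \<Gamma>"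
    have \<Delta>: "bdd_meas B \<Delta>" unfolding \<Delta>_def by (rule sB)
    have close: "\<bar>\<Delta> t - \<Gamma> t\<bar> \<le> e" for t using h0(2)[of h t] h by (simp add: \<Delta>_def)
    have tsub: "tsub \<Delta> p' M c d (\<lambda>t. (m t + l) + \<rho>)"
      if l: "\<bar>l\<bar> \<le> G + 1" "\<And>t. c < t \<Longrightarrow> t < d \<Longrightarrow> \<bar>l - \<Gamma> t\<bar> \<le> \<epsilon> / 2" and \<rho>: "\<bar>\<rho>\<bar> \<le> 2 * \<kappa>" for c d l \<rho>
    proof (rule tsub_margin[OF \<Delta> M1(2) yl])
      have "\<bar>l - \<Delta> t\<bar> \<le> \<epsilon>" if "t \<in> {c<..<d}" for t
      proof -
        have "\<bar>l - \<Gamma> t\<bar> \<le> \<epsilon> / 2" using l(2) that by simp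
        then show ?thesis using close[of t] e(2) by linarith
      qed
      from lower[of "{c<..<d}" l \<Delta>, OF this]
      show "ae_deriv_le c d (\<lambda>t. m t + l) (\<lambda>t. - (m t + l - \<Delta> t)\<^sup>2 + p' t - \<eta>)" by simp
      show "\<bar>m t + l\<bar> \<le> M" for t using yM[OF l(1), of t] by simp
      have "2 * (M + B) * \<bar>\<rho>\<bar> \<le> 2 * (M + B) * (2 * \<kappa>)" using \<rho> M1 B by (intro mult_left_mono) auto
      then show "2 * (M + B) * \<bar>\<rho>\<bar> \<le> \<eta>" using \<kappa>2 by simp
    qed
    have lm: "tsub \<Delta> p' M c s1 (\<lambda>t. (m t + L2) + \<rho>)" if "\<bar>\<rho>\<bar> \<le> 2 * \<kappa>" for c \<rho>
      by (rule tsub[OF lim_bound(2) Tm that]) (use s1(1) in simp)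
    have lp: "tsub \<Delta> p' M s2 d (\<lambda>t. (m t + L1) + \<rho>)" if "\<bar>\<rho>\<bar> \<le> 2 * \<kappa>" for d \<rho>
      by (rule tsub[OF lim_bound(1) Tp that]) (use s2(1) in simp)
    \<comment> \<open>No shift is made here; \<open>tsub_margin\<close> only passes from the strict
      inequality to the truncated field.\<close>
    have ly: "tsub \<Delta> p' M t1 t2 (\<lambda>t. (m t + \<Gamma> t) + 0)"
    proof (rule tsub_margin[OF \<Delta> M1(2), where \<eta>=\<eta>])
      show "lip t1 t2 (\<lambda>t. m t + \<Gamma> t)" by (intro lip_add mlip lip_C1[OF d\<Gamma> cont'])
      from dm show "ae_deriv_le t1 t2 (\<lambda>t. m t + \<Gamma> t) (\<lambda>t. - (m t + \<Gamma> t - \<Delta> t)\<^sup>2 + p' t - \<eta>)"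
      proof eventually_elim
        case (elim t)
        show ?case (is "_ \<longrightarrow> ?C")
        proof
          assume t: "t1 < t \<and> t < t2"
          then have "(\<Gamma> has_real_derivative \<Gamma>' t) (at t)"
            using d\<Gamma>[of t] at_within_interior[of t "{t1..t2}"] by simp
          then have "((\<lambda>t. m t + \<Gamma> t) has_real_derivative (- (m t)\<^sup>2 - 1/4 * (a t - r t)\<^sup>2 + p' t) + \<Gamma>' t) (at t)"
            by (intro DERIV_add elim)
          moreover have "(- (m t)\<^sup>2 - 1/4 * (a t - r t)\<^sup>2 + p' t) + \<Gamma>' t \<le> - (m t + \<Gamma> t - \<Delta> t)\<^sup>2 + p' t - \<eta>"
          proof -
            have "\<bar>\<Gamma> t - \<Delta> t\<bar> \<le> \<epsilon>" using close[of t] e(2) \<epsilon>(1) by linarith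
            from quadratic_perturbation[OF m this \<epsilon>(2) \<epsilon>2, of t]
            show ?thesis using \<eta>2[of t] t \<eta> by (simp add: add_diff_eq)
          qed
          ultimately show ?C by blast
        qed
      qed
      show "\<bar>m t + \<Gamma> t\<bar> \<le> M" for t using m[of t] GB[of t] M(1) B by (auto simp: abs_le_iff)
      show "2 * (M + B) * \<bar>0\<bar> \<le> \<eta>" using \<eta> by simp
    qed
    obtain xb where xb: "xb s1 = m s1 + L2 + \<kappa>" "\<And>T. tsol \<Delta> p' M s1 T xb"
      using tsol_exists[OF \<Delta> pB M1(2)] by blast
    obtain Xb where Xb: "Xb s2 = m s2 + L1 - \<kappa>" "\<And>T. tsol \<Delta> p' M T s2 Xb"
      using tsol_exists_backward[OF \<Delta> pB M1(2)] by blast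
    have x1: "m t1 + \<Gamma> t1 < xb t1"
      by (rule bar1[OF \<Delta> _ xb(2,1)]) (use close e(3) order_trans in blast)
    have x2: "Xb t2 < m t2 + \<Gamma> t2"
      by (rule bar2[OF \<Delta> _ Xb(2,1)]) (use close e(4) order_trans in blast)
    have "\<exists>a r. attractor_repeller_pair \<Delta> p' a r"
    proof (rule attractor_repeller_pair_if_barrier[OF \<Delta> pB M1(1) \<kappa>(1), of s1 t1 t2 s2 "\<lambda>t. m t + L2" "\<lambda>t. m t + L1" xb "\<lambda>t. m t + \<Gamma> t" Xb])
      show "s1 \<le> t1" "t1 \<le> t2" "t2 \<le> s2" using s1 s2 t12 by (auto simp: Tm_def Tp_def)
      show "tsub \<Delta> p' M c s1 (\<lambda>t. m t + L2 + \<kappa>)" "tsub \<Delta> p' M c s1 (\<lambda>t. m t + L2 + 2 * \<kappa>)" for c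
        using lm[of \<kappa> c] lm[of "2 * \<kappa>" c] \<kappa> by auto
      show "tsub \<Delta> p' M s2 d (\<lambda>t. m t + L1 - \<kappa>)" "tsub \<Delta> p' M s2 d (\<lambda>t. m t + L1 - 2 * \<kappa>)" for d
        using lp[of "- \<kappa>" d] lp[of "- 2 * \<kappa>" d] \<kappa> by auto
      show "m t + L2 + 2 * \<kappa> \<le> M" for t using yM[OF lim_bound(2), of t] \<kappa> by (simp add: abs_le_iff)
      show "- M \<le> m t + L1 - 2 * \<kappa>" for t using yM[OF lim_bound(1), of t] \<kappa> by (simp add: abs_le_iff)
      show "tsub \<Delta> p' M t1 t2 (\<lambda>t. m t + \<Gamma> t)" using ly by simp
    qed (use xb Xb x1 x2 in auto)
    then show ?thesis unfolding \<Delta>_def using attractor_repeller_pair_cong_AE[OF p'(2)] by blast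
  qed
  then show ?thesis using h0(1) by blast
qed

theorem theorem6p7:
  fixes p \<Gamma> a r :: "real \<Rightarrow> real"
  assumes "p \<in> Linf"
    and "attractor_repeller_pair (\<lambda>t. 0) p a r"
    and "bounded (range \<Gamma>)"
    and "continuous_on UNIV \<Gamma>"
    and "\<exists>L. (\<Gamma> \<longlongrightarrow> L) at_top"
    and "\<exists>L. (\<Gamma> \<longlongrightarrow> L) at_bot"
  shows
    "(\<forall>t1 t2 A a0 R r0.
        t1 < t2 \<and>
        upper_special_solution (sample 0 \<Gamma>) p A a0 \<and>
        lower_special_solution (sample 0 \<Gamma>) p R r0 \<and>
        t1 \<in> A \<and> a0 t1 - \<Gamma> t1 > convex_comb a r (1/2) t1 \<and>
        t2 \<in> R \<and> r0 t2 - \<Gamma> t2 < convex_comb a r (1/2) t2 \<and>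
        C2_on {t1..t2} \<Gamma> \<and>
        (\<forall>t\<in>{t1..t2}. 1/4 * (a t - r t)\<^sup>2 > vector_derivative \<Gamma> (at t within {t1..t2}))
        \<longrightarrow> (\<exists>h_max>0. \<forall>h\<in>{0..h_max}. \<exists>ah rh. attractor_repeller_pair (sample h \<Gamma>) p ah rh)) \<and>
     (C2_on UNIV \<Gamma> \<and>
        ereal (1/4 * (INF t. (a t - r t)\<^sup>2)) > (SUP t. ereal (deriv \<Gamma> t))
        \<longrightarrow> (\<exists>h_max>0. \<forall>h\<in>{0..h_max}. total_tracking_on_hull (sample h \<Gamma>) p))"
proof -
  obtain G where G: "\<And>t. \<bar>\<Gamma> t\<bar> \<le> G" using assms(3) by (auto simp: bounded_iff)
  obtain L1 L2 where L: "(\<Gamma> \<longlongrightarrow> L1) at_top" "(\<Gamma> \<longlongrightarrow> L2) at_bot" using assms(5,6) by blast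
  have s0: "sample 0 \<Gamma> = \<Gamma>" by (simp add: sample_def fun_eq_iff)
  show ?thesis
  proof (intro conjI allI impI, goal_cases)
    case (1 t1 t2 A a0 R r0)
    note * = this
    then obtain \<Gamma>' \<Gamma>'' where d: "\<And>t. t \<in> {t1..t2} \<Longrightarrow> (\<Gamma> has_real_derivative \<Gamma>' t) (at t within {t1..t2})"
      "\<And>t. t \<in> {t1..t2} \<Longrightarrow> (\<Gamma>' has_real_derivative \<Gamma>'' t) (at t within {t1..t2})"
      unfolding C2_on_def by blast
    have t12: "t1 < t2" using * by blast
    have vd: "vector_derivative \<Gamma> (at t within {t1..t2}) = \<Gamma>' t" if "t \<in> {t1..t2}" for t
      using vector_derivative_within_cbox[of t1 t2 t \<Gamma> "\<Gamma>' t"] d(1)[OF that] t12 that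
      by (simp add: has_real_derivative_iff_has_vector_derivative)
    show ?case
    proof (rule tracking_for_small_steps[OF assms(1,2) G assms(4) L t12 _ _ _ _ d(1)])
      \<comment> \<open>As t1 and t2 lie in the domains, the defining equivalences can be read at x0
        = a0 t1 and x0 = r0 t2.\<close>
      show "bounded_in_past \<Gamma> p t1 (a0 t1)" "bounded_in_future \<Gamma> p t2 (r0 t2)"
        using * by (auto simp: upper_special_solution_def lower_special_solution_def s0)
      have "1/2 * a t1 + 1/2 * r t1 < a0 t1 - \<Gamma> t1" using * by (simp add: convex_comb_def)
      then show "1/2 * (a t1 + r t1) + \<Gamma> t1 < a0 t1" by (simp add: field_simps)
      have "r0 t2 - \<Gamma> t2 < 1/2 * a t2 + 1/2 * r t2" using * by (simp add: convex_comb_def)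
      then show "r0 t2 < 1/2 * (a t2 + r t2) + \<Gamma> t2" by (simp add: field_simps)
      show "continuous_on {t1..t2} \<Gamma>'" using d(2) by (rule DERIV_continuous_on)
      show "\<Gamma>' t < 1/4 * (a t - r t)\<^sup>2" if "t \<in> {t1..t2}" for t using * vd[OF that] that by fastforce
    qed
  next
    case 2
    note * = this
    then obtain \<Gamma>' \<Gamma>'' where d: "\<And>t. (\<Gamma> has_real_derivative \<Gamma>' t) (at t)"
      "\<And>t. (\<Gamma>' has_real_derivative \<Gamma>'' t) (at t)"
      unfolding C2_on_def by auto
    have dd: "deriv \<Gamma> t = \<Gamma>' t" for t using d(1) by (rule DERIV_imp_deriv)
    define I where "I = 1/4 * (INF t. (a t - r t)\<^sup>2)"
    \<comment> \<open>The supremum is an extended real, so a real number is inserted below the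
      infimum term I; (I - y) / 2 then serves as \<eta>.\<close>
    obtain y where y: "(SUP t. ereal (\<Gamma>' t)) < ereal y" "y < I"
      using * ereal_dense2[of "SUP t. ereal (\<Gamma>' t)" "ereal I"] by (auto simp: dd I_def)
    have le_y: "\<Gamma>' t \<le> y" for t
    proof -
      have "ereal (\<Gamma>' t) \<le> (SUP t. ereal (\<Gamma>' t))" by (rule SUP_upper) simp
      then have "ereal (\<Gamma>' t) \<le> ereal y" using y(1) by (metis less_imp_le order_trans)
      then show ?thesis by simp
    qed
    have I_le: "I \<le> 1/4 * (a t - r t)\<^sup>2" for t
    proof -
      have "(INF t. (a t - r t)\<^sup>2) \<le> (a t - r t)\<^sup>2" by (rule cINF_lower) (auto intro!: bdd_belowI[of _ 0])
      then show ?thesis by (simp add: I_def)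
    qed
    show ?case
    proof (rule total_tracking[OF assms(1,2) G assms(4) L d(1)])
      show "continuous_on UNIV \<Gamma>'" using d(2) by (intro DERIV_continuous_on[of UNIV]) auto
      show "(I - y) / 2 > 0" using y(2) by simp
      show "\<Gamma>' t + 2 * ((I - y) / 2) \<le> 1/4 * (a t' - r t')\<^sup>2" for t t'
        using le_y[of t] I_le[of t'] by (simp add: field_simps)
    qed
  qed
qed

end
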